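(* Let $(\mathbb{B},\|\cdot\|)$ be a real separable Banach space and consider the multiple change point model $X_n=\varepsilon_n+\sum_{k=1}^{K+1}\mu^{(k)}\mathbb{I}\{c_{k-1}<n\le c_k\}$, $n=1,\dots,N$, of the context. Let $\rho$ be a polynomial weight ($\rho(x)=x^\beta$, $\beta\in[0,1/2)$) or a logarithmic weight ($\rho(x)=x^{1/2}\log^\beta(x^{-1})$, $\beta>1/2$). Suppose that: (1) the Hölder convergence assumption of the context holds for $\rho$, with limit process $W$; (2) the mean parameters $\mu^{(k)}$ are bounded in norm uniformly in $k$ and $N$, and, with $\delta_k=\min(c_{k+1}-c_k,c_k-c_{k-1})$ and $\Delta_k=\|\mu^{(k+1)}-\mu^{(k)}\|$, $$\min_{k=1,\dots,K}\delta_k^{1-\beta}\Delta_k\gg N^{1/2-\beta}\quad\text{if }\rho(x)=x^\beta,\qquad \min_{k=1,\dots,K}\delta_k^{1/2}\Delta_k\gg\log^\beta(N)\quad\text{if }\rho(x)=x^{1/2}\log^\beta(x^{-1}).$$ For all $N$ let $\mathbf{N}_N$ be $\mathbf{N}^{all}$, or for all $N$ let $\mathbf{N}_N$ be $\mathbf{N}_N^\theta$ for some fixed $\theta>1$. Let $\alpha\in(0,1)$, let $q_{1-\alpha}$ be the upper $\alpha$-quantile (the $(1-\alpha)$-quantile) of $L^\rho$, and let $\mathbf{C}$ be the output of MultiScan$(\emptyset,\mathbf{N}_N,q_{1-\alpha})$. Then the strong localization property holds, namely: (a) $\liminf_{N\to\infty}\mathbb{P}\big(\forall (n,h)\in\mathbf{C}\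 \exists k\in\{1,\dots,K\}:\ n-h+1\le c_k\le n+h\big)\ge 1-\alpha$; (b) there is a fixed constant $C_0>0$ (not depending on $N$ or $k$; it depends on the covariance structure of $W$) such that, with probability converging to $1$ as $N\to\infty$, simultaneously for all $k=1,\dots,K$ there exists a unique pair $(n_k,h_k)\in\mathbf{C}$ with $$n_k-h_k+1\le c_k\le n_k+h_k,$$ and it satisfies $$h_k\le C_0\cdot\begin{cases}\left(\dfrac{N^{1/2-\beta}}{\Delta_k}\right)^{\frac1{1-\beta}}&\text{for }\rho(x)=x^\beta,\\[2mm] \dfrac{\log^{2\beta}(N)}{\Delta_k^2}&\text{for }\rho(x)=x^{1/2}\log^\beta(x^{-1}).\end{cases}$$
   Context: Notation: for positive sequences, $a_N\ll b_N$ (equivalently $b_N\gg a_N$) means $a_N/b_N\to0$ as $N\to\infty$. Model. $(\mathbb{B},\|\cdot\|)$ is a real separable Banach space with dual $\mathbb{B}'$. For each $N$ one observes $X_1,\dots,X_N$ with $X_n=\varepsilon_n+\sum_{k=1}^{K+1}\mu^{(k)}\mathbb{I}\{c_{k-1}<n\le c_k\}$, where $K\ge 0$, $c_0:=0<c_1<\dots<c_K<c_{K+1}:=N$ are integers, $\mu^{(1)},\dots,\mu^{(K+1)}\in\mathbb{B}$ with $\mu^{(k)}\ne\mu^{(k+1)}$, and the $\varepsilon_n$ are centered $\mathbb{B}$-valued random variables (not necessarily stationary or independent). All quantities $K,c_k,\mu^{(k)}$ and the error distribution may depend on $N$ (the errors form a triangular array). Hölder space. For polynomial weights, $\|f\|_\rho=\sup_{x\in[0,1]}\|f(x)\|+\sup_{0\le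 x<y\le 1}\frac{\|f(y)-f(x)\|}{\rho(y-x)}$; for logarithmic weights the second supremum is taken over pairs with $y-x\le 1/2$ only. $\mathcal{C}^\rho([0,1],\mathbb{B})$ is the space of continuous $f:[0,1]\to\mathbb{B}$ with $\|f\|_\rho<\infty$ and $\lim_{\delta\downarrow0}\sup_{0\le x<y\le x+\delta\le 1}\|f(y)-f(x)\|/\rho(y-x)=0$, normed by $\|\cdot\|_\rho$. (For $\beta=0$ the polynomial weight is $1$ on $(0,1]$.) Hölder convergence assumption for $\rho$. Let $P_N(x)=N^{-1/2}\sum_{i=1}^{\lfloor xN\rfloor}\varepsilon_i+N^{-1/2}(Nx-\lfloor Nx\rfloor)\varepsilon_{\lfloor Nx\rfloor+1}$, $x\in[0,1]$. Then $P_N$ converges weakly in $\mathcal{C}^\rho([0,1],\mathbb{B})$ to a centered Gaussian process $W$ characterized by the covariance function $C^\varepsilon(x,y)[f,g]=\lim_{N\to\infty}\mathbb{E}[f[P_N(x)]\,g[P_N(y)]]$, $x,y\in[0,1]$, $f,g\in\mathbb{B}'$, which is continuous in all arguments. The limit is non-degenerate: the Gaussian process of second differences $W(x+y)-2W(x)+W(x-y)$ is not almost surely identically zero. Limit variable. $\blacktriangle_{0,1}=\{(x,y):x\in[0,1],\,y\in(0,\min\{x,1-x\}]\}$ and $L^\rho=\sup_{(x,y)\in\blacktriangle_{0,1}}\|W(x+y)-2W(x)+W(x-y)\|/\rho(y)$. Index sets. $\mathbf{N}^{all}=\{(n,h)\text{ integers}:1\le n-h+1<n+h\le N\}$; for $\theta>1$,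 $\mathbf{N}_N^\theta=\{(n,h)\in\mathbf{N}^{all}:\exists m\in\mathbb{N},\ h=\lfloor\theta^m\rfloor\}$. The pair $(n,h)$ corresponds to the interval $[n-h+1,n+h]$. Order: $(n,h)\preceq(n',h')$ iff $h<h'$, or $h=h'$ and $n<n'$. Scan statistic. $S_i^j=\sum_{\ell=i}^jX_\ell$ and $\gamma(n,h)=\|S_{n-h+1}^n-S_{n+1}^{n+h}\|/(N^{1/2}\rho(h/N))$. Algorithm MultiScan$(\mathbf{C},\mathbf{N},q)$. If $\mathbf{N}=\emptyset$, return $\mathbf{C}$. Otherwise run through $(n,h)\in\mathbf{N}$ in increasing order with respect to $\preceq$. At the first $(n,h)$ with $\gamma(n,h)>q$, let $n^{\max}$ be a maximizer of $\gamma(n',h)$ over $n'$ with $n-h+1<n'<n+h$, $(n',h)\in\mathbf{N}$ (with $n^{\max}=n$ if $h=1$); replace $\mathbf{C}$ by $\mathbf{C}\cup\{(n^{\max},h)\}$; replace $\mathbf{N}$ by $\mathbf{N}\circleddash(n^{\max},h)$, where $\mathbf{N}\circleddash(m,h)=\{(n',h')\in\mathbf{N}:(m,h)\preceq(n',h'),\ [n'-h'+1,n'+h']\cap[m-h+1,m+h]=\emptyset\}$; and call MultiScan recursively with the updated $\mathbf{C},\mathbf{N}$ and the same $q$. If no pair in $\mathbf{N}$ satisfies $\gamma(n,h)>q$, return $\mathbf{C}$. *)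

theory Defs
  imports "HOL-Probability.Probability"
begin

datatype weight = Poly_weight real | Log_weight real

fun valid_weight :: "weight \<Rightarrow> bool" where
  "valid_weight (Poly_weight \<beta>) \<longleftrightarrow> 0 \<le> \<beta> \<and> \<beta> < 1/2"
| "valid_weight (Log_weight \<beta>) \<longleftrightarrow> 1/2 < \<beta>"

text \<open>Only evaluated at \<open>x > 0\<close>, and for logarithmic weights only at \<open>x \<le> 1/2\<close>, where it is positive;
  note \<open>x powr 0 = 1\<close> for \<open>x > 0\<close>.\<close>

fun rho :: "weight \<Rightarrow> real \<Rightarrow> real" where
  "rho (Poly_weight \<beta>) x = x powr \<beta>"
| "rho (Log_weight \<beta>) x = x powr (1/2) * ln (1 / x) powr \<beta>"

text \<open>The largest increment \<open>y - x\<close> admitted in the Hoelder seminorm.\<close>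

fun max_lag :: "weight \<Rightarrow> real" where
  "max_lag (Poly_weight \<beta>) = 1"
| "max_lag (Log_weight \<beta>) = 1/2"

definition holder_quotient :: "weight \<Rightarrow> (real \<Rightarrow> 'b::real_normed_vector) \<Rightarrow> real \<times> real \<Rightarrow> ennreal" where
  "holder_quotient w f = (\<lambda>(x, y). ennreal (norm (f y - f x) / rho w (y - x)))"

definition holder_norm :: "weight \<Rightarrow> (real \<Rightarrow> 'b::real_normed_vector) \<Rightarrow> ennreal" where
  "holder_norm w f =
     (SUP x\<in>{0..1}. ennreal (norm (f x))) +
     (SUP p\<in>{(x, y). 0 \<le> x \<and> x < y \<and> y \<le> 1 \<and> y - x \<le> max_lag w}. holder_quotient w f p)"

text \<open>Functions on \<open>[0,1]\<close> are represented as functions on the reals that are \<open>undefined\<close> outside \<open>[0,1]\<close>.\<close>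

definition holder_space :: "weight \<Rightarrow> (real \<Rightarrow> 'b::real_normed_vector) set" where
  "holder_space w = {f \<in> extensional {0..1}.
     continuous_on {0..1} f \<and> holder_norm w f < \<infinity> \<and>
     ((\<lambda>\<delta>. SUP p\<in>{(x, y). 0 \<le> x \<and> x < y \<and> y \<le> x + \<delta> \<and> x + \<delta> \<le> 1}. holder_quotient w f p)
        \<longlongrightarrow> 0) (at_right 0)}"

definition holder_dist :: "weight \<Rightarrow> (real \<Rightarrow> 'b::real_normed_vector) \<Rightarrow> (real \<Rightarrow> 'b) \<Rightarrow> real" where
  "holder_dist w f g = enn2real (holder_norm w (\<lambda>x. f x - g x))"

lemma holder_norm_minus_commute:
  "holder_norm w (\<lambda>x. f x - g x) = holder_norm w (\<lambda>x. g x - f x)"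
proof -
  have "norm (f y - g y - (f x - g x)) = norm (g y - f y - (g x - f x))" for x y
    by (metis minus_diff_eq norm_minus_cancel minus_diff_minus)
  then show ?thesis
    by (simp add: holder_norm_def holder_quotient_def norm_minus_commute)
qed

lemma rho_nonneg: "0 \<le> x \<Longrightarrow> 0 \<le> rho w x"
  by (cases w) auto

lemma holder_norm_triangle:
  "holder_norm w (\<lambda>x. f x - h x) \<le> holder_norm w (\<lambda>x. f x - g x) + holder_norm w (\<lambda>x. g x - h x)"
proof -
  let ?I = "{(x, y). 0 \<le> x \<and> x < y \<and> y \<le> 1 \<and> y - x \<le> max_lag w}"
  let ?A = "\<lambda>f. SUP x\<in>{0..1::real}. ennreal (norm (f x :: 'a))"
  let ?B = "\<lambda>f. SUP p\<in>?I. holder_quotient w (f :: real \<Rightarrow> 'a) p"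
  have 1: "?A (\<lambda>x. f x - h x) \<le> ?A (\<lambda>x. f x - g x) + ?A (\<lambda>x. g x - h x)"
  proof (rule SUP_least)
    fix x :: real assume x: "x \<in> {0..1}"
    have "ennreal (norm (f x - h x)) \<le> ennreal (norm (f x - g x)) + ennreal (norm (g x - h x))"
    proof -
      have "norm (f x - h x) \<le> norm (f x - g x) + norm (g x - h x)"
        using norm_triangle_ineq[of "f x - g x" "g x - h x"] by simp
      then show ?thesis
        by (metis ennreal_leI ennreal_plus norm_ge_zero)
    qed
    also have "\<dots> \<le> ?A (\<lambda>x. f x - g x) + ?A (\<lambda>x. g x - h x)"
      using x by (intro add_mono) (auto intro!: SUP_upper2[of x])
    finally show "ennreal (norm (f x - h x)) \<le> \<dots>" .
  qed
  have 2: "?B (\<lambda>x. f x - h x) \<le> ?B (\<lambda>x. f x - g x) + ?B (\<lambda>x. g x - h x)"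
  proof (rule SUP_least)
    fix p assume p: "p \<in> ?I"
    obtain x y where xy: "p = (x, y)" by force
    have r: "0 \<le> rho w (y - x)" using p xy by (intro rho_nonneg) auto
    define a where "a = f y - g y - (f x - g x)"
    define b where "b = g y - h y - (g x - h x)"
    have "norm (f y - h y - (f x - h x)) = norm (a + b)"
      by (rule arg_cong[where f = norm]) (simp add: a_def b_def algebra_simps)
    also have "\<dots> \<le> norm a + norm b"
      by (rule norm_triangle_ineq)
    finally have "norm (f y - h y - (f x - h x)) / rho w (y - x) \<le>
        norm a / rho w (y - x) + norm b / rho w (y - x)"
      unfolding add_divide_distrib[symmetric] using r by (rule divide_right_mono)
    then have "ennreal (norm (f y - h y - (f x - h x)) / rho w (y - x)) \<le>
        ennreal (norm a / rho w (y - x)) + ennreal (norm b / rho w (y - x))"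
      using r by (metis divide_nonneg_nonneg ennreal_leI ennreal_plus norm_ge_zero)
    then have "holder_quotient w (\<lambda>x. f x - h x) p
        \<le> holder_quotient w (\<lambda>x. f x - g x) p + holder_quotient w (\<lambda>x. g x - h x) p"
      by (simp only: holder_quotient_def xy a_def b_def prod.case)
    also have "\<dots> \<le> ?B (\<lambda>x. f x - g x) + ?B (\<lambda>x. g x - h x)"
      by (rule add_mono; rule SUP_upper[OF p])
    finally show "holder_quotient w (\<lambda>x. f x - h x) p \<le> \<dots>" .
  qed
  show ?thesis
    using add_mono[OF 1 2] unfolding holder_norm_def by (simp only: ac_simps)
qed

lemma Metric_space_holder:
  "Metric_space (holder_space w :: (real \<Rightarrow> 'b::real_normed_vector) set) (holder_dist w)"
proof
  fix f g h :: "real \<Rightarrow> 'b"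
  show "0 \<le> holder_dist w f g" by (simp add: holder_dist_def)
  show "holder_dist w f g = holder_dist w g f"
    by (simp add: holder_dist_def holder_norm_minus_commute[of w f g])
  have fin: "holder_norm w (\<lambda>x. f x - g x) < \<infinity>"
    if "f \<in> holder_space w" "g \<in> holder_space w" for f g :: "real \<Rightarrow> 'b"
  proof -
    have "holder_norm w (\<lambda>x. 0 - g x) = holder_norm w g"
      using holder_norm_minus_commute[of w "\<lambda>_. 0" g] by simp
    then have "holder_norm w (\<lambda>x. f x - g x) \<le> holder_norm w f + holder_norm w g"
      using holder_norm_triangle[of w f g "\<lambda>_. 0"] by simp
    also have "\<dots> < \<infinity>"
      using that by (simp add: holder_space_def)
    finally show ?thesis .
  qed
  assume f: "f \<in> holder_space w" and g: "g \<in> holder_space w"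
  show "holder_dist w f g = 0 \<longleftrightarrow> f = g"
  proof
    assume "holder_dist w f g = 0"
    then have zero: "holder_norm w (\<lambda>x. f x - g x) = 0"
      unfolding holder_dist_def enn2real_eq_0_iff
      using less_imp_neq[OF fin[OF f g]] unfolding infinity_ennreal_def by blast
    have sup_le: "(SUP x\<in>{0..1}. ennreal (norm (f x - g x))) \<le> 0"
      unfolding zero[symmetric] holder_norm_def by (rule add_increasing2) simp_all
    have "f x = g x" if "x \<in> {0..1}" for x
    proof -
      have "ennreal (norm (f x - g x)) \<le> (SUP x\<in>{0..1}. ennreal (norm (f x - g x)))"
        by (rule SUP_upper[OF that])
      then have "ennreal (norm (f x - g x)) = 0"
        using sup_le by (meson le_zero_eq order_trans)
      then show ?thesis
        by simp
    qed
    then show "f = g"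
      using f g unfolding holder_space_def by (intro extensionalityI[of f "{0..1}" g]) simp_all
  next
    assume "f = g"
    moreover have "holder_quotient w (\<lambda>x. 0 :: 'b) p = 0" for p
      by (cases p) (simp add: holder_quotient_def)
    moreover have "(SUP x\<in>A. 0 :: ennreal) = 0" for A :: "(real \<times> real) set"
      by (rule antisym[OF SUP_least]) simp_all
    ultimately show "holder_dist w f g = 0"
      by (simp add: holder_dist_def holder_norm_def)
  qed
  assume h: "h \<in> holder_space w"
  show "holder_dist w f h \<le> holder_dist w f g + holder_dist w g h"
    unfolding holder_dist_def enn2real_plus[OF fin[OF f g, simplified infinity_ennreal_def]
        fin[OF g h, simplified infinity_ennreal_def], symmetric]
    using fin[OF f g] fin[OF g h] by (intro enn2real_mono holder_norm_triangle) (simp add: ennreal_add_less_top)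
qed

definition holder_topology :: "weight \<Rightarrow> (real \<Rightarrow> 'b::real_normed_vector) topology" where
  "holder_topology w = Metric_space.mtopology (holder_space w) (holder_dist w)"

definition holder_borel :: "weight \<Rightarrow> (real \<Rightarrow> 'b::real_normed_vector) measure" where
  "holder_borel w = sigma (holder_space w) {U. openin (holder_topology w) U}"

definition weakly_converges_to ::
  "'x topology \<Rightarrow> (nat \<Rightarrow> 'a measure) \<Rightarrow> (nat \<Rightarrow> 'a \<Rightarrow> 'x) \<Rightarrow> 'c measure \<Rightarrow> ('c \<Rightarrow> 'x) \<Rightarrow> bool" where
  "weakly_converges_to T M Y M' Z \<longleftrightarrow>
     (\<forall>\<phi>. continuous_map T euclideanreal \<phi> \<and> bounded (\<phi> ` topspace T) \<longrightarrow>
        (\<lambda>N. \<integral>\<omega>. \<phi> (Y N \<omega>) \<partial>M N) \<longlonglongrightarrow> (\<integral>\<omega>. \<phi> (Z \<omega>) \<partial>M'))"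

text \<open>\<open>\<sigma> = 0\<close> is the degenerate normal distribution.\<close>

definition centered_normal :: "'c measure \<Rightarrow> ('c \<Rightarrow> real) \<Rightarrow> bool" where
  "centered_normal M Y \<longleftrightarrow> Y \<in> borel_measurable M \<and>
     (\<exists>\<sigma>\<ge>0. distr M borel Y =
        (if \<sigma> = 0 then return borel 0 else density lborel (normal_density 0 \<sigma>)))"

definition centered_gaussian_process :: "'c measure \<Rightarrow> ('c \<Rightarrow> real \<Rightarrow> 'b::real_normed_vector) \<Rightarrow> bool" where
  "centered_gaussian_process M W \<longleftrightarrow>
     (\<forall>(m::nat) (x :: nat \<Rightarrow> real) (f :: nat \<Rightarrow> 'b \<Rightarrow>\<^sub>L real). (\<forall>i<m. x i \<in> {0..1}) \<longrightarrow>
        centered_normal M (\<lambda>\<omega>. \<Sum>i<m. blinfun_apply (f i) (W \<omega> (x i))))"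

definition partial_sum_process ::
  "(nat \<Rightarrow> int \<Rightarrow> 'a \<Rightarrow> 'b::real_normed_vector) \<Rightarrow> nat \<Rightarrow> 'a \<Rightarrow> real \<Rightarrow> 'b" where
  "partial_sum_process \<epsilon> N \<omega> = (\<lambda>x\<in>{0..1}.
     (1 / sqrt (real N)) *\<^sub>R (\<Sum>i\<in>{1..\<lfloor>x * real N\<rfloor>}. \<epsilon> N i \<omega>) +
     (1 / sqrt (real N) * (real N * x - \<lfloor>real N * x\<rfloor>)) *\<^sub>R \<epsilon> N (\<lfloor>real N * x\<rfloor> + 1) \<omega>)"

definition scan_triangle :: "(real \<times> real) set" where
  "scan_triangle = {(x, y). x \<in> {0..1} \<and> y \<in> {0<..min x (1 - x)}}"

definition second_difference :: "(real \<Rightarrow> 'b::real_normed_vector) \<Rightarrow> real \<times> real \<Rightarrow> 'b" where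
  "second_difference f = (\<lambda>(x, y). f (x + y) - 2 *\<^sub>R f x + f (x - y))"

text \<open>The integrability clause makes the existence of the expectations defining \<open>C\<close> explicit.
  The process \<open>partial_sum_process \<epsilon> N\<close> is a continuous function of finitely many errors, so its
  measurability as a random element of the Hoelder space need not be assumed.\<close>

definition holder_convergence ::
  "weight \<Rightarrow> (nat \<Rightarrow> 'a measure) \<Rightarrow> (nat \<Rightarrow> int \<Rightarrow> 'a \<Rightarrow> 'b::real_normed_vector)
    \<Rightarrow> 'c measure \<Rightarrow> ('c \<Rightarrow> real \<Rightarrow> 'b) \<Rightarrow> bool" where
  "holder_convergence w M \<epsilon> M' W \<longleftrightarrow>
     W \<in> measurable M' (holder_borel w) \<and>
     weakly_converges_to (holder_topology w) M (partial_sum_process \<epsilon>) M' W \<and>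
     centered_gaussian_process M' W \<and>
     (\<exists>C :: real \<Rightarrow> real \<Rightarrow> ('b \<Rightarrow>\<^sub>L real) \<Rightarrow> ('b \<Rightarrow>\<^sub>L real) \<Rightarrow> real.
        (\<forall>x\<in>{0..1}. \<forall>y\<in>{0..1}. \<forall>f g.
           (\<forall>N\<ge>1. integrable (M N) (\<lambda>\<omega>. blinfun_apply f (partial_sum_process \<epsilon> N \<omega> x) *
                                       blinfun_apply g (partial_sum_process \<epsilon> N \<omega> y))) \<and>
           (\<lambda>N. \<integral>\<omega>. blinfun_apply f (partial_sum_process \<epsilon> N \<omega> x) *
                    blinfun_apply g (partial_sum_process \<epsilon> N \<omega> y) \<partial>M N) \<longlonglongrightarrow> C x y f g \<and>
           (\<integral>\<omega>. blinfun_apply f (W \<omega> x) * blinfun_apply g (W \<omega> y) \<partial>M') = C x y f g) \<and>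
        continuous_on ({0..1} \<times> {0..1} \<times> UNIV \<times> UNIV) (\<lambda>(x, y, f, g). C x y f g)) \<and>
     \<not> (AE \<omega> in M'. \<forall>p\<in>scan_triangle. second_difference (W \<omega>) p = 0)"

definition limit_statistic :: "weight \<Rightarrow> (real \<Rightarrow> 'b::real_normed_vector) \<Rightarrow> real" where
  "limit_statistic w f = (SUP (x, y)\<in>scan_triangle. norm (second_difference f (x, y)) / rho w y)"

definition quantile :: "'c measure \<Rightarrow> ('c \<Rightarrow> real) \<Rightarrow> real \<Rightarrow> real" where
  "quantile M Y p = Inf {t. p \<le> measure M {\<omega> \<in> space M. Y \<omega> \<le> t}}"

text \<open>Time indices are integers; \<open>N\<close>, the number \<open>K\<close> of change points and the index \<open>k\<close> are naturals.\<close>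

definition change_points :: "nat \<Rightarrow> nat \<Rightarrow> (nat \<Rightarrow> int) \<Rightarrow> (nat \<Rightarrow> 'b) \<Rightarrow> bool" where
  "change_points N K c \<mu> \<longleftrightarrow>
     c 0 = 0 \<and> c (K + 1) = int N \<and> (\<forall>k\<le>K. c k < c (k + 1)) \<and> (\<forall>k\<in>{1..K}. \<mu> k \<noteq> \<mu> (k + 1))"

definition observation ::
  "nat \<Rightarrow> (nat \<Rightarrow> int) \<Rightarrow> (nat \<Rightarrow> 'b::real_normed_vector) \<Rightarrow> (int \<Rightarrow> 'a \<Rightarrow> 'b) \<Rightarrow> int \<Rightarrow> 'a \<Rightarrow> 'b" where
  "observation K c \<mu> \<epsilon> n \<omega> =
     \<epsilon> n \<omega> + (\<Sum>k\<in>{1..K + 1}. if c (k - 1) < n \<and> n \<le> c k then \<mu> k else 0)"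

definition min_spacing :: "(nat \<Rightarrow> int) \<Rightarrow> nat \<Rightarrow> int" where
  "min_spacing c k = min (c (k + 1) - c k) (c k - c (k - 1))"

definition jump_size :: "(nat \<Rightarrow> 'b::real_normed_vector) \<Rightarrow> nat \<Rightarrow> real" where
  "jump_size \<mu> k = norm (\<mu> (k + 1) - \<mu> k)"

fun signal_strength :: "weight \<Rightarrow> int \<Rightarrow> real \<Rightarrow> real" where
  "signal_strength (Poly_weight \<beta>) \<delta> \<Delta> = real_of_int \<delta> powr (1 - \<beta>) * \<Delta>"
| "signal_strength (Log_weight \<beta>) \<delta> \<Delta> = real_of_int \<delta> powr (1/2) * \<Delta>"

fun detection_level :: "weight \<Rightarrow> nat \<Rightarrow> real" where
  "detection_level (Poly_weight \<beta>) N = real N powr (1/2 - \<beta>)"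
| "detection_level (Log_weight \<beta>) N = ln (real N) powr \<beta>"

text \<open>The minimum over an empty set of change points is read as \<open>\<infinity>\<close>,
  so that the ratio below is then \<open>0\<close>.\<close>

definition signal_dominates ::
  "weight \<Rightarrow> (nat \<Rightarrow> nat) \<Rightarrow> (nat \<Rightarrow> nat \<Rightarrow> int) \<Rightarrow> (nat \<Rightarrow> nat \<Rightarrow> 'b::real_normed_vector) \<Rightarrow> bool" where
  "signal_dominates w K c \<mu> \<longleftrightarrow>
     (\<lambda>N. if K N = 0 then 0
          else detection_level w N /
               (MIN k\<in>{1..K N}. signal_strength w (min_spacing (c N) k) (jump_size (\<mu> N) k)))
       \<longlonglongrightarrow> 0"

fun localization_rate :: "weight \<Rightarrow> nat \<Rightarrow> real \<Rightarrow> real" where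
  "localization_rate (Poly_weight \<beta>) N \<Delta> = (real N powr (1/2 - \<beta>) / \<Delta>) powr (1 / (1 - \<beta>))"
| "localization_rate (Log_weight \<beta>) N \<Delta> = ln (real N) powr (2 * \<beta>) / \<Delta>\<^sup>2"

definition scan_statistic :: "weight \<Rightarrow> nat \<Rightarrow> (int \<Rightarrow> 'b::real_normed_vector) \<Rightarrow> int \<times> int \<Rightarrow> real" where
  "scan_statistic w N X = (\<lambda>(n, h).
     norm ((\<Sum>l\<in>{n - h + 1..n}. X l) - (\<Sum>l\<in>{n + 1..n + h}. X l)) /
       (sqrt (real N) * rho w (real_of_int h / real N)))"

definition all_pairs :: "nat \<Rightarrow> (int \<times> int) set" where
  "all_pairs N = {(n, h). 1 \<le> n - h + 1 \<and> n - h + 1 < n + h \<and> n + h \<le> int N}"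

text \<open>The parameter \<open>m\<^sub>0\<close> is the least natural number, to cover both conventions (0 or 1).\<close>

definition geometric_pairs :: "nat \<Rightarrow> real \<Rightarrow> nat \<Rightarrow> (int \<times> int) set" where
  "geometric_pairs m\<^sub>0 \<theta> N = {(n, h) \<in> all_pairs N. \<exists>m\<ge>m\<^sub>0. h = \<lfloor>\<theta> ^ m\<rfloor>}"

fun pair_interval :: "int \<times> int \<Rightarrow> int set" where
  "pair_interval (n, h) = {n - h + 1..n + h}"

fun precedes :: "int \<times> int \<Rightarrow> int \<times> int \<Rightarrow> bool" where
  "precedes (n, h) (n', h') \<longleftrightarrow> h < h' \<or> (h = h' \<and> n < n')"

definition prune :: "(int \<times> int) set \<Rightarrow> int \<times> int \<Rightarrow> (int \<times> int) set" where
  "prune A p = {p' \<in> A. precedes p p' \<and> pair_interval p' \<inter> pair_interval p = {}}"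

definition first_exceedance ::
  "(int \<times> int \<Rightarrow> real) \<Rightarrow> real \<Rightarrow> (int \<times> int) set \<Rightarrow> int \<times> int \<Rightarrow> bool" where
  "first_exceedance \<gamma> q A p \<longleftrightarrow>
     p \<in> A \<and> q < \<gamma> p \<and> (\<forall>p'\<in>A. q < \<gamma> p' \<longrightarrow> p' = p \<or> precedes p p')"

definition local_maximizer ::
  "(int \<times> int \<Rightarrow> real) \<Rightarrow> (int \<times> int) set \<Rightarrow> int \<Rightarrow> int \<Rightarrow> int \<Rightarrow> bool" where
  "local_maximizer \<gamma> A n h m \<longleftrightarrow>
     (if h = 1 then m = n
      else m \<in> {n'. n - h + 1 < n' \<and> n' < n + h \<and> (n', h) \<in> A} \<and>
           (\<forall>n'\<in>{n'. n - h + 1 < n' \<and> n' < n + h \<and> (n', h) \<in> A}. \<gamma> (n', h) \<le> \<gamma> (m, h)))"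

text \<open>\<open>multiscan \<gamma> q C A R\<close>: some run of MultiScan on \<open>(C, A, q)\<close> returns \<open>R\<close>.
  It is a relation because the choice among several maximizers is left open.\<close>

inductive multiscan ::
  "(int \<times> int \<Rightarrow> real) \<Rightarrow> real \<Rightarrow> (int \<times> int) set \<Rightarrow> (int \<times> int) set \<Rightarrow> (int \<times> int) set \<Rightarrow> bool"
  for \<gamma> q where
  stop: "(\<And>p. p \<in> A \<Longrightarrow> \<not> q < \<gamma> p) \<Longrightarrow> multiscan \<gamma> q C A C"
| step: "first_exceedance \<gamma> q A (n, h) \<Longrightarrow> local_maximizer \<gamma> A n h m \<Longrightarrow>
         multiscan \<gamma> q (C \<union> {(m, h)}) (prune A (m, h)) R \<Longrightarrow> multiscan \<gamma> q C A R"

end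

theory Submission
  imports Defs
begin

text \<open>
  A pair whose interval contains no change point has the same statistic as the noise, and the noise statistics are
  second differences of the partial sum process at grid points. So the output has no false positives
  when the supremum over a countable dense set of second differences of the partial sum process is at most \<open>q\<close>.
  By weak convergence this has asymptotic probability at least \<open>P(L < q)\<close>, and it remains to see that the
  distribution of \<open>L\<close> has no atom at \<open>q > 0\<close>. Write \<open>L\<close> as the supremum of a jointly Gaussian sequence \<open>X j\<close>.
  Coordinates of small variance do not reach \<open>q\<close>, by separability of the path space. For the others, normalise to
  \<open>(X j - q) / sd j\<close>: given that the maximum is attained at \<open>i\<close>, moving \<open>X i\<close> upwards keeps it there, so
  the mass just below the level 0 is, up to a constant, bounded by the mass of each of \<open>m\<close> disjoint intervals of the same
  length above 0 (Ylvisaker's argument).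

  For the second part, fix a multiple \<open>h\<close> of the localization rate at which the signal at \<open>c k\<close> exceeds \<open>2 q\<close>.
  By the signal condition \<open>h\<close> is negligible against both \<open>N\<close> and the spacing. At such scales the
  noise is below \<open>q / 2\<close> with high probability because Hoelder paths have vanishing small-scale oscillation. Hence \<open>(c k, h)\<close> is an
  exceedance, and since pairs are scanned in increasing order it can only be suppressed by an output pair that is
  at most as long, contains a change point and meets its interval; that change point must be \<open>c k\<close>.
\<close>

section \<open>Norming functionals\<close>

text \<open>The level \<open>q\<close> is itself a quantile, and weak convergence only compares a
  limit event at a level \<open>a\<close> with a finite-sample event at a level
  \<open>b > a\<close>. So mass close to \<open>1 - \<alpha>\<close> has to be found strictly below
  \<open>q\<close>; this is why atoms matter. The paths are Banach valued, and a countable norming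
  family of functionals replaces a bound on a norm by countably many one-sided linear inequalities,
  which yields measurability as well as the Gaussian sequence. Shifting a normal coordinate to the
  right costs a factor \<open>exp (q / s + 1)\<close>, where \<open>s\<close> bounds the standard
  deviations from below. The factor explodes as \<open>s\<close> tends to 0, which forces the
  separate treatment of small variances; it is free of the number of coordinates, which permits
  infinite sequences. In the second part there is slack between noise \<open>q / 2\<close>,
  threshold \<open>q\<close> and signal \<open>2 * q\<close>, so \<open>q > 0\<close> is all that is
  needed about \<open>q\<close>. There \<open>C\<^sub>0\<close> is
  \<open>(2 * q) powr (1 / x) + 1\<close>, with \<open>x\<close> the exponent of the spacing in the
  signal condition, times the cost \<open>\<theta>\<close> of rounding up to a power of
  \<open>\<theta>\<close>.\<close>

definition sublinear :: "('a::real_vector \<Rightarrow> real) \<Rightarrow> bool" where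
  "sublinear p \<longleftrightarrow> (\<forall>x y. p (x + y) \<le> p x + p y) \<and> (\<forall>c x. 0 \<le> c \<longrightarrow> p (c *\<^sub>R x) = c * p x)"

lemma sublinear_add: "sublinear p \<Longrightarrow> p (x + y) \<le> p x + p y"
  and sublinear_scale: "sublinear p \<Longrightarrow> 0 \<le> c \<Longrightarrow> p (c *\<^sub>R x) = c * p x"
  by (auto simp: sublinear_def)

lemma sublinear_zero: "sublinear p \<Longrightarrow> p 0 = 0"
  using sublinear_scale[of p 0 0] by simp

lemma sublinear_minus: "sublinear p \<Longrightarrow> - p (- x) \<le> p x"
  using sublinear_add[of p x "- x"] sublinear_zero[of p] by simp

lemma sublinear_norm: "sublinear (norm :: 'a::real_normed_vector \<Rightarrow> real)"
  by (simp add: sublinear_def norm_triangle_ineq)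

text \<open>The classical lowering in proofs of the Hahn-Banach theorem: for sublinear
  \<open>p\<close> it stays below \<open>p\<close> and takes the value \<open>- p y\<close> at
  \<open>- y\<close>, so a linear functional below it must agree with \<open>p\<close> at
  \<open>y\<close>.\<close>

definition lower_along :: "('a::real_vector \<Rightarrow> real) \<Rightarrow> 'a \<Rightarrow> 'a \<Rightarrow> real" where
  "lower_along p y x = (INF t\<in>{0..}. p (x + t *\<^sub>R y) - t * p y)"

lemma lower_along_bdd:
  assumes "sublinear p" shows "bdd_below ((\<lambda>t. p (x + t *\<^sub>R y) - t * p y) ` {0..})"
proof (rule bdd_belowI2[where m = "- p (- x)"])
  fix t :: real assume "t \<in> {0..}"
  then have "t * p y = p (t *\<^sub>R y)" by (simp add: sublinear_scale[OF assms])
  also have "\<dots> \<le> p (x + t *\<^sub>R y) + p (- x)"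
    using sublinear_add[OF assms, of "x + t *\<^sub>R y" "- x"] by simp
  finally show "- p (- x) \<le> p (x + t *\<^sub>R y) - t * p y" by simp
qed

lemma lower_along_le:
  assumes "sublinear p" "0 \<le> t" shows "lower_along p y x \<le> p (x + t *\<^sub>R y) - t * p y"
  unfolding lower_along_def using assms by (intro cINF_lower lower_along_bdd) auto

lemma lower_along_le_self: "sublinear p \<Longrightarrow> lower_along p y x \<le> p x"
  using lower_along_le[of p 0 y x] by simp

lemma sublinear_lower_along:
  assumes p: "sublinear p" shows "sublinear (lower_along p y)"
  unfolding sublinear_def
proof safe
  fix a b :: 'a
  have "lower_along p y (a + b) - (p (b + t *\<^sub>R y) - t * p y) \<le> p (a + s *\<^sub>R y) - s * p y"
    if "0 \<le> s" "0 \<le> t" for s t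
  proof -
    \<comment> \<open>Parameters add: \<open>s\<close> for \<open>a\<close> and \<open>t\<close> for
      \<open>b\<close> give the admissible parameter \<open>s + t\<close> for
      \<open>a + b\<close>.\<close>
    have "lower_along p y (a + b) \<le> p ((a + s *\<^sub>R y) + (b + t *\<^sub>R y)) - (s + t) * p y"
      using lower_along_le[OF p, of "s + t" y "a + b"] that by (simp add: algebra_simps)
    then show ?thesis using sublinear_add[OF p, of "a + s *\<^sub>R y" "b + t *\<^sub>R y"]
      by (simp add: algebra_simps)
  qed
  then have "lower_along p y (a + b) - (p (b + t *\<^sub>R y) - t * p y) \<le> lower_along p y a"
    if "0 \<le> t" for t
    unfolding lower_along_def[of p y a] using that by (intro cINF_greatest) auto
  then have "lower_along p y (a + b) - lower_along p y a \<le> p (b + t *\<^sub>R y) - t * p y"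
    if "0 \<le> t" for t using that by (force simp: algebra_simps)
  then have "lower_along p y (a + b) - lower_along p y a \<le> lower_along p y b"
    unfolding lower_along_def[of p y b] by (intro cINF_greatest) auto
  then show "lower_along p y (a + b) \<le> lower_along p y a + lower_along p y b" by simp
next
  fix c :: real and x assume c: "0 \<le> c"
  have le: "lower_along p y (c *\<^sub>R x) \<le> c * lower_along p y x" if c: "0 < c" for c x
  proof -
    have "lower_along p y (c *\<^sub>R x) / c \<le> p (x + t *\<^sub>R y) - t * p y" if "0 \<le> t" for t
    proof -
      have "lower_along p y (c *\<^sub>R x) \<le> p (c *\<^sub>R (x + t *\<^sub>R y)) - (c * t) * p y"
        using lower_along_le[OF p, of "c * t" y "c *\<^sub>R x"] that c by (simp add: algebra_simps)
      also have "\<dots> = c * (p (x + t *\<^sub>R y) - t * p y)"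
        using c by (subst sublinear_scale[OF p]) (simp_all add: right_diff_distrib)
      finally show ?thesis using c by (simp add: field_simps)
    qed
    then have "lower_along p y (c *\<^sub>R x) / c \<le> lower_along p y x"
      unfolding lower_along_def[of p y x] by (intro cINF_greatest) auto
    then show ?thesis using c by (simp add: field_simps)
  qed
  show "lower_along p y (c *\<^sub>R x) = c * lower_along p y x"
  proof (cases "c = 0")
    case True
    have "lower_along p y 0 = (INF t\<in>{0::real..}. 0)"
      unfolding lower_along_def by (intro INF_cong) (auto simp: sublinear_scale[OF p])
    then show ?thesis using True by simp
  next
    case False
    with c have "0 < c" by simp
    then have "lower_along p y (inverse c *\<^sub>R (c *\<^sub>R x)) \<le> inverse c * lower_along p y (c *\<^sub>R x)"
      by (intro le) simp
    with \<open>0 < c\<close> have "c * lower_along p y x \<le> lower_along p y (c *\<^sub>R x)"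
      by (simp add: field_simps)
    with le[OF \<open>0 < c\<close>, of x] show ?thesis by simp
  qed
qed

text \<open>A minimal sublinear functional agrees with all its lowerings, and this makes it additive.\<close>

lemma minimal_sublinear_linear:
  assumes p: "sublinear p" and min: "\<And>r. sublinear r \<Longrightarrow> (\<And>x. r x \<le> p x) \<Longrightarrow> r = p"
  shows "linear p"
proof -
  have add: "p (x + y) = p x + p y" for x y
  proof -
    have "lower_along p y = p"
      by (intro min sublinear_lower_along p lower_along_le_self)
    then have "p x \<le> p (x + y) - p y" using lower_along_le[OF p, of 1 y x] by simp
    then show ?thesis using sublinear_add[OF p, of x y] by simp
  qed
  have neg: "p (- x) = - p x" for x
    using add[of x "- x"] sublinear_zero[OF p] by simp
  have "p (c *\<^sub>R x) = c * p x" for c x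
  proof (cases "0 \<le> c")
    case False
    then have "p (- ((- c) *\<^sub>R x)) = - (- c * p x)"
      unfolding neg by (subst sublinear_scale[OF p]) auto
    then show ?thesis by simp
  qed (rule sublinear_scale[OF p])
  then show ?thesis by (intro linearI) (auto simp: add)
qed

lemma linear_below_sublinear:
  fixes p :: "'a::real_vector \<Rightarrow> real"
  assumes p: "sublinear p"
  obtains f where "linear f" "\<And>x. f x \<le> p x"
proof -
  define S where "S = {r. sublinear r \<and> (\<forall>x. r x \<le> p x)}"
  \<comment> \<open>The order is reversed, so that the maximal element supplied by Zorn's lemma is a
    minimal sublinear functional.\<close>
  let ?P = "\<lambda>r s :: 'a \<Rightarrow> real. s \<le> r"
  have "\<exists>m\<in>S. \<forall>a\<in>S. ?P m a \<longrightarrow> a = m"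
  proof (rule predicate_Zorn)
    show "partial_order_on S (relation_of ?P S)"
      by (rule partial_order_on_relation_ofI) auto
    fix Ch assume "Ch \<in> Chains (relation_of ?P S)"
    then have sub: "\<And>r. r \<in> Ch \<Longrightarrow> r \<in> S"
      and tot: "\<And>r s. r \<in> Ch \<Longrightarrow> s \<in> Ch \<Longrightarrow> r \<le> s \<or> s \<le> r"
      unfolding Chains_def relation_of_def by auto
    show "\<exists>u\<in>S. \<forall>a\<in>Ch. ?P a u"
    proof (cases "Ch = {}")
      case True
      then show ?thesis using p by (auto simp: S_def)
    next
      case False
      define u where "u x = (INF r\<in>Ch. r x)" for x
      have bdd: "bdd_below ((\<lambda>r. r x) ` Ch)" for x
      proof (rule bdd_belowI2[where m = "- p (- x)"])
        fix r assume "r \<in> Ch"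
        then have "sublinear r" "r (- x) \<le> p (- x)" using sub by (auto simp: S_def)
        then show "- p (- x) \<le> r x" using sublinear_minus[of r x] by linarith
      qed
      have le: "u x \<le> r x" if "r \<in> Ch" for r x
        unfolding u_def using that by (intro cINF_lower bdd)
      have "u \<in> S" unfolding S_def sublinear_def
      proof safe
        fix x y
        \<comment> \<open>Subadditivity survives the infimum because a chain is totally ordered: the
          smaller of \<open>r\<close> and \<open>s\<close> bounds both.\<close>
        have "u (x + y) - s y \<le> r x" if rs: "r \<in> Ch" "s \<in> Ch" for r s
        proof -
          obtain t where "t \<in> Ch" "t \<le> r" "t \<le> s" using tot[OF rs] rs by auto
          moreover have "t (x + y) \<le> t x + t y" using sub[OF \<open>t \<in> Ch\<close>] by (auto simp: S_def sublinear_def)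
          ultimately show ?thesis using le[of t "x + y"]
            by (smt (verit) le_funD)
        qed
        then have "u (x + y) - s y \<le> u x" if "s \<in> Ch" for s
          unfolding u_def[of x] using that False by (intro cINF_greatest) auto
        then have "u (x + y) - u x \<le> s y" if "s \<in> Ch" for s using that by force
        then have "u (x + y) - u x \<le> u y"
          unfolding u_def[of y] using False by (intro cINF_greatest) auto
        then show "u (x + y) \<le> u x + u y" by simp
      next
        fix c :: real and x assume c: "0 \<le> c"
        have scale: "r (c *\<^sub>R x) = c * r x" if "r \<in> Ch" for r
          using sub[OF that] c by (auto simp: S_def sublinear_def)
        have "u (c *\<^sub>R x) = (INF r\<in>Ch. c * r x)"
          unfolding u_def using scale by (intro INF_cong) auto
        also have "\<dots> = c * u x"
        proof (cases "c = 0")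
          case True then show ?thesis using False by simp
        next
          case c0: False
          show ?thesis
          proof (rule antisym)
            have "(INF r\<in>Ch. c * r x) / c \<le> r x" if "r \<in> Ch" for r
            proof -
              have "bdd_below ((\<lambda>r. c * r x) ` Ch)"
                using le c by (intro bdd_belowI2[where m = "c * u x"] mult_left_mono) auto
              then have "(INF r\<in>Ch. c * r x) \<le> c * r x" using that by (intro cINF_lower)
              then show ?thesis using c c0 by (simp add: field_simps)
            qed
            then have "(INF r\<in>Ch. c * r x) / c \<le> u x"
              unfolding u_def using False by (intro cINF_greatest)
            then show "(INF r\<in>Ch. c * r x) \<le> c * u x" using c c0 by (simp add: field_simps)
            show "c * u x \<le> (INF r\<in>Ch. c * r x)"
              using le c False by (intro cINF_greatest mult_left_mono) auto
          qed
        qed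
        finally show "u (c *\<^sub>R x) = c * u x" .
      next
        fix x
        obtain r where "r \<in> Ch" using False by auto
        then show "u x \<le> p x" using le[of r x] sub[of r]
          by (auto simp: S_def intro: order_trans)
      qed
      then show ?thesis using le by (auto simp: le_fun_def)
    qed
  qed
  then obtain m where m: "m \<in> S" "\<And>a. a \<in> S \<Longrightarrow> a \<le> m \<Longrightarrow> a = m" by auto
  have "linear m"
  proof (rule minimal_sublinear_linear)
    show "sublinear m" using m(1) by (simp add: S_def)
    fix r assume "sublinear r" "\<And>x. r x \<le> m x"
    then show "r = m" using m(1) by (intro m(2)) (auto simp: S_def le_fun_def intro: order_trans)
  qed
  then show ?thesis using m(1) that by (auto simp: S_def)
qed

lemma norming_functional:
  fixes v :: "'a::real_normed_vector"
  obtains f :: "'a \<Rightarrow>\<^sub>L real" where "\<And>x. \<bar>blinfun_apply f x\<bar> \<le> norm x" "blinfun_apply f v = norm v"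
proof -
  \<comment> \<open>Domination by the lowered norm, not merely by the norm, forces
    \<open>f (- v) \<le> - norm v\<close> and hence equality at \<open>v\<close>.\<close>
  let ?p = "lower_along norm v"
  obtain f where f: "linear f" "\<And>x. f x \<le> ?p x"
    using linear_below_sublinear[OF sublinear_lower_along[OF sublinear_norm]] by blast
  have le: "f x \<le> norm x" for x
    using f(2)[of x] lower_along_le_self[OF sublinear_norm, of v x] by linarith
  have abs: "\<bar>f x\<bar> \<le> norm x" for x
    using le[of x] le[of "- x"] linear_neg[OF f(1)] by (simp add: abs_le_iff)
  have "?p (- v) \<le> - norm v" using lower_along_le[OF sublinear_norm, of 1 v "- v"] by simp
  then have "f v = norm v" using f(2)[of "- v"] linear_neg[OF f(1)] le[of v] by simp
  moreover have "bounded_linear f"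
    using f(1) abs by (intro bounded_linear_intro[where K = 1]) (auto simp: linear_add linear_scale)
  ultimately show ?thesis
    using abs that[of "Blinfun f"] by (simp add: bounded_linear_Blinfun_apply)
qed

text \<open>Functionals that norm the points of a countable dense set suffice, since replacing a
  vector by a nearby dense point loses at most twice the distance. One-sided inequalities are
  enough, so a supremum of norms becomes a supremum of linear coordinates.\<close>

lemma countable_norming_set:
  obtains F :: "nat \<Rightarrow> ('a::{real_normed_vector, second_countable_topology} \<Rightarrow>\<^sub>L real)"
  where "\<And>i x. \<bar>blinfun_apply (F i) x\<bar> \<le> norm x"
    and "\<And>x t. norm x \<le> t \<longleftrightarrow> (\<forall>i. blinfun_apply (F i) x \<le> t)"
proof -
  obtain D :: "'a set" where D: "countable D" "\<And>X. open X \<Longrightarrow> X \<noteq> {} \<Longrightarrow> \<exists>d\<in>D. d \<in> X"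
    using countable_dense_exists by blast
  then have "D \<noteq> {}" using D(2)[of UNIV] by auto
  define d where "d = from_nat_into D"
  have "\<exists>f :: 'a \<Rightarrow>\<^sub>L real. (\<forall>x. \<bar>blinfun_apply f x\<bar> \<le> norm x) \<and> blinfun_apply f v = norm v" for v
    using norming_functional[of v] by metis
  then obtain F :: "'a \<Rightarrow> 'a \<Rightarrow>\<^sub>L real"
    where F: "\<And>v x. \<bar>blinfun_apply (F v) x\<bar> \<le> norm x" "\<And>v. blinfun_apply (F v) v = norm v"
    by metis
  have approx: "\<exists>i. norm x - e < blinfun_apply (F (d i)) x" if e: "0 < e" for x :: 'a and e :: real
  proof -
    obtain v where v: "v \<in> D" "v \<in> ball x (e / 2)" using e D(2)[of "ball x (e / 2)"] by auto
    obtain i where i: "d i = v" unfolding d_def using from_nat_into_surj[OF D(1) v(1)] by auto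
    have dist: "norm (x - v) < e / 2" using v by (simp add: dist_norm)
    have "norm x - blinfun_apply (F v) x = (norm x - norm v) + blinfun_apply (F v) (v - x)"
      by (simp add: blinfun.diff_right F(2))
    also have "\<dots> \<le> norm (x - v) + norm (v - x)"
      using F(1)[of v "v - x"] norm_triangle_ineq2[of x v] by linarith
    finally show ?thesis
      using dist i by (intro exI[of _ i]) (auto simp: norm_minus_commute)
  qed
  show ?thesis
  proof (rule that[of "\<lambda>i. F (d i)"])
    fix x :: 'a and t :: real
    show "norm x \<le> t \<longleftrightarrow> (\<forall>i. blinfun_apply (F (d i)) x \<le> t)"
    proof
      assume "norm x \<le> t"
      then show "\<forall>i. blinfun_apply (F (d i)) x \<le> t" using F(1)[of _ x] by (meson abs_le_D1 order_trans)
    next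
      assume "\<forall>i. blinfun_apply (F (d i)) x \<le> t"
      then show "norm x \<le> t" using approx[of "norm x - t" x] by (auto simp: not_le[symmetric])
    qed
  qed (rule F(1))
qed

section \<open>Suprema of Gaussian sequences\<close>

lemma (in prob_space) char_determines_real:
  fixes g Y :: "'a \<Rightarrow> real"
  assumes [measurable]: "Y \<in> borel_measurable M" "g \<in> borel_measurable M" and bd: "\<And>\<omega>. \<omega> \<in> space M \<Longrightarrow> \<bar>g \<omega>\<bar> \<le> 1"
    and zero: "\<And>s. (\<integral>\<omega>. g \<omega> * iexp (s * Y \<omega>) \<partial>M) = 0"
    and A: "A \<in> sets borel"
  shows "(\<integral>\<omega>. g \<omega> * indicator A (Y \<omega>) \<partial>M) = 0"
proof -
  \<comment> \<open>The bound on \<open>g\<close> makes \<open>1 + g\<close> a nonnegative density,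
    and \<open>s = 0\<close> gives it mass 1. \<open>Y\<close> has the same characteristic function
    under both measures, so a statement on signed weights is reduced to Levy's uniqueness
    theorem.\<close>
  define D where "D = density M (\<lambda>\<omega>. ennreal (1 + g \<omega>))"
  have nonneg: "AE \<omega> in M. 0 \<le> 1 + g \<omega>" using bd by (intro AE_I2) force
  have g_int: "integrable M g" using bd by (intro integrable_const_bound[where B = 1]) auto
  have "(\<integral>\<omega>. g \<omega> \<partial>M) = 0"
    using zero[of 0] by simp
  then have one: "(\<integral>\<omega>. 1 + g \<omega> \<partial>M) = 1" using g_int by (simp add: prob_space)
  have "emeasure D (space D) = (\<integral>\<^sup>+\<omega>. ennreal (1 + g \<omega>) \<partial>M)"
    by (simp add: D_def emeasure_density cong: nn_integral_cong)
  also have "\<dots> = ennreal (\<integral>\<omega>. 1 + g \<omega> \<partial>M)"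
    using g_int nonneg by (intro nn_integral_eq_integral) auto
  finally have "emeasure D (space D) = 1" using one by simp
  then interpret D: prob_space D by (rule prob_spaceI)
  have Y_D [measurable]: "Y \<in> borel_measurable D" by (simp add: D_def)
  have cint: "complex_integrable M (\<lambda>\<omega>. iexp (s * Y \<omega>))" for s
    by (intro integrable_const_bound[where B = 1]) auto
  have gint: "complex_integrable M (\<lambda>\<omega>. g \<omega> * iexp (s * Y \<omega>))" for s
    using bd by (intro integrable_const_bound[where B = 1]) (auto simp: norm_mult)
  have "char (distr D borel Y) = char (distr M borel Y)"
  proof
    fix s
    have "char (distr D borel Y) s = (\<integral>\<omega>. iexp (s * Y \<omega>) \<partial>D)"
      unfolding char_def by (subst integral_distr) auto
    also have "\<dots> = (\<integral>\<omega>. (1 + g \<omega>) *\<^sub>R iexp (s * Y \<omega>) \<partial>M)"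
      unfolding D_def using nonneg by (subst integral_density) auto
    also have "\<dots> = (\<integral>\<omega>. iexp (s * Y \<omega>) + g \<omega> * iexp (s * Y \<omega>) \<partial>M)"
      by (simp add: scaleR_conv_of_real algebra_simps)
    also have "\<dots> = (\<integral>\<omega>. iexp (s * Y \<omega>) \<partial>M)"
      using zero[of s] by (subst Bochner_Integration.integral_add[OF cint gint]) (simp only: add_0_right)
    also have "\<dots> = char (distr M borel Y) s"
      unfolding char_def by (subst integral_distr) auto
    finally show "char (distr D borel Y) s = char (distr M borel Y) s" .
  qed
  then have eq: "distr D borel Y = distr M borel Y"
    by (intro Levy_uniqueness real_distribution_distr D.real_distribution_distr) auto
  have [measurable]: "A \<in> sets borel" by (rule A)
  have ind: "integrable M (\<lambda>\<omega>. indicator A (Y \<omega>) :: real)" "integrable M (\<lambda>\<omega>. g \<omega> * indicator A (Y \<omega>))"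
    using bd by (auto intro!: integrable_const_bound[where B = 1] simp: indicator_def)
  have "(\<integral>\<omega>. indicator A (Y \<omega>) \<partial>M) = (\<integral>x. indicator A x \<partial>distr M borel Y :: real)"
    by (subst integral_distr) auto
  also have "\<dots> = (\<integral>\<omega>. indicator A (Y \<omega>) \<partial>D)"
    unfolding eq[symmetric] by (subst integral_distr) auto
  also have "\<dots> = (\<integral>\<omega>. (1 + g \<omega>) *\<^sub>R indicator A (Y \<omega>) \<partial>M)"
    unfolding D_def using nonneg by (subst integral_density) auto
  also have "\<dots> = (\<integral>\<omega>. indicator A (Y \<omega>) + g \<omega> * indicator A (Y \<omega>) \<partial>M)"
    by (simp add: algebra_simps)
  also have "\<dots> = (\<integral>\<omega>. indicator A (Y \<omega>) \<partial>M) + (\<integral>\<omega>. g \<omega> * indicator A (Y \<omega>) \<partial>M)"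
    by (rule Bochner_Integration.integral_add[OF ind])
  finally show ?thesis by simp
qed

text \<open>A complex weight is split into its real and imaginary part; the transform of the conjugate
  weight vanishes because it is the conjugate of the transform at \<open>- s\<close>.\<close>

lemma (in prob_space) char_determines:
  fixes g :: "'a \<Rightarrow> complex" and Y :: "'a \<Rightarrow> real"
  assumes [measurable]: "Y \<in> borel_measurable M" "g \<in> borel_measurable M" and bd: "\<And>\<omega>. \<omega> \<in> space M \<Longrightarrow> cmod (g \<omega>) \<le> 1"
    and zero: "\<And>s. (\<integral>\<omega>. g \<omega> * iexp (s * Y \<omega>) \<partial>M) = 0"
    and A: "A \<in> sets borel"
  shows "(\<integral>\<omega>. g \<omega> * indicator A (Y \<omega>) \<partial>M) = 0"
proof -
  have [measurable]: "A \<in> sets borel" by (rule A)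
  have gint: "complex_integrable M (\<lambda>\<omega>. g \<omega> * iexp (s * Y \<omega>))" for s
    using bd by (intro integrable_const_bound[where B = 1]) (auto simp: norm_mult)
  have [measurable]: "(\<lambda>\<omega>. cnj (g \<omega>)) \<in> borel_measurable M"
    by (intro borel_measurable_continuous_on[of cnj] continuous_intros) simp
  have cint: "complex_integrable M (\<lambda>\<omega>. cnj (g \<omega>) * iexp (s * Y \<omega>))" for s
    using bd by (intro integrable_const_bound[where B = 1]) (auto simp: norm_mult)
  have cnj_zero: "(\<integral>\<omega>. cnj (g \<omega>) * iexp (s * Y \<omega>) \<partial>M) = 0" for s
  proof -
    have "(\<integral>\<omega>. cnj (g \<omega>) * iexp (s * Y \<omega>) \<partial>M) = (\<integral>\<omega>. cnj (g \<omega> * iexp ((- s) * Y \<omega>)) \<partial>M)"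
      by (simp add: exp_cnj)
    also have "\<dots> = cnj (\<integral>\<omega>. g \<omega> * iexp ((- s) * Y \<omega>) \<partial>M)"
      by (rule Bochner_Integration.integral_cnj)
    finally show ?thesis using zero[of "- s"] by simp
  qed
  have "(\<integral>\<omega>. complex_of_real (Re (g \<omega>)) * iexp (s * Y \<omega>) \<partial>M) =
      (\<integral>\<omega>. (1/2) * (g \<omega> * iexp (s * Y \<omega>) + cnj (g \<omega>) * iexp (s * Y \<omega>)) \<partial>M)" for s
    by (intro Bochner_Integration.integral_cong)
       (auto simp: complex_eq_iff field_simps)
  then have re: "(\<integral>\<omega>. complex_of_real (Re (g \<omega>)) * iexp (s * Y \<omega>) \<partial>M) = 0" for s
    by (simp add: Bochner_Integration.integral_add[OF gint cint] zero cnj_zero del: of_real_mult)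
  have "(\<integral>\<omega>. complex_of_real (Im (g \<omega>)) * iexp (s * Y \<omega>) \<partial>M) =
      (\<integral>\<omega>. (- \<i>/2) * (g \<omega> * iexp (s * Y \<omega>) - cnj (g \<omega>) * iexp (s * Y \<omega>)) \<partial>M)" for s
    by (intro Bochner_Integration.integral_cong)
       (auto simp: complex_eq_iff field_simps)
  then have im: "(\<integral>\<omega>. complex_of_real (Im (g \<omega>)) * iexp (s * Y \<omega>) \<partial>M) = 0" for s
    by (simp add: Bochner_Integration.integral_diff[OF gint cint] zero cnj_zero del: of_real_mult)
  have bds: "\<bar>Re (g \<omega>)\<bar> \<le> 1" "\<bar>Im (g \<omega>)\<bar> \<le> 1" if "\<omega> \<in> space M" for \<omega>
    using bd[OF that] abs_Re_le_cmod[of "g \<omega>"] abs_Im_le_cmod[of "g \<omega>"] by linarith+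
  have Re0: "(\<integral>\<omega>. Re (g \<omega>) * indicator A (Y \<omega>) \<partial>M) = 0"
    using re bds by (intro char_determines_real A) auto
  have Im0: "(\<integral>\<omega>. Im (g \<omega>) * indicator A (Y \<omega>) \<partial>M) = 0"
    using im bds by (intro char_determines_real A) auto
  have int: "complex_integrable M (\<lambda>\<omega>. g \<omega> * indicator A (Y \<omega>))"
    using bd by (intro integrable_const_bound[where B = 1]) (auto simp: norm_mult indicator_def)
  have "Re (\<integral>\<omega>. g \<omega> * indicator A (Y \<omega>) \<partial>M) = 0"
    unfolding integral_Re[OF int, symmetric] Re0[symmetric]
    by (intro Bochner_Integration.integral_cong) (auto simp: indicator_def)
  moreover have "Im (\<integral>\<omega>. g \<omega> * indicator A (Y \<omega>) \<partial>M) = 0"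
    unfolding integral_Im[OF int, symmetric] Im0[symmetric]
    by (intro Bochner_Integration.integral_cong) (auto simp: indicator_def)
  ultimately show ?thesis by (simp add: complex_eq_iff)
qed

text \<open>The coordinates \<open>Z 0, \<dots>, Z (n - 1)\<close> are converted one at a time from characters to indicators.\<close>

lemma (in prob_space) char_factor_rectangle:
  fixes U :: "'a \<Rightarrow> real" and Z :: "nat \<Rightarrow> 'a \<Rightarrow> real"
  assumes [measurable]: "U \<in> borel_measurable M" "\<And>j. Z j \<in> borel_measurable M"
    and fac: "\<And>s t. (\<integral>\<omega>. iexp (s * U \<omega> + (\<Sum>j<n. t j * Z j \<omega>)) \<partial>M) =
        (\<integral>\<omega>. iexp (s * U \<omega>) \<partial>M) * (\<integral>\<omega>. iexp (\<Sum>j<n. t j * Z j \<omega>) \<partial>M)"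
    and A: "A \<in> sets borel" and B: "\<And>j. B j \<in> sets borel" and k: "k \<le> n"
  shows "(\<integral>\<omega>. (indicator A (U \<omega>) - prob (U -` A \<inter> space M)) *
      ((\<Prod>j<k. indicator (B j) (Z j \<omega>)) * iexp (\<Sum>j\<in>{k..<n}. t j * Z j \<omega>)) \<partial>M) = 0"
  using k
proof (induction k arbitrary: t)
  case 0
  define e where "e \<omega> = iexp (\<Sum>j<n. t j * Z j \<omega>)" for \<omega>
  define m where "m = (\<integral>\<omega>. e \<omega> \<partial>M)"
  have [measurable]: "e \<in> borel_measurable M" "A \<in> sets borel" using A unfolding e_def by auto
  have e1: "cmod (e \<omega>) \<le> 1" for \<omega> by (simp add: e_def)
  have eint: "complex_integrable M e"
    using e1 by (intro integrable_const_bound[where B = 1]) auto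
  have "cmod m \<le> (\<integral>\<omega>. cmod (e \<omega>) \<partial>M)" unfolding m_def by (rule integral_norm_bound)
  also have "\<dots> \<le> (\<integral>\<omega>. 1 \<partial>M)" using eint e1 by (intro integral_mono) auto
  finally have m1: "cmod m \<le> 1" by (simp add: prob_space)
  \<comment> \<open>By \<open>fac\<close> the centred character has vanishing transform along
    \<open>U\<close>; halving keeps it within the bound 1 that \<open>char_determines\<close>
    requires.\<close>
  have g1: "cmod ((e \<omega> - m) / 2) \<le> 1" for \<omega>
    using norm_triangle_ineq4[of "e \<omega>" m] m1 e1[of \<omega>] by (simp add: norm_divide)
  have sint: "complex_integrable M (\<lambda>\<omega>. iexp (s * U \<omega>))"
    "complex_integrable M (\<lambda>\<omega>. e \<omega> * iexp (s * U \<omega>))" for s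
    using e1 by (auto intro!: integrable_const_bound[where B = 1] simp: norm_mult)
  have "(\<integral>\<omega>. (e \<omega> - m) / 2 * iexp (s * U \<omega>) \<partial>M) = 0" for s
  proof -
    have "(\<integral>\<omega>. (e \<omega> - m) / 2 * iexp (s * U \<omega>) \<partial>M) =
      (\<integral>\<omega>. (1/2) * (e \<omega> * iexp (s * U \<omega>) - m * iexp (s * U \<omega>)) \<partial>M)"
      by (simp add: algebra_simps diff_divide_distrib)
    also have "\<dots> = (1/2) * ((\<integral>\<omega>. e \<omega> * iexp (s * U \<omega>) \<partial>M) - m * (\<integral>\<omega>. iexp (s * U \<omega>) \<partial>M))"
      using sint by simp
    also have "(\<integral>\<omega>. e \<omega> * iexp (s * U \<omega>) \<partial>M) = m * (\<integral>\<omega>. iexp (s * U \<omega>) \<partial>M)"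
      using fac[of s t] by (simp add: e_def m_def exp_add[symmetric] algebra_simps)
    finally show ?thesis by simp
  qed
  from char_determines[OF _ _ g1 this A]
  have *: "(\<integral>\<omega>. (e \<omega> - m) / 2 * indicator A (U \<omega>) \<partial>M) = 0" by simp
  have ei: "complex_integrable M (\<lambda>\<omega>. indicator A (U \<omega>) * e \<omega>)"
    using e1 by (auto intro!: integrable_const_bound[where B = 1] simp: norm_mult indicator_def)
  have ii: "complex_integrable M (\<lambda>\<omega>. indicator A (U \<omega>) * m)"
    using m1 by (auto intro!: integrable_const_bound[where B = 1] simp: norm_mult indicator_def)
  have "(\<integral>\<omega>. indicator A (U \<omega>) \<partial>M) = (\<integral>\<omega>. complex_of_real (indicator (U -` A \<inter> space M) \<omega>) \<partial>M)"
    by (intro Bochner_Integration.integral_cong) (auto simp: indicator_def)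
  then have pe: "(\<integral>\<omega>. indicator A (U \<omega>) \<partial>M) = complex_of_real (prob (U -` A \<inter> space M))"
    by simp
  have "(\<integral>\<omega>. indicator A (U \<omega>) * e \<omega> - indicator A (U \<omega>) * m \<partial>M) = 0"
  proof -
    have "(\<integral>\<omega>. indicator A (U \<omega>) * e \<omega> - indicator A (U \<omega>) * m \<partial>M) =
      (\<integral>\<omega>. 2 * ((e \<omega> - m) / 2 * indicator A (U \<omega>)) \<partial>M)"
      by (intro Bochner_Integration.integral_cong) (auto simp: algebra_simps)
    also have "\<dots> = 0" by (subst integral_mult_right_zero) (simp only: * mult_zero_right)
    finally show ?thesis .
  qed
  then have "(\<integral>\<omega>. indicator A (U \<omega>) * e \<omega> \<partial>M) = prob (U -` A \<inter> space M) * m"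
    by (simp add: Bochner_Integration.integral_diff[OF ei ii] pe)
  then have "(\<integral>\<omega>. indicator A (U \<omega>) * e \<omega> - prob (U -` A \<inter> space M) * e \<omega> \<partial>M) = 0"
    using ei eint by (simp add: m_def[symmetric])
  moreover have "complex_of_real (indicat_real A x) = indicator A x" for x
    by (simp add: indicator_def)
  ultimately show ?case
    by (simp add: left_diff_distrib lessThan_atLeast0[symmetric] e_def del: of_real_sum of_real_mult)
next
  case (Suc k)
  have [measurable]: "A \<in> sets borel" "\<And>j. B j \<in> sets borel" using A B by auto
  define g where "g \<omega> = (indicator A (U \<omega>) - prob (U -` A \<inter> space M)) *
      ((\<Prod>j<k. indicator (B j) (Z j \<omega>)) * iexp (\<Sum>j\<in>{Suc k..<n}. t j * Z j \<omega>))" for \<omega>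
  have g1: "cmod (g \<omega>) \<le> 1" for \<omega>
  proof -
    have "\<bar>indicator A (U \<omega>) - prob (U -` A \<inter> space M)\<bar> \<le> 1" by (auto simp: indicator_def)
    moreover have "cmod (indicator A (U \<omega>) - prob (U -` A \<inter> space M)) = \<bar>indicator A (U \<omega>) - prob (U -` A \<inter> space M)\<bar>"
      unfolding norm_of_real[symmetric, where 'a = complex] by (simp add: indicator_def)
    moreover have "cmod (\<Prod>j<k. indicator (B j) (Z j \<omega>)) \<le> 1"
      unfolding prod_norm[symmetric] by (intro prod_le_1) (auto simp: indicator_def)
    ultimately show ?thesis by (simp add: g_def norm_mult mult_le_one)
  qed
  have [measurable]: "g \<in> borel_measurable M" unfolding g_def by measurable
  have "(\<integral>\<omega>. g \<omega> * iexp (s * Z k \<omega>) \<partial>M) = 0" for s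
  proof -
    \<comment> \<open>The frequency of the coordinate to be converted must be free; this is why the
      induction generalises over \<open>t\<close>.\<close>
    have "(\<Sum>j\<in>{k..<n}. (t(k := s)) j * Z j \<omega>) = s * Z k \<omega> + (\<Sum>j\<in>{Suc k..<n}. t j * Z j \<omega>)" for \<omega>
      using Suc.prems by (simp add: sum.atLeast_Suc_lessThan)
    then show ?thesis
      using Suc.IH[of "t(k := s)"] Suc.prems by (simp add: g_def exp_add algebra_simps)
  qed
  from char_determines[OF _ _ g1 this B, of k]
  have "(\<integral>\<omega>. g \<omega> * indicator (B k) (Z k \<omega>) \<partial>M) = 0" by simp
  then show ?case by (simp add: g_def algebra_simps)
qed

section \<open>One-dimensional centred normal laws and shifts of their densities\<close>

lemma (in prob_space) centered_normal_integral:
  fixes f :: "real \<Rightarrow> 'b::{banach, second_countable_topology}"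
  assumes "centered_normal M Y" and [measurable]: "f \<in> borel_measurable borel"
  shows "integrable M (\<lambda>\<omega>. f (Y \<omega>)) \<longleftrightarrow> integrable (distr M borel Y) f"
    and "(\<integral>\<omega>. f (Y \<omega>) \<partial>M) = (\<integral>x. f x \<partial>distr M borel Y)"
proof -
  have [measurable]: "Y \<in> borel_measurable M" using assms by (simp add: centered_normal_def)
  show "integrable M (\<lambda>\<omega>. f (Y \<omega>)) \<longleftrightarrow> integrable (distr M borel Y) f"
    by (subst integrable_distr_eq) auto
  show "(\<integral>\<omega>. f (Y \<omega>) \<partial>M) = (\<integral>x. f x \<partial>distr M borel Y)"
    by (subst integral_distr) auto
qed

lemma (in prob_space) centered_normal_cases:
  assumes Y: "centered_normal M Y"
  obtains "distr M borel Y = return borel 0" "expectation (\<lambda>\<omega>. (Y \<omega>)\<^sup>2) = 0"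
    "integrable M (\<lambda>\<omega>. (Y \<omega>)\<^sup>2)"
  | \<sigma> where "0 < \<sigma>" "distr M borel Y = density lborel (normal_density 0 \<sigma>)"
    "expectation (\<lambda>\<omega>. (Y \<omega>)\<^sup>2) = \<sigma>\<^sup>2" "integrable M (\<lambda>\<omega>. (Y \<omega>)\<^sup>2)"
proof -
  obtain \<sigma> where \<sigma>: "0 \<le> \<sigma>"
    "distr M borel Y = (if \<sigma> = 0 then return borel 0 else density lborel (normal_density 0 \<sigma>))"
    using Y by (auto simp: centered_normal_def)
  note int = centered_normal_integral[OF Y, of "\<lambda>x. x\<^sup>2"]
  show ?thesis
  proof (cases "\<sigma> = 0")
    case True
    then have d: "distr M borel Y = return borel 0" using \<sigma> by simp
    have "integrable (return borel 0) (\<lambda>x :: real. x\<^sup>2)"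
      by (rule integrableI_bounded) (auto simp: nn_integral_return)
    then show ?thesis using that(1)[OF d] int d by (simp add: integral_return)
  next
    case False
    then have d: "0 < \<sigma>" "distr M borel Y = density lborel (normal_density 0 \<sigma>)" using \<sigma> by auto
    have "integrable (density lborel (normal_density 0 \<sigma>)) (\<lambda>x :: real. x\<^sup>2)"
      using integrable_normal_moment[OF d(1), of 0 2] by (subst integrable_density) auto
    moreover have "(\<integral>x. x\<^sup>2 \<partial>density lborel (normal_density 0 \<sigma>)) = \<sigma>\<^sup>2"
      using integral_normal_moment_even[OF d(1), of 0 1]
      by (subst integral_density) (auto simp: fact_numeral)
    ultimately show ?thesis using that(2)[OF d] int d by simp
  qed
qed

lemma (in prob_space) centered_normal_char:
  assumes Y: "centered_normal M Y"
  shows "(\<integral>\<omega>. iexp (Y \<omega>) \<partial>M) = exp (- (expectation (\<lambda>\<omega>. (Y \<omega>)\<^sup>2)) / 2)"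
  using Y
proof (cases rule: centered_normal_cases)
  case 1
  then show ?thesis using centered_normal_integral(2)[OF Y, of iexp] by (simp add: integral_return)
next
  case (2 \<sigma>)
  have [measurable]: "Y \<in> borel_measurable M" using Y by (simp add: centered_normal_def)
  have "distributed M lborel Y (normal_density 0 \<sigma>)"
    using 2 by (auto simp: distributed_def cong: distr_cong)
  then have "distributed M lborel (\<lambda>x. (Y x - 0) / \<sigma>) std_normal_density"
    using normal_standard_normal_convert[OF 2(1), of Y 0] by simp
  then have std: "distr M borel (\<lambda>x. Y x / \<sigma>) = std_normal_distribution"
    by (auto simp: distributed_def cong: distr_cong)
  have "(\<integral>\<omega>. iexp (Y \<omega>) \<partial>M) = (\<integral>\<omega>. iexp (\<sigma> * (Y \<omega> / \<sigma>)) \<partial>M)" using 2 by simp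
  also have "\<dots> = char (distr M borel (\<lambda>x. Y x / \<sigma>)) \<sigma>"
    unfolding char_def by (subst integral_distr) auto
  finally show ?thesis using 2 by (simp add: std char_std_normal_distribution)
qed

text \<open>The ratio of the two densities has exponent (2 u \<tau> + \<tau>^2) / (2 \<sigma>^2),
  which is at most \<open>b / \<sigma> + 1 / 2\<close>. Later \<open>b\<close> is the level
  \<open>q\<close>, so the constant is uniform over standard deviations bounded away from 0.\<close>

lemma normal_density_shift_le:
  assumes "0 < \<sigma>" "0 \<le> \<tau>" "\<tau> \<le> \<sigma>" "u \<le> b" "0 \<le> b"
  shows "normal_density 0 \<sigma> u \<le> exp (b / \<sigma> + 1) * normal_density 0 \<sigma> (u + \<tau>)"
proof -
  have "(u + \<tau>)\<^sup>2 - u\<^sup>2 \<le> 2 * \<sigma> * b + \<sigma>\<^sup>2"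
  proof -
    have "2 * u * \<tau> \<le> 2 * b * \<sigma>"
    proof -
      have "u * \<tau> \<le> b * \<tau>" using assms by (intro mult_right_mono)
      also have "\<dots> \<le> b * \<sigma>" using assms by (intro mult_left_mono)
      finally show ?thesis by simp
    qed
    moreover have "\<tau>\<^sup>2 \<le> \<sigma>\<^sup>2" using assms by (intro power_mono)
    ultimately show ?thesis by (simp add: power2_sum algebra_simps)
  qed
  then have "((u + \<tau>)\<^sup>2 - u\<^sup>2) / (2 * \<sigma>\<^sup>2) \<le> (2 * \<sigma> * b + \<sigma>\<^sup>2) / (2 * \<sigma>\<^sup>2)"
    by (intro divide_right_mono) auto
  also have "\<dots> \<le> b / \<sigma> + 1" using assms by (simp add: power2_eq_square field_simps)
  finally have "exp (- u\<^sup>2 / (2 * \<sigma>\<^sup>2)) \<le> exp (b / \<sigma> + 1 + - (u + \<tau>)\<^sup>2 / (2 * \<sigma>\<^sup>2))"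
    by (simp add: diff_divide_distrib)
  then have "exp (- u\<^sup>2 / (2 * \<sigma>\<^sup>2)) \<le> exp (b / \<sigma> + 1) * exp (- (u + \<tau>)\<^sup>2 / (2 * \<sigma>\<^sup>2))"
    by (simp only: exp_add)
  then have "1 / sqrt (2 * pi * \<sigma>\<^sup>2) * exp (- u\<^sup>2 / (2 * \<sigma>\<^sup>2)) \<le>
      1 / sqrt (2 * pi * \<sigma>\<^sup>2) * (exp (b / \<sigma> + 1) * exp (- (u + \<tau>)\<^sup>2 / (2 * \<sigma>\<^sup>2)))"
    by (intro mult_left_mono) auto
  then show ?thesis by (simp add: normal_density_def mult.left_commute)
qed

text \<open>Translation to the right keeps points in the up-set \<open>S\<close>, so the pointwise
  density bound can be integrated. \<open>S\<close> will be the condition that a fixed index attains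
  the maximum, given the residuals of the other coordinates.\<close>

lemma normal_shift_upset_le:
  assumes "0 < \<sigma>" "0 \<le> \<tau>" "\<tau> \<le> \<sigma>" "0 \<le> b"
    and [measurable]: "S \<in> sets borel" and up: "\<And>x y. x \<in> S \<Longrightarrow> x \<le> y \<Longrightarrow> y \<in> S"
  shows "emeasure (density lborel (normal_density 0 \<sigma>)) ({a<..b} \<inter> S) \<le>
    ennreal (exp (b / \<sigma> + 1)) * emeasure (density lborel (normal_density 0 \<sigma>)) ({a + \<tau><..b + \<tau>} \<inter> S)"
proof -
  let ?C = "exp (b / \<sigma> + 1)" and ?\<phi> = "normal_density 0 \<sigma>"
  have "emeasure (density lborel ?\<phi>) ({a<..b} \<inter> S) = (\<integral>\<^sup>+u. ennreal (?\<phi> u) * indicator ({a<..b} \<inter> S) u \<partial>lborel)"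
    by (simp add: emeasure_density)
  also have "\<dots> \<le> (\<integral>\<^sup>+u. ennreal ?C * (ennreal (?\<phi> (u + \<tau>)) * indicator ({a + \<tau><..b + \<tau>} \<inter> S) (u + \<tau>)) \<partial>lborel)"
  proof (rule nn_integral_mono)
    fix u
    show "ennreal (?\<phi> u) * indicator ({a<..b} \<inter> S) u \<le>
      ennreal ?C * (ennreal (?\<phi> (u + \<tau>)) * indicator ({a + \<tau><..b + \<tau>} \<inter> S) (u + \<tau>))"
    proof (cases "u \<in> {a<..b} \<inter> S")
      case True
      then have "u + \<tau> \<in> {a + \<tau><..b + \<tau>} \<inter> S" using up[of u "u + \<tau>"] assms by auto
      then show ?thesis using True assms normal_density_shift_le[of \<sigma> \<tau> u b]
        by (simp add: ennreal_mult[symmetric])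
    qed simp
  qed
  also have "\<dots> = ennreal ?C * (\<integral>\<^sup>+u. ennreal (?\<phi> (u + \<tau>)) * indicator ({a + \<tau><..b + \<tau>} \<inter> S) (u + \<tau>) \<partial>lborel)"
    by (rule nn_integral_cmult) measurable
  also have "(\<integral>\<^sup>+u. ennreal (?\<phi> (u + \<tau>)) * indicator ({a + \<tau><..b + \<tau>} \<inter> S) (u + \<tau>) \<partial>lborel) =
      (\<integral>\<^sup>+u. ennreal (?\<phi> u) * indicator ({a + \<tau><..b + \<tau>} \<inter> S) u \<partial>lborel)"
    using nn_integral_real_affine[where c = 1 and t = \<tau> and
        f = "\<lambda>u. ennreal (?\<phi> u) * indicator ({a + \<tau><..b + \<tau>} \<inter> S) u"] by (simp add: add.commute)
  also have "\<dots> = emeasure (density lborel ?\<phi>) ({a + \<tau><..b + \<tau>} \<inter> S)"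
    by (simp add: emeasure_density)
  finally show ?thesis .
qed

section \<open>Jointly normal sequences: independent residuals and the law of the supremum\<close>

locale gaussian_sequence = prob_space +
  fixes X :: "nat \<Rightarrow> 'a \<Rightarrow> real"
  assumes normal: "centered_normal M (\<lambda>\<omega>. \<Sum>j<n. t j * X j \<omega>)"
begin

lemma normal_X: "centered_normal M (X j)"
  using normal[where n = "Suc j" and t = "\<lambda>i. of_bool (i = j)"] by (simp add: sum.delta of_bool_def if_distrib[of "\<lambda>x. x * _"] cong: if_cong)

lemma measurable_X [measurable]: "X j \<in> borel_measurable M"
  using normal_X by (simp add: centered_normal_def)

lemma square_integrable: "integrable M (\<lambda>\<omega>. (X j \<omega>)\<^sup>2)"
  using normal_X by (cases rule: centered_normal_cases) auto

lemma product_integrable: "integrable M (\<lambda>\<omega>. X i \<omega> * X j \<omega>)"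
proof (rule Bochner_Integration.integrable_bound)
  show "integrable M (\<lambda>\<omega>. (X i \<omega>)\<^sup>2 + (X j \<omega>)\<^sup>2)" by (intro Bochner_Integration.integrable_add square_integrable)
  show "AE \<omega> in M. norm (X i \<omega> * X j \<omega>) \<le> norm ((X i \<omega>)\<^sup>2 + (X j \<omega>)\<^sup>2)"
  proof (intro AE_I2)
    fix \<omega>
    have "2 * \<bar>X i \<omega>\<bar> * \<bar>X j \<omega>\<bar> \<le> \<bar>X i \<omega>\<bar>\<^sup>2 + \<bar>X j \<omega>\<bar>\<^sup>2" by (rule sum_squares_bound)
    moreover have "0 \<le> \<bar>X i \<omega>\<bar> * \<bar>X j \<omega>\<bar>" by simp
    moreover have "norm ((X i \<omega>)\<^sup>2 + (X j \<omega>)\<^sup>2) = \<bar>X i \<omega>\<bar>\<^sup>2 + \<bar>X j \<omega>\<bar>\<^sup>2" by simp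
    ultimately show "norm (X i \<omega> * X j \<omega>) \<le> norm ((X i \<omega>)\<^sup>2 + (X j \<omega>)\<^sup>2)"
      unfolding real_norm_def abs_mult by linarith
  qed
qed auto

definition sd :: "nat \<Rightarrow> real" where "sd j = sqrt (expectation (\<lambda>\<omega>. (X j \<omega>)\<^sup>2))"

lemma sd_nonneg: "0 \<le> sd j" by (simp add: sd_def)

lemma sd_square: "(sd j)\<^sup>2 = expectation (\<lambda>\<omega>. (X j \<omega>)\<^sup>2)" by (simp add: sd_def)

text \<open>Cauchy-Schwarz, from the expected square of \<open>sd j * X i - sd i * X j\<close>.
  Vanishing variances are split off because the argument cancels \<open>sd i * sd j\<close>. The
  bound of correlations by 1 later makes the argmax condition monotone.\<close>

lemma covariance_le: "expectation (\<lambda>\<omega>. X i \<omega> * X j \<omega>) \<le> sd i * sd j" 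
proof (cases "sd i = 0 \<or> sd j = 0")
  case True
  have "expectation (\<lambda>\<omega>. X i \<omega> * X j \<omega>) = 0"
  proof -
    have zero: "AE \<omega> in M. X k \<omega> = 0" if "sd k = 0" for k
      using that integral_nonneg_eq_0_iff_AE[OF square_integrable[of k]] by (auto simp: sd_def)
    then have "AE \<omega> in M. X i \<omega> * X j \<omega> = 0" 
    proof (cases "sd i = 0")
      case si: True
      show ?thesis using zero[OF si] by eventually_elim simp
    next
      case False
      then have "sd j = 0" using True by simp
      from zero[OF this] show ?thesis by eventually_elim simp
    qed
    then show ?thesis by (rule integral_eq_zero_AE)
  qed
  then show ?thesis using True by auto
next
  case False
  then have pos: "0 < sd i" "0 < sd j" using sd_nonneg by (auto simp: less_le)
  have "0 \<le> expectation (\<lambda>\<omega>. (sd j * X i \<omega> - sd i * X j \<omega>)\<^sup>2)" by simp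
  also have "\<dots> = expectation (\<lambda>\<omega>. (sd j)\<^sup>2 * (X i \<omega>)\<^sup>2 + (sd i)\<^sup>2 * (X j \<omega>)\<^sup>2 - 2 * sd i * sd j * (X i \<omega> * X j \<omega>))"
    by (simp add: power2_eq_square algebra_simps)
  also have "\<dots> = (sd j)\<^sup>2 * (sd i)\<^sup>2 + (sd i)\<^sup>2 * (sd j)\<^sup>2 - 2 * sd i * sd j * expectation (\<lambda>\<omega>. X i \<omega> * X j \<omega>)"
    using square_integrable product_integrable by (simp add: sd_square)
  finally have "(sd i * sd j) * expectation (\<lambda>\<omega>. X i \<omega> * X j \<omega>) \<le> (sd i * sd j) * (sd i * sd j)"
    by (simp add: power2_eq_square algebra_simps)
  then show ?thesis using pos by simp
qed

text \<open>For uncorrelated jointly normal variables the variances add, and the characteristic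
  function of a centred normal variable depends on its variance only.\<close>

lemma char_factor:
  fixes a b :: "nat \<Rightarrow> real"
  assumes i: "i < n" and uncorr: "\<And>j. j < n \<Longrightarrow> expectation (\<lambda>\<omega>. X i \<omega> * (a j * X j \<omega> - b j * X i \<omega>)) = 0"
  shows "(\<integral>\<omega>. iexp (s * X i \<omega> + (\<Sum>j<n. t j * (a j * X j \<omega> - b j * X i \<omega>))) \<partial>M) =
    (\<integral>\<omega>. iexp (s * X i \<omega>) \<partial>M) * (\<integral>\<omega>. iexp (\<Sum>j<n. t j * (a j * X j \<omega> - b j * X i \<omega>)) \<partial>M)"
proof -
  define V where "V \<omega> = (\<Sum>j<n. t j * (a j * X j \<omega> - b j * X i \<omega>))" for \<omega>
  have normal_sV: "centered_normal M (\<lambda>\<omega>. s * X i \<omega> + V \<omega>)" for s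
  proof -
    \<comment> \<open>All multiples of \<open>X i\<close>, including those coming from the
      residuals, are collected in the coefficient of index \<open>i\<close>.\<close>
    let ?c = "\<lambda>j. t j * a j + (if j = i then s - (\<Sum>j<n. t j * b j) else 0)"
    have "(\<Sum>j<n. ?c j * X j \<omega>) = s * X i \<omega> + V \<omega>" for \<omega>
    proof -
      have "(\<Sum>j<n. ?c j * X j \<omega>) = (\<Sum>j<n. t j * a j * X j \<omega>) + (\<Sum>j<n. if j = i then (s - (\<Sum>j<n. t j * b j)) * X i \<omega> else 0)"
        unfolding sum.distrib[symmetric] by (intro sum.cong) (auto simp: algebra_simps)
      also have "\<dots> = s * X i \<omega> + V \<omega>"
        using i by (simp add: V_def algebra_simps sum_subtractf sum_distrib_left)
      finally show ?thesis .
    qed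
    then show ?thesis using normal[where n = n and t = ?c] by simp
  qed
  have V: "centered_normal M V" using normal_sV[of 0] by simp
  then have [measurable]: "V \<in> borel_measurable M" by (simp add: centered_normal_def)
  have V2: "integrable M (\<lambda>\<omega>. (V \<omega>)\<^sup>2)" using V by (cases rule: centered_normal_cases) auto
  have sX: "centered_normal M (\<lambda>\<omega>. s * X i \<omega>)"
    using normal[where n = n and t = "\<lambda>j. if j = i then s else 0"] i
    by (simp add: if_distrib[of "\<lambda>x. x * _"] cong: if_cong)
  have XV: "X i \<omega> * V \<omega> = (\<Sum>j<n. t j * (X i \<omega> * (a j * X j \<omega> - b j * X i \<omega>)))" for \<omega>
    by (simp add: V_def sum_distrib_left algebra_simps)
  have int_XZ: "integrable M (\<lambda>\<omega>. X i \<omega> * (a j * X j \<omega> - b j * X i \<omega>))" for j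
  proof -
    have "integrable M (\<lambda>\<omega>. a j * (X i \<omega> * X j \<omega>) - b j * (X i \<omega> * X i \<omega>))"
      by (intro Bochner_Integration.integrable_diff integrable_mult_right product_integrable)
    then show ?thesis by (simp add: algebra_simps)
  qed
  have int_XV: "integrable M (\<lambda>\<omega>. X i \<omega> * V \<omega>)" unfolding XV using int_XZ by simp
  have "expectation (\<lambda>\<omega>. X i \<omega> * V \<omega>) = 0"
    unfolding XV using int_XZ uncorr by simp
  then have "expectation (\<lambda>\<omega>. (s * X i \<omega> + V \<omega>)\<^sup>2) = expectation (\<lambda>\<omega>. (s * X i \<omega>)\<^sup>2) + expectation (\<lambda>\<omega>. (V \<omega>)\<^sup>2)"
    using square_integrable[of i] V2 int_XV
    by (simp add: power2_sum power_mult_distrib mult.assoc)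
  then show ?thesis
    unfolding V_def[symmetric] centered_normal_char[OF normal_sV] centered_normal_char[OF V] centered_normal_char[OF sX]
    by (simp add: exp_add[symmetric] add_divide_distrib flip: of_real_mult)
qed

text \<open>Factorised characters give the product rule on rectangles. Rectangles generate both
  sigma-algebras and are stable under intersection, so independence follows and the joint law is a
  product.\<close>

lemma distr_residuals:
  fixes a b :: "nat \<Rightarrow> real"
  assumes i: "i < n" and uncorr: "\<And>j. j < n \<Longrightarrow> expectation (\<lambda>\<omega>. X i \<omega> * (a j * X j \<omega> - b j * X i \<omega>)) = 0"
  defines "ZZ \<equiv> (\<lambda>\<omega>. \<lambda>j\<in>{..<n}. a j * X j \<omega> - b j * X i \<omega>)"
  shows "distr M borel (X i) \<Otimes>\<^sub>M distr M (\<Pi>\<^sub>M j\<in>{..<n}. borel) ZZ =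
    distr M (borel \<Otimes>\<^sub>M (\<Pi>\<^sub>M j\<in>{..<n}. borel)) (\<lambda>\<omega>. (X i \<omega>, ZZ \<omega>))"
proof -
  define Z where "Z j \<omega> = a j * X j \<omega> - b j * X i \<omega>" for j \<omega>
  have [measurable]: "Z j \<in> borel_measurable M" for j unfolding Z_def by measurable
  have ZZ_eq: "ZZ = (\<lambda>\<omega>. \<lambda>j\<in>{..<n}. Z j \<omega>)" by (simp add: ZZ_def Z_def)
  have ZZ [measurable]: "ZZ \<in> measurable M (\<Pi>\<^sub>M j\<in>{..<n}. borel)" unfolding ZZ_eq by measurable
  define Q where "Q = {Pi\<^sub>E {..<n} B | B. (\<forall>j. B j \<in> sets (borel :: real measure)) \<and> finite {j. B j \<noteq> UNIV}}"
  define G1 where "G1 = {X i -` A \<inter> space M |A. A \<in> sets borel}"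
  define G2 where "G2 = {ZZ -` A \<inter> space M |A. A \<in> Q}"
  have Q: "sets (\<Pi>\<^sub>M j\<in>{..<n}. borel) = sigma_sets (\<Pi>\<^sub>E j\<in>{..<n}. (UNIV :: real set)) Q"
    unfolding Q_def using sets_PiM_finite[of "{..<n}" "\<lambda>_. borel :: real measure"] by simp
  have "indep_set G1 G2"
  proof (rule indep_setI)
    show "G1 \<subseteq> events" by (auto simp: G1_def)
    have "A \<in> sets (\<Pi>\<^sub>M j\<in>{..<n}. borel)" if "A \<in> Q" for A unfolding Q using that by (rule sigma_sets.Basic)
    then show "G2 \<subseteq> events" unfolding G2_def using measurable_sets[OF ZZ] by blast
    fix E1 E2 assume "E1 \<in> G1" "E2 \<in> G2"
    then obtain A B where A: "A \<in> sets borel" "E1 = X i -` A \<inter> space M"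
      and B [measurable]: "\<And>j. B j \<in> sets borel" and E2_def: "E2 = ZZ -` (Pi\<^sub>E {..<n} B) \<inter> space M"
      by (auto simp: G1_def G2_def Q_def)
    have [measurable]: "A \<in> sets borel" by (rule A)
    have E2: "E2 = {\<omega> \<in> space M. \<forall>j<n. Z j \<omega> \<in> B j}"
      unfolding E2_def ZZ_eq PiE_iff vimage_def by (auto simp: restrict_extensional)
    have [measurable]: "E1 \<in> events" "E2 \<in> events" unfolding A(2) E2 by auto
    have prod: "(\<Prod>j<n. indicator (B j) (Z j \<omega>)) = (indicator E2 \<omega> :: complex)" if "\<omega> \<in> space M" for \<omega>
    proof (cases "\<forall>j<n. Z j \<omega> \<in> B j")
      case False
      then obtain j where "j < n" "Z j \<omega> \<notin> B j" by auto
      then have "(\<Prod>j<n. indicator (B j) (Z j \<omega>) :: complex) = 0" by (auto simp: indicator_def)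
      then show ?thesis using False that by (auto simp: E2)
    qed (use that in \<open>auto simp: E2\<close>)
    \<comment> \<open>Once all \<open>n\<close> coordinates are converted the remaining character is
      1, and the identity is the product rule for \<open>E1\<close> and \<open>E2\<close>.\<close>
    have "(\<integral>\<omega>. (indicator A (X i \<omega>) - prob (X i -` A \<inter> space M)) *
      ((\<Prod>j<n. indicator (B j) (Z j \<omega>)) * iexp (\<Sum>j\<in>{n..<n}. 0 * Z j \<omega>)) \<partial>M) = 0"
      using char_factor[OF i uncorr]
      by (intro char_factor_rectangle[where n = n] A B) (auto simp: Z_def)
    also have "(\<integral>\<omega>. (indicator A (X i \<omega>) - prob (X i -` A \<inter> space M)) *
      ((\<Prod>j<n. indicator (B j) (Z j \<omega>)) * iexp (\<Sum>j\<in>{n..<n}. 0 * Z j \<omega>)) \<partial>M) =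
      (\<integral>\<omega>. complex_of_real (indicator (E1 \<inter> E2) \<omega> - prob E1 * indicator E2 \<omega>) \<partial>M)"
      using prod by (intro Bochner_Integration.integral_cong) (auto simp: A(2) indicator_def)
    also have "\<dots> = complex_of_real (expectation (\<lambda>\<omega>. indicator (E1 \<inter> E2) \<omega> - prob E1 * indicator E2 \<omega>))"
      by (rule integral_complex_of_real)
    also have "expectation (\<lambda>\<omega>. indicator (E1 \<inter> E2) \<omega> - prob E1 * indicator E2 \<omega>) = prob (E1 \<inter> E2) - prob E1 * prob E2"
    proof -
      have "integrable M (indicat_real (E1 \<inter> E2))" "integrable M (\<lambda>\<omega>. prob E1 * indicat_real E2 \<omega>)"
        by (auto intro!: integrable_real_indicator simp: emeasure_eq_measure)
      then show ?thesis by simp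
    qed
    finally have "prob (E1 \<inter> E2) - prob E1 * prob E2 = 0" unfolding of_real_eq_0_iff .
    then show "prob (E1 \<inter> E2) = prob E1 * prob E2" by simp
  qed
  moreover have "Int_stable G1"
  proof (rule Int_stableI)
    fix E E' assume "E \<in> G1" "E' \<in> G1"
    then obtain A A' where "A \<in> sets borel" "A' \<in> sets borel" "E = X i -` A \<inter> space M" "E' = X i -` A' \<inter> space M"
      by (auto simp: G1_def)
    then have "A \<inter> A' \<in> sets borel" "E \<inter> E' = X i -` (A \<inter> A') \<inter> space M" by auto
    then show "E \<inter> E' \<in> G1" unfolding G1_def by blast
  qed
  moreover have "Int_stable G2"
  proof (rule Int_stableI)
    fix E E' assume "E \<in> G2" "E' \<in> G2"
    then obtain B B' where B: "\<forall>j. B j \<in> sets borel" "finite {j. B j \<noteq> UNIV}" "E = ZZ -` (Pi\<^sub>E {..<n} B) \<inter> space M"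
      and B': "\<forall>j. B' j \<in> sets borel" "finite {j. B' j \<noteq> UNIV}" "E' = ZZ -` (Pi\<^sub>E {..<n} B') \<inter> space M"
      by (auto simp: G2_def Q_def)
    have "{j. B j \<inter> B' j \<noteq> UNIV} \<subseteq> {j. B j \<noteq> UNIV} \<union> {j. B' j \<noteq> UNIV}" by auto
    then have "finite {j. B j \<inter> B' j \<noteq> UNIV}" using B(2) B'(2) finite_subset by blast
    then have "Pi\<^sub>E {..<n} (\<lambda>j. B j \<inter> B' j) \<in> Q"
      using B(1) B'(1) unfolding Q_def by (intro CollectI exI[of _ "\<lambda>j. B j \<inter> B' j"]) auto
    moreover have "E \<inter> E' = ZZ -` (Pi\<^sub>E {..<n} (\<lambda>j. B j \<inter> B' j)) \<inter> space M"
      unfolding B(3) B'(3) PiE_Int[symmetric] by auto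
    ultimately show "E \<inter> E' \<in> G2" unfolding G2_def by blast
  qed
  ultimately have "indep_set (sigma_sets (space M) G1) (sigma_sets (space M) G2)"
    by (rule indep_set_sigma_sets)
  moreover have "{ZZ -` A \<inter> space M |A. A \<in> sets (\<Pi>\<^sub>M j\<in>{..<n}. borel)} = sigma_sets (space M) G2"
    unfolding G2_def Q by (rule sigma_sets_vimage_commute) (auto simp: ZZ_eq)
  ultimately have indep: "prob ((X i -` A \<inter> space M) \<inter> (ZZ -` B \<inter> space M)) = prob (X i -` A \<inter> space M) * prob (ZZ -` B \<inter> space M)"
    if "A \<in> sets borel" "B \<in> sets (\<Pi>\<^sub>M j\<in>{..<n}. borel)" for A B
    using that by (intro indep_setD) (auto simp: G1_def)
  interpret D1: prob_space "distr M borel (X i)" by (rule prob_space_distr) simp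
  interpret D2: prob_space "distr M (\<Pi>\<^sub>M j\<in>{..<n}. borel) ZZ" by (rule prob_space_distr) simp
  show ?thesis
  proof (rule pair_measure_eqI)
    fix A B assume "A \<in> sets (distr M borel (X i))" "B \<in> sets (distr M (\<Pi>\<^sub>M j\<in>{..<n}. borel) ZZ)"
    then have [measurable]: "A \<in> sets borel" "B \<in> sets (\<Pi>\<^sub>M j\<in>{..<n}. borel)" by auto
    have "(\<lambda>\<omega>. (X i \<omega>, ZZ \<omega>)) -` (A \<times> B) \<inter> space M = (X i -` A \<inter> space M) \<inter> (ZZ -` B \<inter> space M)" by auto
    then show "emeasure (distr M borel (X i)) A * emeasure (distr M (\<Pi>\<^sub>M j\<in>{..<n}. borel) ZZ) B =
      emeasure (distr M (borel \<Otimes>\<^sub>M (\<Pi>\<^sub>M j\<in>{..<n}. borel)) (\<lambda>\<omega>. (X i \<omega>, ZZ \<omega>))) (A \<times> B)"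
      by (simp add: emeasure_distr emeasure_eq_measure indep ennreal_mult)
  qed (auto simp: D1.sigma_finite_measure_axioms D2.sigma_finite_measure_axioms intro!: sets_pair_measure_cong)
qed

lemma distr_X:
  assumes "0 < sd i" shows "distr M borel (X i) = density lborel (normal_density 0 (sd i))"
  using normal_X[of i]
proof (cases rule: centered_normal_cases)
  case 1
  then show ?thesis using assms by (simp add: sd_def)
next
  case (2 \<sigma>)
  then show ?thesis using assms by (simp add: sd_def)
qed

text \<open>Ties are broken in favour of the least index, so that the events for different \<open>i\<close> are disjoint.\<close>

definition argmax_event :: "real \<Rightarrow> nat set \<Rightarrow> nat \<Rightarrow> real set \<Rightarrow> 'a set" where
  "argmax_event q J i I = {\<omega> \<in> space M. (X i \<omega> - q) / sd i \<in> I \<and>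
     (\<forall>j\<in>J. if j < i then (X j \<omega> - q) / sd j < (X i \<omega> - q) / sd i
            else (X j \<omega> - q) / sd j \<le> (X i \<omega> - q) / sd i)}"

lemma argmax_event_sets [measurable]: "I \<in> sets borel \<Longrightarrow> argmax_event q J i I \<in> events"
proof -
  assume [measurable]: "I \<in> sets borel"
  have [measurable]: "{\<omega> \<in> space M. if j < i then (X j \<omega> - q) / sd j < (X i \<omega> - q) / sd i
            else (X j \<omega> - q) / sd j \<le> (X i \<omega> - q) / sd i} \<in> events" for j
    by (cases "j < i") auto
  show ?thesis unfolding argmax_event_def by measurable
qed

text \<open>Given the part of the sequence that is independent of \<open>X i\<close>, the argmax condition describes an
  up-set of values of \<open>X i\<close>, because the regression coefficients of \<open>X j / sd j\<close> on \<open>X i / sd i\<close> are at most 1.\<close>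

lemma argmax_event_shift:
  assumes J: "finite J" "i \<in> J" and pos: "\<And>j. j \<in> J \<Longrightarrow> 0 < sd j"
    and \<tau>: "0 \<le> \<tau>" "\<tau> \<le> 1" and q: "0 \<le> q"
  shows "prob (argmax_event q J i {-\<eta><..0}) \<le> exp (q / sd i + 1) * prob (argmax_event q J i {\<tau> - \<eta><..\<tau>})"
proof -
  obtain n where n: "\<And>j. j \<in> J \<Longrightarrow> j < n" using J finite_nat_set_iff_bounded by auto
  have si: "0 < sd i" using J pos by simp
  \<comment> \<open>Indices outside \<open>J\<close> get coefficient 0: their \<open>sd\<close> may
    vanish, and a zero residual is trivially uncorrelated with \<open>X i\<close>.\<close>
  define a where "a j = (if j \<in> J then 1 / sd j else 0)" for j
  \<comment> \<open>\<open>r j\<close> is the correlation, and for \<open>j\<close> in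
    \<open>J\<close> the residual is \<open>X j / sd j - r j * (X i / sd i)\<close>.\<close>
  define r where "r j = expectation (\<lambda>\<omega>. X i \<omega> * X j \<omega>) / (sd i * sd j)" for j
  define b where "b j = (if j \<in> J then r j / sd i else 0)" for j
  have r1: "r j \<le> 1" if "j \<in> J" for j
    using covariance_le[of i j] pos[OF that] si by (simp add: r_def divide_le_eq)
  have uncorr: "expectation (\<lambda>\<omega>. X i \<omega> * (a j * X j \<omega> - b j * X i \<omega>)) = 0" for j
  proof (cases "j \<in> J")
    case True
    have "expectation (\<lambda>\<omega>. X i \<omega> * (a j * X j \<omega> - b j * X i \<omega>)) =
      expectation (\<lambda>\<omega>. a j * (X i \<omega> * X j \<omega>) - b j * (X i \<omega>)\<^sup>2)"
      by (simp add: power2_eq_square algebra_simps)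
    also have "\<dots> = a j * expectation (\<lambda>\<omega>. X i \<omega> * X j \<omega>) - b j * (sd i)\<^sup>2"
      using product_integrable[of i j] square_integrable[of i] by (simp add: sd_square)
    also have "\<dots> = 0" using True pos[OF True] si by (simp add: a_def b_def r_def power2_eq_square)
    finally show ?thesis .
  qed (simp add: a_def b_def)
  define ZZ where "ZZ = (\<lambda>\<omega>. \<lambda>j\<in>{..<n}. a j * X j \<omega> - b j * X i \<omega>)"
  let ?P = "\<Pi>\<^sub>M j\<in>{..<n}. borel :: real measure"
  have [measurable]: "ZZ \<in> measurable M ?P" unfolding ZZ_def by measurable
  define N where "N = density lborel (normal_density 0 (sd i))"
  define DZ where "DZ = distr M ?P ZZ"
  have joint: "N \<Otimes>\<^sub>M DZ = distr M (borel \<Otimes>\<^sub>M ?P) (\<lambda>\<omega>. (X i \<omega>, ZZ \<omega>))"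
    using distr_residuals[of i n a b] n J uncorr by (simp add: N_def DZ_def distr_X[OF si] ZZ_def)
  interpret N: prob_space N unfolding N_def by (rule prob_space_normal_density[OF si])
  interpret DZ: prob_space DZ unfolding DZ_def by (rule prob_space_distr) simp
  interpret NZ: pair_sigma_finite N DZ ..
  \<comment> \<open>The comparison of normalised values, solved for the residual \<open>z\<close>.
    Since \<open>1 - r j\<close> is nonnegative, the condition persists when \<open>x\<close>
    grows.\<close>
  define below where "below j z x \<longleftrightarrow> (if j < i then z - q / sd j < (1 - r j) * (x / sd i) - q / sd i
     else z - q / sd j \<le> (1 - r j) * (x / sd i) - q / sd i)" for j and z x :: real
  define S where "S z = {x. \<forall>j\<in>J. below j (z j) x}" for z :: "nat \<Rightarrow> real"
  have S_up: "y \<in> S z" if "x \<in> S z" "x \<le> y" for x y z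
  proof -
    have "(1 - r j) * (x / sd i) \<le> (1 - r j) * (y / sd i)" if "j \<in> J" for j
      using r1[OF that] \<open>x \<le> y\<close> si by (intro mult_left_mono divide_right_mono) auto
    then show ?thesis using that(1) unfolding S_def below_def by (fastforce split: if_splits)
  qed
  have comp [measurable]: "(\<lambda>p. snd p j) \<in> borel_measurable (borel \<Otimes>\<^sub>M ?P)" if "j \<in> J" for j
    using n[OF that] by (intro measurable_compose[OF measurable_snd] measurable_component_singleton) simp
  have T_sets [measurable]: "{p \<in> space (borel \<Otimes>\<^sub>M ?P). fst p \<in> {c<..d} \<and> fst p \<in> S (snd p)} \<in> sets (borel \<Otimes>\<^sub>M ?P)"
    for c d :: real
  proof -
    have 1: "{p \<in> space (borel \<Otimes>\<^sub>M ?P). below j (snd p j) (fst p)} \<in> sets (borel \<Otimes>\<^sub>M ?P)" if "j \<in> J" for j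
    proof -
      note [measurable] = comp[OF that]
      have "{p \<in> space (borel \<Otimes>\<^sub>M ?P). snd p j - q / sd j < (1 - r j) * (fst p / sd i) - q / sd i} \<in> sets (borel \<Otimes>\<^sub>M ?P)"
        "{p \<in> space (borel \<Otimes>\<^sub>M ?P). snd p j - q / sd j \<le> (1 - r j) * (fst p / sd i) - q / sd i} \<in> sets (borel \<Otimes>\<^sub>M ?P)"
        by measurable
      then show ?thesis unfolding below_def by (cases "j < i") (simp_all only: if_True if_False)
    qed
    have 2: "{p \<in> space (borel \<Otimes>\<^sub>M ?P). \<forall>j\<in>J. below j (snd p j) (fst p)} \<in> sets (borel \<Otimes>\<^sub>M ?P)"
      by (rule sets.sets_Collect_finite_All[OF 1 J(1)])
    have 3: "{p \<in> space (borel \<Otimes>\<^sub>M ?P). fst p \<in> {c<..d}} \<in> sets (borel \<Otimes>\<^sub>M ?P)" by measurable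
    show ?thesis unfolding S_def mem_Collect_eq by (rule sets.sets_Collect_conj[OF 2 3])
  qed
  have S_sets: "S z \<in> sets borel" for z
  proof -
    have "{x \<in> space borel. below j (z j) x} \<in> sets borel" for j
      unfolding below_def by (cases "j < i") auto
    then have "{x \<in> space borel. \<forall>j\<in>J. below j (z j) x} \<in> sets borel"
      using J by (intro sets.sets_Collect_finite_All') auto
    then show ?thesis by (simp add: S_def)
  qed
  have iff: "\<omega> \<in> argmax_event q J i {c<..d} \<longleftrightarrow>
      X i \<omega> \<in> {q + sd i * c<..q + sd i * d} \<and> X i \<omega> \<in> S (ZZ \<omega>)" if "\<omega> \<in> space M" for c d \<omega>
  proof -
    have eq: "(X j \<omega> - q) / sd j - (X i \<omega> - q) / sd i =
      (ZZ \<omega> j - q / sd j) - ((1 - r j) * (X i \<omega> / sd i) - q / sd i)" if "j \<in> J" for j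
      using n[OF that] that pos[OF that] si by (simp add: ZZ_def a_def b_def field_simps)
    have "(\<forall>j\<in>J. if j < i then (X j \<omega> - q) / sd j < (X i \<omega> - q) / sd i
            else (X j \<omega> - q) / sd j \<le> (X i \<omega> - q) / sd i) \<longleftrightarrow> X i \<omega> \<in> S (ZZ \<omega>)"
      unfolding S_def below_def mem_Collect_eq using eq by (intro ball_cong refl) (auto, (smt (verit))+)
    moreover have "(X i \<omega> - q) / sd i \<in> {c<..d} \<longleftrightarrow> X i \<omega> \<in> {q + sd i * c<..q + sd i * d}"
      using si by (auto simp: field_simps)
    ultimately show ?thesis using that unfolding argmax_event_def by blast
  qed
  have int: "emeasure M (argmax_event q J i {c<..d}) =
    (\<integral>\<^sup>+z. emeasure N ({q + sd i * c<..q + sd i * d} \<inter> S z) \<partial>DZ)" for c d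
  proof -
    let ?T = "{p \<in> space (borel \<Otimes>\<^sub>M ?P). fst p \<in> {q + sd i * c<..q + sd i * d} \<and> fst p \<in> S (snd p)}"
    have sets_NZ: "sets (N \<Otimes>\<^sub>M DZ) = sets (borel \<Otimes>\<^sub>M ?P)"
      by (intro sets_pair_measure_cong) (auto simp: N_def DZ_def)
    have "argmax_event q J i {c<..d} = (\<lambda>\<omega>. (X i \<omega>, ZZ \<omega>)) -` ?T \<inter> space M"
    proof (intro set_eqI)
      fix \<omega>
      show "\<omega> \<in> argmax_event q J i {c<..d} \<longleftrightarrow> \<omega> \<in> (\<lambda>\<omega>. (X i \<omega>, ZZ \<omega>)) -` ?T \<inter> space M"
      proof (cases "\<omega> \<in> space M")
        case True
        have "ZZ \<omega> \<in> space ?P" using True measurable_space[of ZZ M ?P] by simp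
        then show ?thesis unfolding iff[OF True] using True by (auto simp: space_pair_measure)
      qed (auto simp: argmax_event_def)
    qed
    then have "emeasure M (argmax_event q J i {c<..d}) = emeasure (N \<Otimes>\<^sub>M DZ) ?T"
      unfolding joint using T_sets by (subst emeasure_distr) (simp_all only: argmax_event_sets, measurable)
    also have "\<dots> = (\<integral>\<^sup>+z. emeasure N ((\<lambda>x. (x, z)) -` ?T) \<partial>DZ)"
      using T_sets by (intro NZ.emeasure_pair_measure_alt2) (simp add: sets_NZ)
    also have "\<dots> = (\<integral>\<^sup>+z. emeasure N ({q + sd i * c<..q + sd i * d} \<inter> S z) \<partial>DZ)"
    proof (intro nn_integral_cong arg_cong[where f = "emeasure N"])
      fix z assume "z \<in> space DZ"
      then have "z \<in> space ?P" by (simp add: DZ_def)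
      then show "(\<lambda>x. (x, z)) -` ?T = {q + sd i * c<..q + sd i * d} \<inter> S z"
        by (auto simp: space_pair_measure)
    qed
    finally show ?thesis .
  qed
  have "emeasure M (argmax_event q J i {-\<eta><..0}) = (\<integral>\<^sup>+z. emeasure N ({q + sd i * (- \<eta>)<..q + sd i * 0} \<inter> S z) \<partial>DZ)"
    by (rule int)
  also have "\<dots> \<le> (\<integral>\<^sup>+z. ennreal (exp (q / sd i + 1)) * emeasure N ({q + sd i * (\<tau> - \<eta>)<..q + sd i * \<tau>} \<inter> S z) \<partial>DZ)"
  proof (rule nn_integral_mono)
    fix z
    show "emeasure N ({q + sd i * (- \<eta>)<..q + sd i * 0} \<inter> S z) \<le>
      ennreal (exp (q / sd i + 1)) * emeasure N ({q + sd i * (\<tau> - \<eta>)<..q + sd i * \<tau>} \<inter> S z)"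
      \<comment> \<open>On the scale of \<open>X i\<close> the shift is
        \<open>sd i * \<tau>\<close>, at most \<open>sd i\<close> since
        \<open>\<tau> \<le> 1\<close>. The upper end of the unshifted window is \<open>q\<close>,
        which plays the role of \<open>b\<close>.\<close>
      using normal_shift_upset_le[of "sd i" "sd i * \<tau>" q "S z" "q + sd i * (- \<eta>)"] S_sets S_up si q \<tau>
      by (simp add: N_def algebra_simps mult_left_le)
  qed
  also have "\<dots> = ennreal (exp (q / sd i + 1)) * (\<integral>\<^sup>+z. emeasure N ({q + sd i * (\<tau> - \<eta>)<..q + sd i * \<tau>} \<inter> S z) \<partial>DZ)"
  proof (rule nn_integral_cmult)
    let ?T = "{p \<in> space (borel \<Otimes>\<^sub>M ?P). fst p \<in> {q + sd i * (\<tau> - \<eta>)<..q + sd i * \<tau>} \<and> fst p \<in> S (snd p)}"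
    have "?T \<in> sets (N \<Otimes>\<^sub>M DZ)"
      using T_sets by (simp add: N_def DZ_def cong: sets_pair_measure_cong)
    then have "(\<lambda>z. emeasure N ((\<lambda>x. (x, z)) -` ?T)) \<in> borel_measurable DZ"
      by (rule NZ.measurable_emeasure_Pair2)
    moreover have "(\<lambda>x. (x, z)) -` ?T = {q + sd i * (\<tau> - \<eta>)<..q + sd i * \<tau>} \<inter> S z" if "z \<in> space DZ" for z
      using that by (auto simp: space_pair_measure DZ_def)
    ultimately show "(\<lambda>z. emeasure N ({q + sd i * (\<tau> - \<eta>)<..q + sd i * \<tau>} \<inter> S z)) \<in> borel_measurable DZ"
      by (simp cong: measurable_cong)
  qed
  also have "\<dots> = ennreal (exp (q / sd i + 1)) * emeasure M (argmax_event q J i {\<tau> - \<eta><..\<tau>})"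
    by (simp only: int)
  finally show ?thesis by (simp add: emeasure_eq_measure ennreal_mult[symmetric])
qed

text \<open>The size of \<open>J\<close> does not enter, since argmax events of different indices
  are disjoint. The window has width \<open>s / m\<close> because division by a standard deviation
  of at least \<open>s\<close> turns this into at most \<open>1 / m\<close>, the length of the
  comparison intervals.\<close>

lemma prob_finite_max_le:
  assumes J: "finite J" and pos: "\<And>j. j \<in> J \<Longrightarrow> s \<le> sd j" "0 < s" and q: "0 \<le> q" and m: "0 < (m::nat)"
  shows "prob {\<omega> \<in> space M. (\<forall>j\<in>J. X j \<omega> \<le> q) \<and> (\<exists>j\<in>J. q - s / m < X j \<omega>)} \<le> exp (q / s + 1) / m"
proof -
  define I where "I k = {real k / m - 1 / m<..real k / m}" for k :: nat
  have I [measurable]: "I k \<in> sets borel" for k by (simp add: I_def)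
  define E where "E i k = argmax_event q J i (I k)" for i k
  have E [measurable]: "E i k \<in> events" for i k by (simp add: E_def)
  have sd_pos: "0 < sd j" if "j \<in> J" for j using pos(1)[OF that] pos(2) by linarith
  have uniq: "i = i' \<and> k = k'" if i: "i \<in> J" "i' \<in> J" and w: "\<omega> \<in> E i k" "\<omega> \<in> E i' k'" for i i' k k' \<omega>
  proof -
    \<comment> \<open>The asymmetric rule for ties excludes that two indices win together.\<close>
    have "\<not> i < i'" "\<not> i' < i"
      using w i by (fastforce simp: E_def argmax_event_def)+
    then have eq: "i = i'" by simp
    define y where "y = (X i \<omega> - q) / sd i * m"
    have "real k - 1 < y" "y \<le> real k" "real k' - 1 < y" "y \<le> real k'"
      using w eq m by (auto simp: E_def argmax_event_def I_def y_def field_simps)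
    then have "k = k'" by linarith
    then show ?thesis using eq by simp
  qed
  have disj: "disjoint_family_on (\<lambda>p. E (fst p) (snd p)) (J \<times> {1..m})"
    unfolding disjoint_family_on_def
  proof (intro ballI impI equals0I)
    fix p p' \<omega> assume "p \<in> J \<times> {1..m}" "p' \<in> J \<times> {1..m}" "p \<noteq> p'" "\<omega> \<in> E (fst p) (snd p) \<inter> E (fst p') (snd p')"
    then show False using uniq[of "fst p" "fst p'" \<omega> "snd p" "snd p'"] by (auto simp: prod_eq_iff)
  qed
  have "(\<Sum>k\<in>{1..m}. \<Sum>i\<in>J. prob (E i k)) = (\<Sum>p\<in>J \<times> {1..m}. prob (E (fst p) (snd p)))"
    by (subst sum.swap) (simp add: sum.cartesian_product case_prod_unfold)
  also have "\<dots> = prob (\<Union>p\<in>J \<times> {1..m}. E (fst p) (snd p))"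
    using J disj by (intro finite_measure_finite_Union[symmetric]) auto
  also have "\<dots> \<le> 1" by (rule prob_le_1)
  finally have total: "(\<Sum>k\<in>{1..m}. \<Sum>i\<in>J. prob (E i k)) \<le> 1" .
  define p where "p = (\<Sum>i\<in>J. prob (E i 0))"
  have "p \<le> exp (q / s + 1) * (\<Sum>i\<in>J. prob (E i k))" if k: "k \<in> {1..m}" for k
  proof -
    have "prob (E i 0) \<le> exp (q / s + 1) * prob (E i k)" if i: "i \<in> J" for i
    proof -
      have "prob (E i 0) \<le> exp (q / sd i + 1) * prob (E i k)"
        using argmax_event_shift[OF J i sd_pos, of "real k / m" q "1 / m"] k m q
        by (simp add: E_def I_def)
      also have "\<dots> \<le> exp (q / s + 1) * prob (E i k)"
        using pos(1)[OF i] pos(2) q by (intro mult_right_mono) (auto intro!: divide_left_mono)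
      finally show ?thesis .
    qed
    then show ?thesis unfolding p_def sum_distrib_left by (intro sum_mono)
  qed
  then have "(\<Sum>k\<in>{1..m}. p) \<le> (\<Sum>k\<in>{1..m}. exp (q / s + 1) * (\<Sum>i\<in>J. prob (E i k)))"
    by (intro sum_mono)
  also have "\<dots> = exp (q / s + 1) * (\<Sum>k\<in>{1..m}. \<Sum>i\<in>J. prob (E i k))" by (simp add: sum_distrib_left)
  also have "\<dots> \<le> exp (q / s + 1) * 1" using total by (intro mult_left_mono) auto
  finally have p: "p \<le> exp (q / s + 1) / m" using m by (simp add: field_simps)
  have "{\<omega> \<in> space M. (\<forall>j\<in>J. X j \<omega> \<le> q) \<and> (\<exists>j\<in>J. q - s / m < X j \<omega>)} \<subseteq> (\<Union>i\<in>J. E i 0)"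
  proof safe
    fix \<omega> j assume w: "\<omega> \<in> space M" "\<forall>j\<in>J. X j \<omega> \<le> q" and j: "j \<in> J" "q - s / m < X j \<omega>"
    define Y where "Y j = (X j \<omega> - q) / sd j" for j
    define mx where "mx = Max (Y ` J)"
    have mx: "mx \<in> Y ` J" unfolding mx_def using J j by (intro Max_in) auto
    have Y_le: "Y i \<le> mx" if "i \<in> J" for i unfolding mx_def using J that by (intro Max_ge) auto
    define i where "i = (LEAST i. i \<in> J \<and> Y i = mx)"
    have "\<exists>i. i \<in> J \<and> Y i = mx" using mx by auto
    then have i: "i \<in> J \<and> Y i = mx" unfolding i_def by (rule LeastI_ex)
    have "Y l < mx" if "l \<in> J" "l < i" for l
      using not_less_Least[of l "\<lambda>i. i \<in> J \<and> Y i = mx"] that Y_le[of l] by (auto simp: i_def)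
    moreover have "mx \<le> 0" using i w sd_pos[of i] by (auto simp: Y_def divide_le_0_iff)
    moreover have "- 1 / m < mx"
    proof -
      have "- 1 / m \<le> - (s / m) / sd j" using pos(1)[OF j(1)] pos(2) m by (simp add: field_simps)
      also have "\<dots> < Y j" unfolding Y_def using j sd_pos[OF j(1)] by (intro divide_strict_right_mono) auto
      finally show ?thesis using Y_le[OF j(1)] by simp
    qed
    ultimately have "\<omega> \<in> E i 0"
      using w i Y_le by (auto simp: E_def I_def argmax_event_def Y_def[symmetric])
    then show "\<omega> \<in> (\<Union>i\<in>J. E i 0)" using i by auto
  qed
  then have "prob {\<omega> \<in> space M. (\<forall>j\<in>J. X j \<omega> \<le> q) \<and> (\<exists>j\<in>J. q - s / m < X j \<omega>)} \<le> prob (\<Union>i\<in>J. E i 0)"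
    using J by (intro finite_measure_mono) auto
  also have "\<dots> \<le> p" unfolding p_def using J by (intro finite_measure_subadditive_finite) auto
  finally show ?thesis using p by simp
qed

text \<open>The finite bound is uniform in the number of coordinates, so continuity from below
  carries it to the whole family, and letting \<open>m\<close> grow gives 0. \<open>G n\<close>
  bounds all coordinates of large variance by \<open>q\<close>, not only the first \<open>n\<close>;
  this makes it increasing in \<open>n\<close>.\<close>

lemma prob_sup_large_variance:
  assumes s: "0 < s" and q: "0 \<le> q"
  shows "prob {\<omega> \<in> space M. (\<forall>j. s \<le> sd j \<longrightarrow> X j \<omega> \<le> q) \<and> (\<forall>e>0. \<exists>j. s \<le> sd j \<and> q - e < X j \<omega>)} = 0"
    (is "prob ?F = 0")
proof -
  have "prob ?F \<le> exp (q / s + 1) / m" if m: "0 < (m::nat)" for m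
  proof -
    have incseq_aux: "incseq (\<lambda>n. {\<omega> \<in> space M. P \<omega> \<and> (\<exists>j\<in>{j. j < n \<and> s \<le> sd j}. Q j \<omega>)})" for P Q
      unfolding incseq_def by (intro allI impI subsetI) (auto dest: less_le_trans)
    define J where "J n = {j. j < n \<and> s \<le> sd j}" for n
    define G where "G n = {\<omega> \<in> space M. (\<forall>j. s \<le> sd j \<longrightarrow> X j \<omega> \<le> q) \<and> (\<exists>j\<in>J n. q - s / m < X j \<omega>)}" for n
    have fin: "finite (J n)" for n by (simp add: J_def)
    have [measurable]: "G n \<in> events" for n unfolding G_def J_def by measurable
    have "prob (G n) \<le> exp (q / s + 1) / m" for n
    proof -
      have "prob (G n) \<le> prob {\<omega> \<in> space M. (\<forall>j\<in>J n. X j \<omega> \<le> q) \<and> (\<exists>j\<in>J n. q - s / m < X j \<omega>)}"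
        using fin by (intro finite_measure_mono) (auto simp: G_def J_def)
      also have "\<dots> \<le> exp (q / s + 1) / m"
        using s q m fin by (intro prob_finite_max_le) (auto simp: J_def)
      finally show ?thesis .
    qed
    moreover have "(\<lambda>n. prob (G n)) \<longlonglongrightarrow> prob (\<Union>n. G n)"
      unfolding G_def J_def using incseq_aux
      by (intro finite_Lim_measure_incseq) auto
    ultimately have "prob (\<Union>n. G n) \<le> exp (q / s + 1) / m"
      by (intro LIMSEQ_le_const2) auto
    moreover have "?F \<subseteq> (\<Union>n. G n)"
    proof safe
      fix \<omega> assume w: "\<omega> \<in> space M" "\<forall>j. s \<le> sd j \<longrightarrow> X j \<omega> \<le> q" "\<forall>e>0. \<exists>j. s \<le> sd j \<and> q - e < X j \<omega>"
      have "0 < s / m" using s m by simp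
      then obtain j where "s \<le> sd j" "q - s / m < X j \<omega>" using w(3) by blast
      then have "\<omega> \<in> G (Suc j)" using w by (auto simp: G_def J_def)
      then show "\<omega> \<in> (\<Union>n. G n)" by blast
    qed
    then have "prob ?F \<le> prob (\<Union>n. G n)" by (intro finite_measure_mono) auto
    ultimately show ?thesis by linarith
  qed
  moreover have "(\<lambda>m. exp (q / s + 1) / real m) \<longlonglongrightarrow> 0"
    by (intro real_tendsto_divide_at_top[OF tendsto_const] filterlim_real_sequentially)
  ultimately have "prob ?F \<le> 0"
    by (intro LIMSEQ_le_const) (auto intro!: exI[of _ 1])
  then show ?thesis by (simp add: measure_le_0_iff)
qed

lemma prob_abs_gt_le:
  assumes "0 < e" shows "prob {\<omega> \<in> space M. e < \<bar>X j \<omega>\<bar>} \<le> (sd j)\<^sup>2 / e\<^sup>2"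
proof -
  have "prob {\<omega> \<in> space M. e < \<bar>X j \<omega>\<bar>} \<le> prob {\<omega> \<in> space M. e\<^sup>2 \<le> (X j \<omega>)\<^sup>2}"
    using assms by (intro finite_measure_mono) (auto simp: abs_le_square_iff[symmetric])
  also have "\<dots> \<le> expectation (\<lambda>\<omega>. (X j \<omega>)\<^sup>2) / e\<^sup>2"
    using assms by (intro integral_Markov_inequality_measure[where A = "space M"] square_integrable) auto
  finally show ?thesis by (simp add: sd_square)
qed

text \<open>On each of finitely many small balls of paths, a coordinate of small variance is somewhere small,
  hence small on the whole ball.\<close>

lemma prob_small_variance_large:
  assumes sep: "\<And>e. 0 < e \<Longrightarrow> \<exists>D\<subseteq>space M. countable D \<and> (\<forall>\<omega>\<in>space M. \<exists>\<omega>'\<in>D. \<forall>j. \<bar>X j \<omega> - X j \<omega>'\<bar> \<le> e)"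
    and q: "0 < q" and \<eta>: "0 < \<eta>"
  obtains s where "0 < s" "prob {\<omega> \<in> space M. \<exists>j. sd j < s \<and> q \<le> X j \<omega>} \<le> \<eta>"
proof -
  \<comment> \<open>A quarter leaves room for three errors: the value at \<open>\<omega>'\<close>
    and the distances of both paths to the centre \<open>d k\<close>.\<close>
  define e where "e = q / 4"
  have e: "0 < e" "3 * e < q" using q by (auto simp: e_def)
  obtain D where D: "D \<subseteq> space M" "countable D" "\<And>\<omega>. \<omega> \<in> space M \<Longrightarrow> \<exists>\<omega>'\<in>D. \<forall>j. \<bar>X j \<omega> - X j \<omega>'\<bar> \<le> e"
    using sep[OF e(1)] by blast
  have "D \<noteq> {}" using D(3) not_empty by fastforce
  define d where "d = from_nat_into D"
  have range_d: "range d = D" unfolding d_def using D \<open>D \<noteq> {}\<close> by simp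
  define B where "B k = {\<omega> \<in> space M. \<forall>j. \<bar>X j \<omega> - X j (d k)\<bar> \<le> e}" for k :: nat
  have [measurable]: "B k \<in> events" for k unfolding B_def by measurable
  have cover: "(\<Union>k. B k) = space M"
  proof safe
    fix \<omega> assume "\<omega> \<in> space M"
    moreover then obtain k where "\<forall>j. \<bar>X j \<omega> - X j (d k)\<bar> \<le> e"
      using D(3)[of \<omega>] range_d by (metis rangeE)
    ultimately show "\<omega> \<in> (\<Union>k. B k)" by (auto simp: B_def)
  qed (auto simp: B_def)
  have "(\<lambda>n. prob (\<Union>k\<le>n. B k)) \<longlonglongrightarrow> prob (\<Union>n. \<Union>k\<le>n. B k)"
    by (intro finite_Lim_measure_incseq) (force simp: incseq_def)+
  moreover have "(\<Union>n. \<Union>k\<le>n. B k) = space M" using cover by auto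
  ultimately have "(\<lambda>n. prob (\<Union>k\<le>n. B k)) \<longlonglongrightarrow> 1" by (simp add: prob_space)
  then have "eventually (\<lambda>n. 1 - \<eta> < prob (\<Union>k\<le>n. B k)) sequentially"
    using \<eta> by (intro order_tendstoD(1)[where a = "1 - \<eta>"]) auto
  then obtain n where n: "1 - \<eta> < prob (\<Union>k\<le>n. B k)"
    using eventually_happens by fastforce
  define K where "K = {k. k \<le> n \<and> 0 < prob (B k)}"
  \<comment> \<open>\<open>insert 1\<close> keeps the minimum defined if no ball is
    retained.\<close>
  define p where "p = Min (insert 1 ((\<lambda>k. prob (B k)) ` K))"
  have p: "0 < p" "\<And>k. k \<in> K \<Longrightarrow> p \<le> prob (B k)"
    unfolding p_def by (auto simp: K_def)
  \<comment> \<open>Chosen so that Chebyshev's bound \<open>s\<^sup>2 / e\<^sup>2\<close> equals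
    \<open>p / 2\<close>, which is less than the mass of each retained ball.\<close>
  define s where "s = e * sqrt (p / 2)"
  have s: "0 < s" "s\<^sup>2 / e\<^sup>2 < p" using e p by (auto simp: s_def power_mult_distrib)
  have small: "X j \<omega> < q" if j: "sd j < s" and k: "k \<in> K" and w: "\<omega> \<in> B k" for j k \<omega>
  proof -
    have "\<not> B k \<subseteq> {\<omega> \<in> space M. e < \<bar>X j \<omega>\<bar>}"
    proof
      assume "B k \<subseteq> {\<omega> \<in> space M. e < \<bar>X j \<omega>\<bar>}"
      then have "prob (B k) \<le> prob {\<omega> \<in> space M. e < \<bar>X j \<omega>\<bar>}" by (intro finite_measure_mono) auto
      also have "\<dots> \<le> (sd j)\<^sup>2 / e\<^sup>2" by (rule prob_abs_gt_le[OF e(1)])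
      also have "\<dots> \<le> s\<^sup>2 / e\<^sup>2" using j sd_nonneg by (intro divide_right_mono power_mono) auto
      finally show False using s p(2)[OF k] by simp
    qed
    then obtain \<omega>' where "\<omega>' \<in> B k" "\<bar>X j \<omega>'\<bar> \<le> e" by (force simp: B_def)
    then have "\<bar>X j \<omega>' - X j (d k)\<bar> \<le> e" "\<bar>X j \<omega> - X j (d k)\<bar> \<le> e" "\<bar>X j \<omega>'\<bar> \<le> e" using w by (auto simp: B_def)
    then show ?thesis using e(2) by linarith
  qed
  let ?E = "{\<omega> \<in> space M. \<exists>j. sd j < s \<and> q \<le> X j \<omega>}"
  have "prob ?E \<le> prob ((space M - (\<Union>k\<le>n. B k)) \<union> (\<Union>k\<in>{..n} - K. B k))"
  proof (rule finite_measure_mono)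
    show "?E \<subseteq> (space M - (\<Union>k\<le>n. B k)) \<union> (\<Union>k\<in>{..n} - K. B k)"
    proof safe
      fix \<omega> j k assume "\<omega> \<in> space M" "sd j < s" "q \<le> X j \<omega>" "\<omega> \<notin> (\<Union>k\<in>{..n} - K. B k)" "k \<le> n" "\<omega> \<in> B k"
      then show False using small[of j k \<omega>] by auto
    qed
  qed measurable
  also have "\<dots> \<le> prob (space M - (\<Union>k\<le>n. B k)) + prob (\<Union>k\<in>{..n} - K. B k)"
    by (intro measure_Un_le) auto
  also have "prob (\<Union>k\<in>{..n} - K. B k) \<le> (\<Sum>k\<in>{..n} - K. prob (B k))"
    by (intro finite_measure_subadditive_finite) auto
  also have "\<dots> = 0" by (intro sum.neutral) (auto simp: K_def less_le)
  also have "prob (space M - (\<Union>k\<le>n. B k)) = 1 - prob (\<Union>k\<le>n. B k)" by (intro prob_compl) auto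
  finally show ?thesis using that s n by fastforce
qed

text \<open>Countably many tolerances make the event of approaching \<open>q\<close> visibly
  measurable.\<close>

lemma approach_iff:
  fixes Y :: "nat \<Rightarrow> real"
  shows "(\<forall>e>0. \<exists>j. P j \<and> q - e < Y j) \<longleftrightarrow> (\<forall>n. \<exists>j. P j \<and> q - 1 / real (Suc n) < Y j)"
proof safe
  fix e :: real assume "\<forall>n. \<exists>j. P j \<and> q - 1 / real (Suc n) < Y j" "0 < e"
  moreover obtain n where "1 / real (Suc n) < e" using nat_approx_posE[OF \<open>0 < e\<close>] by blast
  ultimately show "\<exists>j. P j \<and> q - e < Y j" by (smt (verit))
qed auto

text \<open>Positivity of \<open>q\<close> matters: coordinates that are constantly zero have an
  atom at 0. For \<open>q > 0\<close> the coordinates that approach \<open>q\<close> can be taken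
  above \<open>q / 2\<close>, which excludes small variances up to probability
  \<open>\<eta>\<close>.\<close>

theorem prob_sup_eq_zero:
  assumes sep: "\<And>e. 0 < e \<Longrightarrow> \<exists>D\<subseteq>space M. countable D \<and> (\<forall>\<omega>\<in>space M. \<exists>\<omega>'\<in>D. \<forall>j. \<bar>X j \<omega> - X j \<omega>'\<bar> \<le> e)"
    and q: "0 < q"
  shows "prob {\<omega> \<in> space M. (\<forall>j. X j \<omega> \<le> q) \<and> (\<forall>e>0. \<exists>j. q - e < X j \<omega>)} = 0"
    (is "prob ?F = 0")
proof -
  have "prob ?F \<le> 0 + \<eta>" if \<eta>: "0 < \<eta>" for \<eta>
  proof -
    obtain s where s: "0 < s" "prob {\<omega> \<in> space M. \<exists>j. sd j < s \<and> q / 2 \<le> X j \<omega>} \<le> \<eta>"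
      using prob_small_variance_large[OF sep, of "q / 2" \<eta>] q \<eta> by auto
    let ?L = "{\<omega> \<in> space M. (\<forall>j. s \<le> sd j \<longrightarrow> X j \<omega> \<le> q) \<and> (\<forall>e>0. \<exists>j. s \<le> sd j \<and> q - e < X j \<omega>)}"
    let ?S = "{\<omega> \<in> space M. \<exists>j. sd j < s \<and> q / 2 \<le> X j \<omega>}"
    have L: "?L \<in> events" unfolding approach_iff by measurable
    have S: "?S \<in> events" by measurable
    have "?F \<subseteq> ?L \<union> ?S"
    proof safe
      fix \<omega> and e :: real
      assume w: "\<forall>j. X j \<omega> \<le> q" "\<forall>e>0. \<exists>j. q - e < X j \<omega>" and no: "\<nexists>j. sd j < s \<and> q / 2 \<le> X j \<omega>" and e: "0 < e"
      obtain j where j: "q - min e (q / 2) < X j \<omega>" using w(2) e q by (metis min_less_iff_conj half_gt_zero)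
      then have "q - e < X j \<omega>" "q / 2 \<le> X j \<omega>" by auto
      then show "\<exists>j. s \<le> sd j \<and> q - e < X j \<omega>" using no by (meson not_le_imp_less)
    qed auto
    then have "prob ?F \<le> prob (?L \<union> ?S)" by (rule finite_measure_mono[OF _ sets.Un[OF L S]])
    also have "\<dots> \<le> prob ?L + prob ?S" by (rule measure_Un_le[OF L S])
    finally show ?thesis using prob_sup_large_variance[of s q] s q by simp
  qed
  then have "prob ?F \<le> 0" by (rule field_le_epsilon)
  then show ?thesis by (simp add: measure_le_0_iff)
qed

end

section \<open>The MultiScan recursion\<close>

lemma multiscan_subset:
  assumes "multiscan \<gamma> q C A R" shows "C \<subseteq> R"
  using assms by induction auto

text \<open>For \<open>h = 1\<close> the open range of candidates is empty, hence the separate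
  clause. For larger \<open>h\<close> it contains \<open>n\<close>, so the maximizer inherits the
  exceedance, and \<open>n \<le> m\<close> because the first exceedance has the least position among
  those of its length.\<close>

lemma first_exceedance_local_maximizer:
  assumes first: "first_exceedance \<gamma> q A (n, h)" and max: "local_maximizer \<gamma> A n h m" and h: "1 \<le> h"
  shows "(m, h) \<in> A" "q < \<gamma> (m, h)" "n - h < m" "n \<le> m" "m < n + h"
proof -
  have n: "(n, h) \<in> A" "q < \<gamma> (n, h)" using first by (auto simp: first_exceedance_def)
  have "(m, h) \<in> A \<and> q < \<gamma> (m, h) \<and> n - h < m \<and> m < n + h"
  proof (cases "h = 1")
    case True
    then show ?thesis using max n by (auto simp: local_maximizer_def)
  next
    case False
    then have m: "(m, h) \<in> A" "n - h + 1 < m" "m < n + h"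
      and "\<And>n'. n - h + 1 < n' \<Longrightarrow> n' < n + h \<Longrightarrow> (n', h) \<in> A \<Longrightarrow> \<gamma> (n', h) \<le> \<gamma> (m, h)"
      using max by (auto simp: local_maximizer_def)
    then have "\<gamma> (n, h) \<le> \<gamma> (m, h)" using n False h by simp
    then show ?thesis using n m by simp
  qed
  moreover have "n \<le> m" if "(m, h) \<in> A" "q < \<gamma> (m, h)"
    using first that by (auto simp: first_exceedance_def)
  ultimately show "(m, h) \<in> A" "q < \<gamma> (m, h)" "n - h < m" "n \<le> m" "m < n + h" by auto
qed

lemma multiscan_output:
  assumes "multiscan \<gamma> q C A R" "\<And>n h. (n, h) \<in> A \<Longrightarrow> 1 \<le> h" "p \<in> R" "p \<notin> C"
  shows "p \<in> A \<and> q < \<gamma> p"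
  using assms
proof (induction arbitrary: p)
  case (step A n h m C R)
  have "1 \<le> h" using step.hyps(1) step.prems(1) unfolding first_exceedance_def by blast
  note m = first_exceedance_local_maximizer[OF step(1,2) this]
  show ?case
  proof (cases "p = (m, h)")
    case False
    have "p \<in> prune A (m, h) \<and> q < \<gamma> p"
      using step.prems False by (intro step.IH) (auto simp: prune_def)
    then show ?thesis by (simp add: prune_def)
  qed (use m in simp)
qed blast

text \<open>The last assumption is the invariant of the recursion: remaining pairs never meet
  selected ones, and pruning restores this after each selection.\<close>

lemma multiscan_disjoint:
  assumes "multiscan \<gamma> q C A R" "\<And>n h. (n, h) \<in> A \<Longrightarrow> 1 \<le> h"
    "disjoint_family_on pair_interval C" "\<And>p p'. p \<in> C \<Longrightarrow> p' \<in> A \<Longrightarrow> pair_interval p \<inter> pair_interval p' = {}"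
  shows "disjoint_family_on pair_interval R"
  using assms
proof induction
  case (step A n h m C R)
  have "1 \<le> h" using step.hyps(1) step.prems(1) unfolding first_exceedance_def by blast
  note m = first_exceedance_local_maximizer[OF step(1,2) this]
  show ?case
  proof (rule step.IH)
    show "1 \<le> h'" if "(n', h') \<in> prune A (m, h)" for n' h'
      using step.prems(1) that by (auto simp: prune_def)
    show "disjoint_family_on pair_interval (C \<union> {(m, h)})"
    proof (unfold disjoint_family_on_def, intro ballI impI)
      fix p p' assume "p \<in> C \<union> {(m, h)}" "p' \<in> C \<union> {(m, h)}" "p \<noteq> p'"
      then consider "p \<in> C" "p' \<in> C" | "p \<in> C" "p' = (m, h)" | "p = (m, h)" "p' \<in> C" by blast
      then show "pair_interval p \<inter> pair_interval p' = {}"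
      proof cases
        case 1
        then show ?thesis using step.prems(2) \<open>p \<noteq> p'\<close> unfolding disjoint_family_on_def by blast
      next
        case 2
        then show ?thesis using step.prems(3) m(1) by blast
      next
        case 3
        then show ?thesis using step.prems(3) m(1) by blast
      qed
    qed
    show "pair_interval p \<inter> pair_interval p' = {}"
      if "p \<in> C \<union> {(m, h)}" "p' \<in> prune A (m, h)" for p p'
      using that step.prems(3) unfolding prune_def by blast
  qed
qed simp

text \<open>Since pairs are scanned in increasing order of \<open>h\<close>, an exceedance can only be suppressed
  by an output pair that is at most as long and meets it.\<close>

lemma multiscan_detects:
  assumes "multiscan \<gamma> q C A R" "\<And>n h. (n, h) \<in> A \<Longrightarrow> 1 \<le> h" "(n, h) \<in> A" "q < \<gamma> (n, h)"
  shows "\<exists>m h'. (m, h') \<in> R \<and> h' \<le> h \<and> pair_interval (m, h') \<inter> pair_interval (n, h) \<noteq> {}"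
  using assms
proof induction
  case (step A n0 h0 m C R)
  have h0: "1 \<le> h0" using step.hyps(1) step.prems(1) unfolding first_exceedance_def by blast
  note m = first_exceedance_local_maximizer[OF step(1,2) h0]
  have R: "(m, h0) \<in> R" using multiscan_subset[OF step(3)] by auto
  have order: "h0 < h \<or> h0 = h \<and> n0 \<le> n"
    using step.hyps(1) step.prems by (auto simp: first_exceedance_def)
  show ?case
  proof (cases "(n, h) \<in> prune A (m, h0)")
    case True
    then show ?thesis using step.IH step.prems unfolding prune_def by blast
  next
    case False
    have "pair_interval (m, h0) \<inter> pair_interval (n, h) \<noteq> {}"
    proof
      assume disj: "pair_interval (m, h0) \<inter> pair_interval (n, h) = {}"
      then have "\<not> precedes (m, h0) (n, h)" using False step.prems by (auto simp: prune_def)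
      \<comment> \<open>A pair dropped for its order alone has the same length and
        \<open>n0 \<le> n \<le> m < n0 + h0\<close>, so its position \<open>n\<close> lies in the
        selected interval after all.\<close>
      then have "h0 = h" "n0 \<le> n" "n \<le> m" using order by auto
      then have "n \<in> pair_interval (m, h0) \<inter> pair_interval (n, h)" using m h0 by auto
      then show False using disj by blast
    qed
    then show ?thesis using R order by (intro exI[of _ m] exI[of _ h0]) auto
  qed
qed blast

section \<open>Change points and the means seen by a scan window\<close>

lemma change_points_mono:
  assumes "change_points N K c \<mu>" "i \<le> j" "j \<le> K + 1" shows "c i \<le> c j"
  using assms(2,3)
proof (induction j rule: dec_induct)
  case (step j)
  have "c j < c (j + 1)" using assms(1) step by (auto simp: change_points_def)
  then show ?case using step by simp
qed simp

lemma change_points_separated: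
  assumes c: "change_points N K c \<mu>" and k: "k \<in> {1..K}" and l: "l \<in> {1..K}" "l \<noteq> k"
  shows "min_spacing c k \<le> \<bar>c l - c k\<bar>"
proof (cases "l < k")
  case True
  then have "c l \<le> c (k - 1)" "c l \<le> c k" using k l by (auto intro!: change_points_mono[OF c])
  then show ?thesis by (auto simp: min_spacing_def)
next
  case False
  then have "c (k + 1) \<le> c l" "c k \<le> c l" using k l by (auto intro!: change_points_mono[OF c])
  then show ?thesis by (auto simp: min_spacing_def)
qed

lemma observation_segment:
  assumes c: "change_points N K c \<mu>" and k: "k \<in> {1..K + 1}" and n: "c (k - 1) < n" "n \<le> c k"
  shows "observation K c \<mu> \<epsilon> n \<omega> = \<epsilon> n \<omega> + \<mu> k"
proof -
  have "(\<Sum>l\<in>{1..K + 1}. if c (l - 1) < n \<and> n \<le> c l then \<mu> l else 0) =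
    (\<Sum>l\<in>{1..K + 1}. if l = k then \<mu> l else 0)"
  proof (rule sum.cong)
    fix l assume l: "l \<in> {1..K + 1}"
    have uniq: "l = k" if ln: "c (l - 1) < n" "n \<le> c l"
    proof (rule ccontr)
      assume "l \<noteq> k"
      then consider "l \<le> k - 1" | "k \<le> l - 1" by linarith
      then show False
      proof cases
        case 1
        moreover have "k - 1 \<le> K + 1" using k by auto
        ultimately show ?thesis using change_points_mono[OF c, of l "k - 1"] n ln by linarith
      next
        case 2
        moreover have "l - 1 \<le> K + 1" using l by auto
        ultimately show ?thesis using change_points_mono[OF c, of k "l - 1"] n ln by linarith
      qed
    qed
    show "(if c (l - 1) < n \<and> n \<le> c l then \<mu> l else 0) = (if l = k then \<mu> l else 0)"
    proof (cases "l = k")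
      case False
      then have "\<not> (c (l - 1) < n \<and> n \<le> c l)" using uniq by blast
      then show ?thesis using False by (simp only: if_False)
    qed (use n in simp)
  qed simp
  then show ?thesis using k by (simp add: observation_def)
qed

lemma segment_exists:
  assumes c: "change_points N K c \<mu>" and n: "1 \<le> n" "n \<le> int N"
  obtains k where "k \<in> {1..K + 1}" "c (k - 1) < n" "n \<le> c k"
proof -
  define k where "k = (LEAST k. n \<le> c k)"
  have ends: "c 0 = 0" "c (K + 1) = int N" using c unfolding change_points_def by blast+
  have ex: "n \<le> c (K + 1)" using ends n by simp
  have nk: "n \<le> c k" unfolding k_def using ex by (rule LeastI)
  have kK: "k \<le> K + 1" unfolding k_def using ex by (rule Least_le)
  have k0: "k \<noteq> 0" 
  proof
    assume "k = 0"
    then show False using nk n ends by simp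
  qed
  have "\<not> n \<le> c (k - 1)" using not_less_Least[of "k - 1" "\<lambda>k. n \<le> c k"] k0 by (simp add: k_def)
  then show ?thesis using that[of k] k0 kK nk by auto
qed

text \<open>Both windows have \<open>h\<close> terms, so a common mean cancels. The segment
  containing the left end reaches at least to \<open>n + h\<close>, because its right end is either
  \<open>N\<close> or a change point outside the interval.\<close>

lemma scan_statistic_no_change_point:
  assumes c: "change_points N K c \<mu>" and p: "(n, h) \<in> all_pairs N"
    and no: "\<And>k. k \<in> {1..K} \<Longrightarrow> c k \<notin> pair_interval (n, h)"
  shows "scan_statistic w N (\<lambda>n. observation K c \<mu> \<epsilon> n \<omega>) (n, h) =
    scan_statistic w N (\<lambda>n. \<epsilon> n \<omega>) (n, h)"
proof -
  have h: "1 \<le> h" "1 \<le> n - h + 1" "n + h \<le> int N" using p by (auto simp: all_pairs_def)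
  obtain k where k: "k \<in> {1..K + 1}" "c (k - 1) < n - h + 1" "n - h + 1 \<le> c k"
    using segment_exists[OF c, of "n - h + 1"] h by auto
  have "n + h \<le> c k"
  proof (cases "k = K + 1")
    case True
    moreover have "c (K + 1) = int N" using c unfolding change_points_def by blast
    ultimately show ?thesis using h by simp
  next
    case False
    then have "c k \<notin> pair_interval (n, h)" using k by (intro no) auto
    then show ?thesis using k by auto
  qed
  then have obs: "observation K c \<mu> \<epsilon> i \<omega> = \<epsilon> i \<omega> + \<mu> k" if "n - h + 1 \<le> i" "i \<le> n + h" for i
    using that k by (intro observation_segment[OF c]) auto
  have "(\<Sum>l\<in>{n - h + 1..n}. observation K c \<mu> \<epsilon> l \<omega>) = (\<Sum>l\<in>{n - h + 1..n}. \<epsilon> l \<omega>) + h *\<^sub>R \<mu> k"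
  proof -
    have "(\<Sum>l\<in>{n - h + 1..n}. observation K c \<mu> \<epsilon> l \<omega>) = (\<Sum>l\<in>{n - h + 1..n}. \<epsilon> l \<omega> + \<mu> k)"
      using obs h by (intro sum.cong) auto
    then show ?thesis using h by (simp add: sum.distrib sum_constant_scaleR del: sum_constant)
  qed
  moreover have "(\<Sum>l\<in>{n + 1..n + h}. observation K c \<mu> \<epsilon> l \<omega>) = (\<Sum>l\<in>{n + 1..n + h}. \<epsilon> l \<omega>) + h *\<^sub>R \<mu> k"
  proof -
    have "(\<Sum>l\<in>{n + 1..n + h}. observation K c \<mu> \<epsilon> l \<omega>) = (\<Sum>l\<in>{n + 1..n + h}. \<epsilon> l \<omega> + \<mu> k)"
      using obs h by (intro sum.cong) auto
    then show ?thesis using h by (simp add: sum.distrib sum_constant_scaleR del: sum_constant)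
  qed
  ultimately show ?thesis
    unfolding scan_statistic_def split_conv by (simp only: add_diff_cancel_right)
qed

text \<open>With \<open>h\<close> at most the spacing, the left window lies in segment
  \<open>k\<close> and the right one in segment \<open>k + 1\<close>; the reverse triangle
  inequality separates jump and noise.\<close>

lemma scan_statistic_change_point:
  assumes c: "change_points N K c \<mu>" and k: "k \<in> {1..K}"
    and h: "1 \<le> h" "h \<le> min_spacing c k"
  shows "scan_statistic w N (\<lambda>n. observation K c \<mu> \<epsilon> n \<omega>) (c k, h) \<ge>
    h * jump_size \<mu> k / (sqrt N * rho w (h / N)) - scan_statistic w N (\<lambda>n. \<epsilon> n \<omega>) (c k, h)"
proof -
  have hk: "c (k - 1) \<le> c k - h" "c k + h \<le> c (k + 1)" using h unfolding min_spacing_def by linarith+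
  let ?L = "{c k - h + 1..c k}" and ?R = "{c k + 1..c k + h}"
  have L: "(\<Sum>l\<in>?L. observation K c \<mu> \<epsilon> l \<omega>) = (\<Sum>l\<in>?L. \<epsilon> l \<omega>) + (\<Sum>l\<in>?L. \<mu> k)"
    unfolding sum.distrib[symmetric] using h hk k
    by (intro sum.cong observation_segment[OF c]) auto
  have R: "(\<Sum>l\<in>?R. observation K c \<mu> \<epsilon> l \<omega>) = (\<Sum>l\<in>?R. \<epsilon> l \<omega>) + (\<Sum>l\<in>?R. \<mu> (k + 1))"
    unfolding sum.distrib[symmetric] using h hk k
    by (intro sum.cong observation_segment[OF c]) auto
  define u where "u = (\<Sum>l\<in>?L. \<epsilon> l \<omega>) - (\<Sum>l\<in>?R. \<epsilon> l \<omega>)"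
  define v where "v = real_of_int h *\<^sub>R (\<mu> (k + 1) - \<mu> k)"
  have "(\<Sum>l\<in>?L. observation K c \<mu> \<epsilon> l \<omega>) - (\<Sum>l\<in>?R. observation K c \<mu> \<epsilon> l \<omega>) = u - v"
    unfolding L R u_def v_def using h by (simp add: algebra_simps sum_constant_scaleR del: sum_constant)
  moreover have "norm v = h * jump_size \<mu> k" using h by (simp add: v_def jump_size_def)
  moreover have "norm v - norm u \<le> norm (u - v)"
    using norm_triangle_ineq2[of v u] by (simp add: norm_minus_commute)
  moreover have "0 \<le> sqrt N * rho w (h / N)" using h by (simp add: rho_nonneg)
  ultimately show ?thesis
    unfolding scan_statistic_def by (simp add: u_def diff_divide_distrib[symmetric] divide_right_mono)
qed

section \<open>Second differences in the Hoelder space\<close>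

text \<open>One functional for three purposes: on a countable dense \<open>D\<close> it is a
  measurable form of the limit statistic, on grid points it dominates the noise, and on points with
  small second coordinate it measures small-scale oscillation. Values in \<open>ennreal\<close>
  avoid any finiteness condition on the partial sum paths.\<close>

definition osc :: "weight \<Rightarrow> (real \<times> real) set \<Rightarrow> (real \<Rightarrow> 'b::real_normed_vector) \<Rightarrow> ennreal" where
  "osc w D f = (SUP p\<in>D. ennreal (norm (second_difference f p) / rho w (snd p)))"

lemma rho_pos:
  assumes "valid_weight w" "0 < y" "y \<le> 1 / 2" shows "0 < rho w y"
proof (cases w)
  case (Log_weight \<beta>)
  have "1 < 1 / y" using assms by (simp add: field_simps)
  then show ?thesis using assms Log_weight by simp
qed (use assms in auto)

lemma rho_pos_triangle: "valid_weight w \<Longrightarrow> p \<in> scan_triangle \<Longrightarrow> 0 < rho w (snd p)"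
  by (rule rho_pos) (auto simp: scan_triangle_def)

lemma half_le_max_lag: "1 / 2 \<le> max_lag w"
  by (cases w) auto

lemma second_difference_eq:
  "second_difference f (x, y) = (f (x + y) - f x) - (f x - f (x - y))"
  by (simp add: second_difference_def scaleR_2)

lemma second_difference_diff:
  "second_difference (\<lambda>x. f x - g x) p = second_difference f p - second_difference g p"
  by (cases p) (simp add: second_difference_eq)

lemma second_difference_quotient_le:
  assumes w: "valid_weight w" and p: "(x, y) \<in> scan_triangle"
  shows "ennreal (norm (second_difference f (x, y)) / rho w y) \<le>
    holder_quotient w f (x, x + y) + holder_quotient w f (x - y, x)"
proof -
  have "norm (second_difference f (x, y)) / rho w y \<le> norm (f (x + y) - f x) / rho w y + norm (f x - f (x - y)) / rho w y"
    unfolding second_difference_eq add_divide_distrib[symmetric]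
    using rho_pos_triangle[OF w p] by (intro divide_right_mono norm_triangle_ineq4) auto
  then show ?thesis
    using rho_pos_triangle[OF w p] by (simp add: holder_quotient_def ennreal_plus[symmetric] ennreal_leI del: ennreal_plus)
qed

text \<open>The factor 2 counts the two increments that make up a second difference.\<close>

lemma osc_le_holder_norm:
  assumes w: "valid_weight w" and D: "D \<subseteq> scan_triangle"
  shows "osc w D f \<le> 2 * holder_norm w f"
  unfolding osc_def
proof (rule SUP_least)
  fix p assume "p \<in> D"
  then obtain x y where p: "p = (x, y)" "(x, y) \<in> scan_triangle" using D by (cases p) auto
  have le: "holder_quotient w f z \<le> holder_norm w f"
    if "z \<in> {(x, y). 0 \<le> x \<and> x < y \<and> y \<le> 1 \<and> y - x \<le> max_lag w}" for z
    unfolding holder_norm_def by (rule add_increasing[OF _ SUP_upper[OF that]]) simp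
  have "holder_quotient w f (x, x + y) + holder_quotient w f (x - y, x) \<le> holder_norm w f + holder_norm w f"
    using p half_le_max_lag[of w] by (intro add_mono le) (auto simp: scan_triangle_def)
  then show "ennreal (norm (second_difference f p) / rho w (snd p)) \<le> 2 * holder_norm w f"
    using second_difference_quotient_le[OF w p(2), of f] by (auto simp: p mult_2 intro: order_trans)
qed

lemma osc_triangle:
  assumes w: "valid_weight w" and D: "D \<subseteq> scan_triangle"
  shows "osc w D f \<le> osc w D g + osc w D (\<lambda>x. f x - g x)"
  unfolding osc_def[of w D f]
proof (rule SUP_least)
  fix p assume p: "p \<in> D"
  have pos: "0 < rho w (snd p)" using p D by (intro rho_pos_triangle[OF w]) blast
  have "norm (second_difference f p) \<le> norm (second_difference g p) + norm (second_difference (\<lambda>x. f x - g x) p)"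
    unfolding second_difference_diff by (metis add.commute diff_add_cancel norm_triangle_ineq)
  then have "norm (second_difference f p) / rho w (snd p) \<le>
    norm (second_difference g p) / rho w (snd p) + norm (second_difference (\<lambda>x. f x - g x) p) / rho w (snd p)"
    unfolding add_divide_distrib[symmetric] using pos by (intro divide_right_mono) auto
  then have "ennreal (norm (second_difference f p) / rho w (snd p)) \<le>
    ennreal (norm (second_difference g p) / rho w (snd p)) + ennreal (norm (second_difference (\<lambda>x. f x - g x) p) / rho w (snd p))"
    using pos by (simp add: ennreal_plus[symmetric] ennreal_leI del: ennreal_plus)
  also have "\<dots> \<le> osc w D g + osc w D (\<lambda>x. f x - g x)"
    unfolding osc_def using p by (intro add_mono SUP_upper)
  finally show "ennreal (norm (second_difference f p) / rho w (snd p)) \<le> osc w D g + osc w D (\<lambda>x. f x - g x)" .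
qed

lemma holder_norm_finite: "f \<in> holder_space w \<Longrightarrow> holder_norm w f < \<infinity>"
  by (simp add: holder_space_def)

lemma holder_norm_diff_finite:
  assumes "f \<in> holder_space w" "g \<in> holder_space w"
  shows "holder_norm w (\<lambda>x. f x - g x) < \<infinity>"
proof -
  have "holder_norm w (\<lambda>x. f x - g x) \<le> holder_norm w f + holder_norm w g"
    using holder_norm_triangle[of w f g "\<lambda>_. 0"] holder_norm_minus_commute[of w "\<lambda>_. 0" g] by simp
  also have "\<dots> < \<infinity>" using assms by (simp add: holder_space_def)
  finally show ?thesis .
qed

lemma osc_finite:
  assumes "valid_weight w" "D \<subseteq> scan_triangle" "f \<in> holder_space w"
  shows "osc w D f < \<infinity>"
  using osc_le_holder_norm[OF assms(1,2), of f] holder_norm_finite[OF assms(3)]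
  by (auto simp: ennreal_mult_less_top intro: le_less_trans)

text \<open>\<open>osc\<close> is subadditive and at most twice the Hoelder norm; finiteness on the
  Hoelder space allows the extended inequality to be read in the reals.\<close>

lemma osc_lipschitz:
  assumes w: "valid_weight w" and D: "D \<subseteq> scan_triangle"
    and f: "f \<in> holder_space w" and g: "g \<in> holder_space w"
  shows "\<bar>enn2real (osc w D f) - enn2real (osc w D g)\<bar> \<le> 2 * holder_dist w f g"
proof -
  have le: "enn2real (osc w D f) \<le> enn2real (osc w D g) + 2 * holder_dist w f g"
    if f: "f \<in> holder_space w" and g: "g \<in> holder_space w" for f g
  proof -
    have fin: "holder_norm w (\<lambda>x. f x - g x) < top" "osc w D g < top"
      using holder_norm_diff_finite[OF f g] osc_finite[OF w D g] by auto
    have "osc w D f \<le> osc w D g + 2 * holder_norm w (\<lambda>x. f x - g x)"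
      using osc_triangle[OF w D, of f g] osc_le_holder_norm[OF w D, of "\<lambda>x. f x - g x"]
      by (meson add_left_mono order_trans)
    then have "enn2real (osc w D f) \<le> enn2real (osc w D g + 2 * holder_norm w (\<lambda>x. f x - g x))"
      using fin by (intro enn2real_mono) (auto simp: ennreal_mult_less_top)
    also have "\<dots> = enn2real (osc w D g) + 2 * holder_dist w f g"
      using fin by (subst enn2real_plus) (auto simp: ennreal_mult_less_top holder_dist_def enn2real_mult)
    finally show ?thesis .
  qed
  have "holder_dist w f g = holder_dist w g f"
    by (simp add: holder_dist_def holder_norm_minus_commute[of w f g])
  then show ?thesis using le[OF f g] le[OF g f] by (simp add: abs_le_iff)
qed

lemma continuous_map_holder_lipschitz:
  assumes "\<And>f g. f \<in> holder_space w \<Longrightarrow> g \<in> holder_space w \<Longrightarrow> \<bar>\<phi> f - \<phi> g\<bar> \<le> L * holder_dist w f g"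
  shows "continuous_map (holder_topology w) euclideanreal \<phi>"
  unfolding continuous_map_def
proof (intro conjI allI impI)
  fix U :: "real set" assume U: "openin euclideanreal U"
  show "openin (holder_topology w) {f \<in> topspace (holder_topology w). \<phi> f \<in> U}"
    unfolding holder_topology_def Metric_space.openin_mtopology[OF Metric_space_holder]
      Metric_space.topspace_mtopology[OF Metric_space_holder]
  proof (intro conjI allI impI)
    fix f assume "f \<in> {f \<in> holder_space w. \<phi> f \<in> U}"
    then have f: "f \<in> holder_space w" "\<phi> f \<in> U" by auto
    obtain e where e: "0 < e" "ball (\<phi> f) e \<subseteq> U" using U f by (auto elim!: openE)
    \<comment> \<open>The denominator \<open>\<bar>L\<bar> + 1\<close> keeps the radius positive for
      every \<open>L\<close>.\<close>
    have "\<phi> g \<in> U" if g: "g \<in> holder_space w" "holder_dist w f g < e / (\<bar>L\<bar> + 1)" for g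
    proof -
      have nn: "0 \<le> holder_dist w f g" by (simp add: holder_dist_def)
      have "\<bar>\<phi> f - \<phi> g\<bar> \<le> L * holder_dist w f g" using assms f g by auto
      also have "\<dots> \<le> (\<bar>L\<bar> + 1) * holder_dist w f g" using nn by (intro mult_right_mono) auto
      also have "\<dots> < e" using g(2) by (simp add: field_simps)
      finally show ?thesis using e(2) by (auto simp: dist_real_def)
    qed
    then have "Metric_space.mball (holder_space w) (holder_dist w) f (e / (\<bar>L\<bar> + 1)) \<subseteq> {f \<in> holder_space w. \<phi> f \<in> U}"
      by (auto simp: Metric_space.mball_def[OF Metric_space_holder])
    then show "\<exists>r>0. Metric_space.mball (holder_space w) (holder_dist w) f r \<subseteq> {f \<in> holder_space w. \<phi> f \<in> U}"
      using e(1) by (intro exI[of _ "e / (\<bar>L\<bar> + 1)"]) auto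
  qed auto
qed auto

section \<open>Transfer of oscillation bounds through weak convergence\<close>

text \<open>The value at \<open>\<infinity>\<close> makes a positive ramp an upper bound on \<open>t\<close>, also for paths outside the Hoelder space.\<close>

definition ramp :: "real \<Rightarrow> real \<Rightarrow> ennreal \<Rightarrow> real" where
  "ramp a b t = (if t = \<infinity> then 0 else max 0 (min 1 ((b - enn2real t) / (b - a))))"

lemma ramp_bounds: "0 \<le> ramp a b t" "ramp a b t \<le> 1"
  by (auto simp: ramp_def)

lemma ramp_lower: "a < b \<Longrightarrow> 0 \<le> a \<Longrightarrow> t \<le> ennreal a \<Longrightarrow> ramp a b t = 1"
  using enn2real_mono[of t "ennreal a"] by (auto simp: ramp_def top_unique)

lemma ramp_upper: "a < b \<Longrightarrow> \<not> t \<le> ennreal b \<Longrightarrow> ramp a b t = 0"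
proof (cases t)
  case (real r)
  assume "a < b" "\<not> t \<le> ennreal b"
  then have "\<not> r \<le> b" using real ennreal_leI[of r b] by auto
  then have "(b - r) / (b - a) \<le> 0" using \<open>a < b\<close> by (intro divide_nonpos_pos) auto
  then show ?thesis using real by (simp add: ramp_def)
qed (simp add: ramp_def)

lemma measurable_ramp [measurable]: "ramp a b \<in> borel_measurable borel"
  unfolding ramp_def[abs_def] by measurable

lemma continuous_map_ramp_osc:
  assumes w: "valid_weight w" and D: "D \<subseteq> scan_triangle" and ab: "a < b"
  shows "continuous_map (holder_topology w) euclideanreal (\<lambda>f. ramp a b (osc w D f))"
proof (rule continuous_map_holder_lipschitz)
  fix f g :: "real \<Rightarrow> 'a" assume f: "f \<in> holder_space w" and g: "g \<in> holder_space w"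
  have "osc w D f \<noteq> \<infinity>" "osc w D g \<noteq> \<infinity>" using osc_finite[OF w D] f g by (auto simp: less_le)
  then have "\<bar>ramp a b (osc w D f) - ramp a b (osc w D g)\<bar> \<le>
    \<bar>(b - enn2real (osc w D f)) / (b - a) - (b - enn2real (osc w D g)) / (b - a)\<bar>"
    unfolding ramp_def by (auto simp: abs_if max_def min_def)
  also have "\<dots> = \<bar>enn2real (osc w D f) - enn2real (osc w D g)\<bar> / (b - a)"
    using ab by (simp add: diff_divide_distrib[symmetric])
  also have "\<dots> \<le> 2 * holder_dist w f g / (b - a)"
    using osc_lipschitz[OF w D f g] ab by (intro divide_right_mono) auto
  finally show "\<bar>ramp a b (osc w D f) - ramp a b (osc w D g)\<bar> \<le> 2 / (b - a) * holder_dist w f g" by simp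
qed

text \<open>One half of the portmanteau theorem: the continuous ramp lies between the indicators of
  \<open>osc\<close> at most \<open>a\<close> and \<open>osc\<close> at most \<open>b\<close>. The
  gap between the levels replaces any assumption on atoms of the limit law.\<close>

lemma weak_convergence_osc:
  assumes w: "valid_weight w" and D: "D \<subseteq> scan_triangle"
    and conv: "weakly_converges_to (holder_topology w) M Y M' Z"
    and M: "\<And>N. N \<ge> 1 \<Longrightarrow> prob_space (M N)" and M': "prob_space M'"
    and Y: "\<And>N. N \<ge> 1 \<Longrightarrow> (\<lambda>\<omega>. osc w D (Y N \<omega>)) \<in> borel_measurable (M N)"
    and Z: "(\<lambda>\<omega>. osc w D (Z \<omega>)) \<in> borel_measurable M'"
    and ab: "0 \<le> a" "a < b" and \<eta>: "0 < \<eta>"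
  shows "\<forall>\<^sub>F N in sequentially. measure M' {\<omega> \<in> space M'. osc w D (Z \<omega>) \<le> ennreal a} - \<eta> \<le>
    measure (M N) {\<omega> \<in> space (M N). osc w D (Y N \<omega>) \<le> ennreal b}"
proof -
  interpret M': prob_space M' by (rule M')
  note Z[measurable]
  let ?A = "{\<omega> \<in> space M'. osc w D (Z \<omega>) \<le> ennreal a}" and ?B = "\<lambda>N. {\<omega> \<in> space (M N). osc w D (Y N \<omega>) \<le> ennreal b}"
  let ?\<phi> = "\<lambda>f. ramp a b (osc w D f)"
  have "bounded (?\<phi> ` topspace (holder_topology w))"
    by (rule boundedI[where B = 1]) (use ramp_bounds in auto)
  then have lim: "(\<lambda>N. \<integral>\<omega>. ?\<phi> (Y N \<omega>) \<partial>M N) \<longlonglongrightarrow> (\<integral>\<omega>. ?\<phi> (Z \<omega>) \<partial>M')"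
    using conv continuous_map_ramp_osc[OF w D ab(2)] unfolding weakly_converges_to_def by blast
  have "measure M' ?A =
    (\<integral>\<omega>. indicator ?A \<omega> \<partial>M')"
    by (simp add: Int_def conj_commute)
  also have "\<dots> \<le> (\<integral>\<omega>. ?\<phi> (Z \<omega>) \<partial>M')"
  proof (rule integral_mono)
    show "integrable M' (\<lambda>\<omega>. ?\<phi> (Z \<omega>))"
      using ramp_bounds by (intro M'.integrable_const_bound[where B = 1]) auto
    show "integrable M' (indicat_real ?A)"
      by (intro integrable_real_indicator) (auto simp: M'.emeasure_eq_measure)
  qed (use ab ramp_bounds in \<open>auto simp: indicator_def ramp_lower\<close>)
  finally have "measure M' ?A - \<eta> < (\<integral>\<omega>. ?\<phi> (Z \<omega>) \<partial>M')"
    using \<eta> by linarith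
  from order_tendstoD(1)[OF lim this] eventually_ge_at_top[of 1] show ?thesis
  proof eventually_elim
    case (elim N)
    interpret MN: prob_space "M N" by (rule M[OF elim(2)])
    note Y[OF elim(2), measurable]
    have "(\<integral>\<omega>. ?\<phi> (Y N \<omega>) \<partial>M N) \<le> (\<integral>\<omega>. indicator (?B N) \<omega> \<partial>M N)"
    proof (rule integral_mono)
      show "integrable (M N) (\<lambda>\<omega>. ?\<phi> (Y N \<omega>))"
        using ramp_bounds by (intro MN.integrable_const_bound[where B = 1]) auto
      show "integrable (M N) (indicat_real (?B N))"
        by (intro integrable_real_indicator) (auto simp: MN.emeasure_eq_measure)
    qed (use ab ramp_bounds in \<open>auto simp: indicator_def ramp_upper\<close>)
    also have "\<dots> = measure (M N) (?B N)" by (simp add: Int_def conj_commute)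
    finally show ?case using elim(1) by linarith
  qed
qed

section \<open>Small-scale regularity and separability of Hoelder paths\<close>

lemma holder_space_little_o:
  assumes w: "valid_weight w" and f: "f \<in> holder_space w" and e: "0 < e"
  obtains \<delta> where "0 < \<delta>"
    "\<And>p. p \<in> scan_triangle \<Longrightarrow> snd p < \<delta> \<Longrightarrow> norm (second_difference f p) / rho w (snd p) \<le> e"
proof -
  let ?H = "\<lambda>\<delta>. SUP p\<in>{(x, y). 0 \<le> x \<and> x < y \<and> y \<le> x + \<delta> \<and> x + \<delta> \<le> 1}. holder_quotient w f p"
  have "(?H \<longlongrightarrow> 0) (at_right 0)" using f by (simp add: holder_space_def)
  then have "\<forall>\<^sub>F \<delta> in at_right 0. ?H \<delta> < ennreal (e / 2)"
    using e by (intro order_tendstoD) (auto simp: ennreal_less_zero_iff)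
  then obtain \<delta> where \<delta>: "0 < \<delta>" "\<And>y. 0 < y \<Longrightarrow> y < \<delta> \<Longrightarrow> ?H y < ennreal (e / 2)"
    unfolding eventually_at_right_field by auto
  show ?thesis
  proof (rule that[OF \<delta>(1)])
    fix p assume p: "p \<in> scan_triangle" "snd p < \<delta>"
    obtain x y where xy: "p = (x, y)" by force
    have y: "0 < y" "y < \<delta>" "y \<le> x" "x + y \<le> 1" using p xy by (auto simp: scan_triangle_def)
    \<comment> \<open>The supremum is taken at the parameter \<open>y\<close> itself. Both
      increments have lag exactly \<open>y\<close> and start at a point \<open>u\<close> with
      \<open>u + y \<le> 1\<close>, as the definition of \<open>holder_space\<close> demands; for a
      larger parameter this could fail near 1.\<close>
    have le: "holder_quotient w f z \<le> ennreal (e / 2)"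
      if "z \<in> {(u, v). 0 \<le> u \<and> u < v \<and> v \<le> u + y \<and> u + y \<le> 1}" for z
      using SUP_upper[OF that, of "holder_quotient w f"] \<delta>(2)[OF y(1,2)] by (meson less_imp_le order_trans)
    have "ennreal (norm (second_difference f (x, y)) / rho w y) \<le> ennreal (e / 2) + ennreal (e / 2)"
      using y p xy by (intro order_trans[OF second_difference_quotient_le[OF w]] add_mono le) auto
    also have "\<dots> = ennreal e" using e by (simp add: ennreal_plus[symmetric] del: ennreal_plus)
    finally show "norm (second_difference f p) / rho w (snd p) \<le> e" using e by (simp add: xy)
  qed
qed

lemma continuous_on_rho: "valid_weight w \<Longrightarrow> continuous_on scan_triangle (\<lambda>p. rho w (snd p))"
proof (cases w)
  case (Log_weight \<beta>)
  have "1 / snd p > 1" "snd p > 0" if "p \<in> scan_triangle" for p :: "real \<times> real"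
    using that by (auto simp: scan_triangle_def field_simps)
  then have "snd p > 0" "ln (1 / snd p) \<noteq> 0" if "p \<in> scan_triangle" for p :: "real \<times> real"
    using that ln_gt_zero[of "1 / snd p"] by (metis, metis less_irrefl)
  then show ?thesis unfolding Log_weight rho.simps
    by (intro continuous_intros) force+
next
  case (Poly_weight \<beta>)
  have "snd p > 0" if "p \<in> scan_triangle" for p :: "real \<times> real"
    using that by (auto simp: scan_triangle_def)
  then show ?thesis unfolding Poly_weight rho.simps by (intro continuous_intros) force+
qed

lemma continuous_on_second_difference:
  assumes "continuous_on {0..1} f" shows "continuous_on scan_triangle (second_difference f)"
proof -
  have "continuous_on scan_triangle (\<lambda>p. f (fst p + snd p) - 2 *\<^sub>R f (fst p) + f (fst p - snd p))"
    by (intro continuous_intros continuous_on_compose2[OF assms]) (auto simp: scan_triangle_def)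
  then show ?thesis by (simp add: second_difference_def case_prod_unfold)
qed

text \<open>The real supremum needs a bounded family, and boundedness comes from the finiteness of
  \<open>osc\<close> on the Hoelder space. Continuity of the quotient carries a bound from
  \<open>D\<close> to its closure.\<close>

lemma limit_statistic_le_iff:
  assumes w: "valid_weight w" and f: "f \<in> holder_space w"
    and D: "D \<subseteq> scan_triangle" "scan_triangle \<subseteq> closure D" and t: "0 \<le> t"
  shows "limit_statistic w f \<le> t \<longleftrightarrow> osc w D f \<le> ennreal t"
proof -
  let ?q = "\<lambda>p. norm (second_difference f p) / rho w (snd p)"
  have L: "limit_statistic w f = (SUP p\<in>scan_triangle. ?q p)"
    unfolding limit_statistic_def by (intro SUP_cong) auto
  have q_le: "?q p \<le> enn2real (osc w scan_triangle f)" if "p \<in> scan_triangle" for p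
  proof -
    have "ennreal (?q p) \<le> osc w scan_triangle f" unfolding osc_def using that by (rule SUP_upper)
    also have "\<dots> = ennreal (enn2real (osc w scan_triangle f))" using osc_finite[OF w order_refl f] by simp
    finally show ?thesis by simp
  qed
  then have bdd: "bdd_above (?q ` scan_triangle)" by (intro bdd_aboveI2)
  show ?thesis
  proof
    assume "limit_statistic w f \<le> t"
    then have "?q p \<le> t" if "p \<in> D" for p
      using cSUP_upper[OF _ bdd, of p] that D(1) unfolding L by force
    then show "osc w D f \<le> ennreal t" unfolding osc_def by (intro SUP_least ennreal_leI)
  next
    assume le: "osc w D f \<le> ennreal t"
    have D_le: "?q p \<le> t" if "p \<in> D" for p
    proof -
      have "ennreal (?q p) \<le> ennreal t" using le SUP_upper[OF that, of "\<lambda>p. ennreal (?q p)"] unfolding osc_def by simp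
      then show ?thesis using t by simp
    qed
    have cont: "continuous_on scan_triangle ?q"
      using f rho_pos_triangle[OF w]
      by (intro continuous_intros continuous_on_second_difference continuous_on_rho w) (auto simp: holder_space_def less_le)
    have "?q p \<le> t" if p: "p \<in> scan_triangle" for p
    proof -
      obtain s where s: "\<And>n. s n \<in> D" "s \<longlonglongrightarrow> p" using D(2) p closure_sequential[of p D] by blast
      have "(\<lambda>n. ?q (s n)) \<longlonglongrightarrow> ?q p"
        using cont p s D(1) unfolding continuous_on_sequentially comp_def by blast
      then show ?thesis using D_le[OF s(1)] by (intro LIMSEQ_le_const2) auto
    qed
    moreover have "(1 / 2, 1 / 2) \<in> scan_triangle" by (simp add: scan_triangle_def)
    ultimately show "limit_statistic w f \<le> t" unfolding L by (intro cSUP_least) auto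
  qed
qed

text \<open>Each path receives a code: a scale below which it is small, a mesh on which it varies
  little, and approximate values from a countable dense set on a finite net. There are countably
  many codes, and paths with a common code are close, so one path per realised code is
  enough.\<close>

lemma countable_net_paths:
  fixes f :: "'c \<Rightarrow> real \<Rightarrow> 'b::{real_normed_vector, second_countable_topology}"
  assumes w: "valid_weight w" and f: "\<And>\<omega>. \<omega> \<in> \<Omega> \<Longrightarrow> f \<omega> \<in> holder_space w" and e: "0 < e"
  shows "\<exists>D\<subseteq>\<Omega>. countable D \<and> (\<forall>\<omega>\<in>\<Omega>. \<exists>\<omega>'\<in>D. \<forall>p\<in>scan_triangle.
    norm (second_difference (f \<omega>) p - second_difference (f \<omega>') p) / rho w (snd p) \<le> 4 * e)"
proof -
  define g where "g \<omega> p = (1 / rho w (snd p)) *\<^sub>R second_difference (f \<omega>) p" for \<omega> p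
  \<comment> \<open>Away from scale 0 the triangle is compact, so normalised second differences are
    uniformly continuous there.\<close>
  define K where "K n = {p \<in> scan_triangle. 1 / real (Suc n) \<le> snd p}" for n
  have K_eq: "K n = {0..1} \<times> {1 / real (Suc n)..1} \<inter> {p. snd p \<le> fst p} \<inter> {p. snd p \<le> 1 - fst p}" for n
  proof -
    define c where "c = 1 / real (Suc n)"
    have "0 < c" by (simp add: c_def)
    then show ?thesis unfolding K_def scan_triangle_def c_def[symmetric] by auto
  qed
  have "compact (K n)" for n
    unfolding K_eq by (intro compact_Int_closed closed_Collect_le continuous_intros compact_Times) auto
  then have "\<exists>k. finite k \<and> k \<subseteq> K n \<and> K n \<subseteq> (\<Union>x\<in>k. ball x (1 / real (Suc m)))" for n m
  proof (rule compactE_image)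
    show "K n \<subseteq> (\<Union>x\<in>K n. ball x (1 / real (Suc m)))" for n m
    proof
      fix x assume "x \<in> K n"
      then show "x \<in> (\<Union>x\<in>K n. ball x (1 / real (Suc m)))" by (intro UN_I[of x]) auto
    qed
  qed auto
  then obtain net where net: "\<And>n m. finite (net n m)" "\<And>n m. net n m \<subseteq> K n"
    "\<And>n m. K n \<subseteq> (\<Union>x\<in>net n m. ball x (1 / real (Suc m)))"
    by metis
  obtain V :: "'b set" where V: "countable V" "\<And>U. open U \<Longrightarrow> U \<noteq> {} \<Longrightarrow> \<exists>d\<in>V. d \<in> U"
    using countable_dense_exists by blast
  define codes where "codes = (SIGMA n:UNIV. SIGMA m:UNIV. net n m \<rightarrow>\<^sub>E V)"
  have "countable codes" unfolding codes_def using net V(1) by (intro countable_SIGMA countable_PiE) auto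
  define P where "P = (\<lambda>(n, m, c) \<omega>. (\<forall>p\<in>scan_triangle. snd p < 1 / real (Suc n) \<longrightarrow> norm (g \<omega> p) \<le> e) \<and>
    (\<forall>p\<in>K n. \<forall>z\<in>K n. dist p z < 1 / real (Suc m) \<longrightarrow> dist (g \<omega> p) (g \<omega> z) \<le> e) \<and>
    (\<forall>z\<in>net n m. dist (g \<omega> z) (c z) \<le> e))"
  have norm_g: "norm (g \<omega> p) = norm (second_difference (f \<omega>) p) / rho w (snd p)" if "p \<in> scan_triangle" for \<omega> p
    using rho_pos_triangle[OF w that] by (simp add: g_def)
  have coded: "\<exists>k\<in>codes. P k \<omega>" if \<omega>: "\<omega> \<in> \<Omega>" for \<omega>
  proof -
    obtain \<delta> where \<delta>: "0 < \<delta>" "\<And>p. p \<in> scan_triangle \<Longrightarrow> snd p < \<delta> \<Longrightarrow> norm (second_difference (f \<omega>) p) / rho w (snd p) \<le> e"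
      using holder_space_little_o[OF w f[OF \<omega>] e] by blast
    obtain n where n: "1 / real (Suc n) < \<delta>" using nat_approx_posE[OF \<delta>(1)] by blast
    have "continuous_on (K n) (g \<omega>)"
    proof -
      have "continuous_on scan_triangle (g \<omega>)" unfolding g_def
        using f[OF \<omega>] rho_pos_triangle[OF w]
        by (intro continuous_intros continuous_on_second_difference continuous_on_rho w) (auto simp: holder_space_def less_le)
      then show ?thesis by (rule continuous_on_subset) (auto simp: K_def)
    qed
    then have "uniformly_continuous_on (K n) (g \<omega>)"
      using \<open>compact (K n)\<close> by (intro compact_uniformly_continuous)
    then obtain d where d: "0 < d" "\<And>p z. p \<in> K n \<Longrightarrow> z \<in> K n \<Longrightarrow> dist z p < d \<Longrightarrow> dist (g \<omega> z) (g \<omega> p) < e"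
      using e unfolding uniformly_continuous_on_def by blast
    obtain m where m: "1 / real (Suc m) < d" using nat_approx_posE[OF d(1)] by blast
    have "\<exists>v\<in>V. dist (g \<omega> z) v \<le> e" for z
      using V(2)[of "ball (g \<omega> z) e"] e by (auto intro: less_imp_le)
    then obtain v where v: "\<And>z. v z \<in> V" "\<And>z. dist (g \<omega> z) (v z) \<le> e" by metis
    have "(n, m, restrict v (net n m)) \<in> codes" using v(1) by (auto simp: codes_def)
    moreover have "P (n, m, restrict v (net n m)) \<omega>"
      unfolding P_def prod.case
    proof (intro conjI ballI impI)
      fix p assume "p \<in> scan_triangle" "snd p < 1 / real (Suc n)"
      then show "norm (g \<omega> p) \<le> e" using \<delta>(2)[of p] n norm_g by simp
    next
      fix p z assume "p \<in> K n" "z \<in> K n" "dist p z < 1 / real (Suc m)"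
      then show "dist (g \<omega> p) (g \<omega> z) \<le> e" using d(2)[of z p] m by (simp add: less_imp_le)
    qed (use v in simp)
    ultimately show ?thesis by blast
  qed
  \<comment> \<open>The 4 counts, for each of the two paths, one passage from \<open>p\<close> to
    the net point \<open>z\<close> and one from its value there to the common code.\<close>
  have same: "norm (g \<omega> p - g \<omega>' p) \<le> 4 * e" if k: "P k \<omega>" "P k \<omega>'" and p: "p \<in> scan_triangle" for k \<omega> \<omega>' p
  proof -
    obtain n m c where k_eq: "k = (n, m, c)" by (cases k)
    show ?thesis
    proof (cases "snd p < 1 / real (Suc n)")
      case True
      then have "norm (g \<omega> p) \<le> e" "norm (g \<omega>' p) \<le> e" using k p unfolding P_def k_eq prod.case by blast+
      then show ?thesis using norm_triangle_ineq4[of "g \<omega> p" "g \<omega>' p"] e by linarith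
    next
      case False
      then have pK: "p \<in> K n" using p by (simp add: K_def)
      then obtain z where z: "z \<in> net n m" "dist z p < 1 / real (Suc m)" using net(3)[of n m] by auto
      then have zK: "z \<in> K n" using net(2)[of n m] by auto
      have "dist (g \<omega> p) (g \<omega> z) \<le> e" "dist (g \<omega>' p) (g \<omega>' z) \<le> e" "dist (g \<omega> z) (c z) \<le> e" "dist (g \<omega>' z) (c z) \<le> e"
        using k pK zK z unfolding P_def k_eq prod.case by (auto simp: dist_commute)
      then have "dist (g \<omega> p) (g \<omega>' p) \<le> 4 * e"
        using dist_triangle[of "g \<omega> p" "g \<omega>' p" "c z"] dist_triangle[of "g \<omega> p" "c z" "g \<omega> z"]
          dist_triangle[of "g \<omega>' p" "c z" "g \<omega>' z"] by (simp add: dist_commute)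
      then show ?thesis by (simp add: dist_norm)
    qed
  qed
  \<comment> \<open>Representatives are chosen among paths realising the code, so the net stays
    inside \<open>\<Omega>\<close>.\<close>
  define rep where "rep k = (SOME \<omega>. \<omega> \<in> \<Omega> \<and> P k \<omega>)" for k
  have rep: "rep k \<in> \<Omega> \<and> P k (rep k)" if "\<exists>\<omega>. \<omega> \<in> \<Omega> \<and> P k \<omega>" for k
    unfolding rep_def using that by (rule someI_ex)
  define D where "D = rep ` {k \<in> codes. \<exists>\<omega>. \<omega> \<in> \<Omega> \<and> P k \<omega>}"
  show ?thesis
  proof (intro exI[of _ D] conjI ballI)
    show "D \<subseteq> \<Omega>" using rep by (auto simp: D_def)
    show "countable D" unfolding D_def
      by (rule countable_image, rule countable_subset[OF _ \<open>countable codes\<close>]) blast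
    fix \<omega> assume \<omega>: "\<omega> \<in> \<Omega>"
    then obtain k where k: "k \<in> codes" "P k \<omega>" using coded by blast
    then have "rep k \<in> D" "P k (rep k)" using \<omega> rep[of k] unfolding D_def by blast+
    moreover have "norm (second_difference (f \<omega>) p - second_difference (f \<omega>') p) / rho w (snd p) = norm (g \<omega> p - g \<omega>' p)"
      if "p \<in> scan_triangle" for p \<omega>'
      using rho_pos_triangle[OF w that] by (simp add: g_def scaleR_diff_right[symmetric])
    ultimately show "\<exists>\<omega>'\<in>D. \<forall>p\<in>scan_triangle.
      norm (second_difference (f \<omega>) p - second_difference (f \<omega>') p) / rho w (snd p) \<le> 4 * e"
      using same[OF k(2)] by (intro bexI[of _ "rep k"]) auto
  qed
qed

lemma scan_grid_in_triangle:
  assumes "(n, h) \<in> all_pairs N" shows "(real_of_int n / real N, real_of_int h / real N) \<in> scan_triangle"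
proof -
  have nh: "1 \<le> h" "h \<le> n" "n + h \<le> int N" using assms by (auto simp: all_pairs_def)
  then have N: "0 < real N" by linarith
  have "real_of_int h \<le> real_of_int n" "real_of_int n + real_of_int h \<le> real N" "1 \<le> real_of_int h" using nh by linarith+
  then show ?thesis using N by (auto simp: scan_triangle_def field_simps)
qed

text \<open>Grid points of all sample sizes are adjoined to a dense set, so that one countable
  \<open>D\<close> determines the limit statistic by density and also contains the location of every
  finite-sample statistic.\<close>

lemma countable_scan_net:
  obtains D where "countable D" "D \<subseteq> scan_triangle" "scan_triangle \<subseteq> closure D"
    "\<And>N n h. (n, h) \<in> all_pairs N \<Longrightarrow> (real_of_int n / real N, real_of_int h / real N) \<in> D"
proof -
  obtain T where T: "countable T" "T \<subseteq> scan_triangle" "scan_triangle \<subseteq> closure T"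
    using separable by blast
  define G where "G = (\<lambda>(N, n, h). (real_of_int n / real N, real_of_int h / real N)) ` (SIGMA N:UNIV. all_pairs N)"
  have "countable G" unfolding G_def by (intro countable_image) simp
  moreover have "G \<subseteq> scan_triangle" using scan_grid_in_triangle by (auto simp: G_def)
  moreover have "(real_of_int n / real N, real_of_int h / real N) \<in> G" if "(n, h) \<in> all_pairs N" for N n h
    using that by (force simp: G_def)
  ultimately show ?thesis using T closure_mono[of T "T \<union> G"] by (intro that[of "T \<union> G"]) auto
qed

lemma scan_statistic_eq_second_difference:
  assumes "(n, h) \<in> all_pairs N"
  shows "scan_statistic w N (\<lambda>n. \<epsilon> N n \<omega>) (n, h) =
    norm (second_difference (partial_sum_process \<epsilon> N \<omega>) (real_of_int n / real N, real_of_int h / real N)) /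
      rho w (real_of_int h / real N)"
proof -
  have nh: "1 \<le> h" "h \<le> n" "n + h \<le> int N" using assms by (auto simp: all_pairs_def)
  then have N: "0 < real N" by linarith
  \<comment> \<open>At grid points the fractional part is 0, so the interpolation term
    vanishes.\<close>
  have P: "partial_sum_process \<epsilon> N \<omega> (real_of_int i / real N) = (1 / sqrt N) *\<^sub>R (\<Sum>l\<in>{1..i}. \<epsilon> N l \<omega>)"
    if i: "0 \<le> i" "i \<le> int N" for i
  proof -
    have "real_of_int i \<le> real N" using i by linarith
    then have "real_of_int i / real N \<in> {0..1}" using i N by simp
    then show ?thesis using N by (simp add: partial_sum_process_def)
  qed
  let ?S = "\<lambda>i. \<Sum>l\<in>{1..i}. \<epsilon> N l \<omega>"
  have Pnh: "partial_sum_process \<epsilon> N \<omega> (real_of_int (n + h) / real N) = (1 / sqrt N) *\<^sub>R ?S (n + h)"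
    "partial_sum_process \<epsilon> N \<omega> (real_of_int n / real N) = (1 / sqrt N) *\<^sub>R ?S n"
    "partial_sum_process \<epsilon> N \<omega> (real_of_int (n - h) / real N) = (1 / sqrt N) *\<^sub>R ?S (n - h)"
    using nh by (intro P; simp)+
  have "second_difference (partial_sum_process \<epsilon> N \<omega>) (real_of_int n / real N, real_of_int h / real N) =
    (partial_sum_process \<epsilon> N \<omega> (real_of_int (n + h) / real N) - partial_sum_process \<epsilon> N \<omega> (real_of_int n / real N)) -
    (partial_sum_process \<epsilon> N \<omega> (real_of_int n / real N) - partial_sum_process \<epsilon> N \<omega> (real_of_int (n - h) / real N))"
    unfolding second_difference_eq by (simp add: add_divide_distrib diff_divide_distrib)
  also have "\<dots> = (1 / sqrt N) *\<^sub>R ((?S (n + h) - ?S n) - (?S n - ?S (n - h)))"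
    unfolding Pnh by (simp only: scaleR_diff_right)
  also have "?S (n + h) - ?S n = (\<Sum>l\<in>{n + 1..n + h}. \<epsilon> N l \<omega>)"
  proof -
    have "{1..n + h} = {1..n} \<union> {n + 1..n + h}" using nh by auto
    then show ?thesis by (simp add: sum.union_disjoint)
  qed
  also have "?S n - ?S (n - h) = (\<Sum>l\<in>{n - h + 1..n}. \<epsilon> N l \<omega>)"
  proof -
    have "{1..n} = {1..n - h} \<union> {n - h + 1..n}" using nh by auto
    then show ?thesis by (simp add: sum.union_disjoint)
  qed
  finally show ?thesis using N by (simp add: scan_statistic_def norm_minus_commute)
qed

lemma measurable_partial_sum_process:
  fixes \<epsilon> :: "nat \<Rightarrow> int \<Rightarrow> 'a \<Rightarrow> 'b::{banach, second_countable_topology}"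
  assumes \<epsilon>: "\<And>n. n \<in> {1..int N} \<Longrightarrow> \<epsilon> N n \<in> borel_measurable M" and N: "1 \<le> N" and x: "x \<in> {0..1}"
  shows "(\<lambda>\<omega>. partial_sum_process \<epsilon> N \<omega> x) \<in> borel_measurable M"
proof -
  have "x * real N \<le> 1 * real N" using x by (intro mult_right_mono) auto
  then have le: "\<lfloor>x * real N\<rfloor> \<le> int N" by (simp add: floor_le_iff)
  have 1: "(\<lambda>\<omega>. \<Sum>i\<in>{1..\<lfloor>x * real N\<rfloor>}. \<epsilon> N i \<omega>) \<in> borel_measurable M"
    using le by (intro borel_measurable_sum \<epsilon>) auto
  have 2: "(\<lambda>\<omega>. (real N * x - \<lfloor>real N * x\<rfloor>) *\<^sub>R \<epsilon> N (\<lfloor>real N * x\<rfloor> + 1) \<omega>) \<in> borel_measurable M"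
  proof (cases "\<lfloor>real N * x\<rfloor> + 1 \<le> int N")
    case True
    moreover have "0 \<le> \<lfloor>real N * x\<rfloor>" using x by simp
    ultimately have "\<epsilon> N (\<lfloor>real N * x\<rfloor> + 1) \<in> borel_measurable M" by (intro \<epsilon>) auto
    then show ?thesis by simp
  next
    \<comment> \<open>This is the point \<open>x = 1\<close>: the interpolation refers to the error
      of index \<open>N + 1\<close>, of which nothing is known, but with coefficient 0.\<close>
    case False
    then have "\<lfloor>real N * x\<rfloor> = int N" using le by (simp add: mult.commute)
    moreover have "real N * x \<le> real N" using x by (simp add: mult_left_le)
    ultimately have "real N * x - \<lfloor>real N * x\<rfloor> = 0" by linarith
    then show ?thesis by simp
  qed
  have "(\<lambda>\<omega>. (1 / sqrt (real N)) *\<^sub>R (\<Sum>i\<in>{1..\<lfloor>x * real N\<rfloor>}. \<epsilon> N i \<omega>) +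
     (1 / sqrt (real N)) *\<^sub>R ((real N * x - \<lfloor>real N * x\<rfloor>) *\<^sub>R \<epsilon> N (\<lfloor>real N * x\<rfloor> + 1) \<omega>)) \<in> borel_measurable M"
    by (rule borel_measurable_add[OF borel_measurable_scaleR[OF borel_measurable_const 1]
        borel_measurable_scaleR[OF borel_measurable_const 2]])
  then show ?thesis using x by (simp add: partial_sum_process_def)
qed

lemma measurable_osc:
  fixes Y :: "'a \<Rightarrow> real \<Rightarrow> 'b::{banach, second_countable_topology}"
  assumes D: "countable D" "D \<subseteq> scan_triangle" and Y: "\<And>x. x \<in> {0..1} \<Longrightarrow> (\<lambda>\<omega>. Y \<omega> x) \<in> borel_measurable M"
  shows "(\<lambda>\<omega>. osc w D (Y \<omega>)) \<in> borel_measurable M"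
  unfolding osc_def
proof (rule borel_measurable_SUP[OF D(1)])
  fix p assume "p \<in> D"
  then have p: "fst p \<in> {0..1}" "fst p + snd p \<in> {0..1}" "fst p - snd p \<in> {0..1}"
    using D(2) by (auto simp: scan_triangle_def)
  note [measurable] = Y[OF p(1)] Y[OF p(2)] Y[OF p(3)]
  have "(\<lambda>\<omega>. ennreal (norm (Y \<omega> (fst p + snd p) - 2 *\<^sub>R Y \<omega> (fst p) + Y \<omega> (fst p - snd p)) / rho w (snd p))) \<in> borel_measurable M"
    by measurable
  then show "(\<lambda>\<omega>. ennreal (norm (second_difference (Y \<omega>) p) / rho w (snd p))) \<in> borel_measurable M"
    by (simp add: second_difference_def case_prod_unfold)
qed

section \<open>The limit statistic\<close>

text \<open>The three values entering each second difference are enumerated consecutively.\<close>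

lemma second_differences_normal:
  fixes W :: "'c \<Rightarrow> real \<Rightarrow> 'b::real_normed_vector" and F :: "nat \<Rightarrow> 'b \<Rightarrow>\<^sub>L real"
  assumes W: "centered_gaussian_process M W" and p: "\<And>j. j < n \<Longrightarrow> p j \<in> scan_triangle"
  shows "centered_normal M (\<lambda>\<omega>. \<Sum>j<n. blinfun_apply (F j) (second_difference (W \<omega>) (p j)))"
proof -
  define x where "x i = (let j = i div 3 in if i mod 3 = 0 then fst (p j) + snd (p j)
    else if i mod 3 = 1 then fst (p j) else fst (p j) - snd (p j))" for i
  define f where "f i = (let j = i div 3 in if i mod 3 = 1 then (- 2) *\<^sub>R F j else F j)" for i
  have x_in: "x i \<in> {0..1}" if "i < n * 3" for i
  proof -
    have "p (i div 3) \<in> scan_triangle" using that by (intro p) (simp add: less_mult_imp_div_less)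
    then show ?thesis by (auto simp: x_def Let_def scan_triangle_def)
  qed
  have "(\<Sum>i<n * 3. blinfun_apply (f i) (W \<omega> (x i))) = (\<Sum>j<n. blinfun_apply (F j) (second_difference (W \<omega>) (p j)))" for \<omega>
  proof -
    have "(\<Sum>i<n * 3. blinfun_apply (f i) (W \<omega> (x i))) =
      (\<Sum>j<n. \<Sum>i\<in>{j * 3..<j * 3 + 3}. blinfun_apply (f i) (W \<omega> (x i)))"
      by (rule sum.nat_group[symmetric])
    also have "\<dots> = (\<Sum>j<n. blinfun_apply (F j) (second_difference (W \<omega>) (p j)))"
    proof (rule sum.cong[OF refl])
      fix j
      have "{j * 3..<j * 3 + 3} = {3 * j, Suc (3 * j), Suc (Suc (3 * j))}" by auto
      moreover have "Suc (3 * j) div 3 = j" "Suc (Suc (3 * j)) div 3 = j" "Suc (3 * j) mod 3 = 1" "Suc (Suc (3 * j)) mod 3 = 2"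
        by presburger+
      ultimately show "(\<Sum>i\<in>{j * 3..<j * 3 + 3}. blinfun_apply (f i) (W \<omega> (x i))) = blinfun_apply (F j) (second_difference (W \<omega>) (p j))"
        by (cases "p j") (simp add: f_def x_def second_difference_def blinfun.diff_right blinfun.add_right
            blinfun.scaleR_right blinfun.scaleR_left uminus_blinfun.rep_eq)
    qed
    finally show ?thesis .
  qed
  moreover have "centered_normal M (\<lambda>\<omega>. \<Sum>i<n * 3. blinfun_apply (f i) (W \<omega> (x i)))"
    using W x_in unfolding centered_gaussian_process_def by blast
  ultimately show ?thesis by simp
qed

locale gaussian_limit = prob_space M' for M' :: "'c measure" +
  fixes w :: weight and W :: "'c \<Rightarrow> real \<Rightarrow> 'b::{banach, second_countable_topology}"
    and D :: "(real \<times> real) set"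
  assumes weight: "valid_weight w"
    and gauss: "centered_gaussian_process M' W"
    and paths: "\<And>\<omega>. \<omega> \<in> space M' \<Longrightarrow> W \<omega> \<in> holder_space w"
    and nondegenerate: "\<not> (AE \<omega> in M'. \<forall>p\<in>scan_triangle. second_difference (W \<omega>) p = 0)"
    and D: "countable D" "D \<subseteq> scan_triangle" "scan_triangle \<subseteq> closure D"
begin

lemma scan_triangle_nonempty: "(1 / 2, 1 / 2) \<in> scan_triangle"
  by (simp add: scan_triangle_def)

lemma D_nonempty: "D \<noteq> {}"
  using D(3) scan_triangle_nonempty by auto

text \<open>\<open>prod_decode\<close> pairs each norming functional with each point of
  \<open>D\<close>. Levels are nonnegative because \<open>ennreal\<close> sends negative reals to 0.
  The last two properties serve the separability hypothesis and the exclusion of an atom at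
  0.\<close>

lemma gaussian_coordinates:
  obtains X where "gaussian_sequence M' X"
    "\<And>\<omega> t. 0 \<le> t \<Longrightarrow> (\<forall>j. X j \<omega> \<le> t) \<longleftrightarrow> osc w D (W \<omega>) \<le> ennreal t"
    "\<And>j. \<exists>p\<in>scan_triangle. \<forall>\<omega> \<omega>'. \<bar>X j \<omega> - X j \<omega>'\<bar> \<le>
      norm (second_difference (W \<omega>) p - second_difference (W \<omega>') p) / rho w (snd p)"
    "\<And>j. \<exists>p\<in>scan_triangle. \<forall>\<omega>. second_difference (W \<omega>) p = 0 \<longrightarrow> X j \<omega> = 0"
proof -
  obtain F :: "nat \<Rightarrow> 'b \<Rightarrow>\<^sub>L real" where F: "\<And>i x. \<bar>blinfun_apply (F i) x\<bar> \<le> norm x"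
    "\<And>x t. norm x \<le> t \<longleftrightarrow> (\<forall>i. blinfun_apply (F i) x \<le> t)"
    by (rule countable_norming_set) blast
  define d where "d = from_nat_into D"
  have range_d: "range d = D" unfolding d_def using D D_nonempty by simp
  define P where "P j = d (snd (prod_decode j))" for j
  have P: "P j \<in> scan_triangle" for j using range_d D(2) by (auto simp: P_def)
  have rho: "0 < rho w (snd (P j))" for j by (rule rho_pos_triangle[OF weight P])
  define G where "G j = (1 / rho w (snd (P j))) *\<^sub>R F (fst (prod_decode j))" for j
  define X where "X j \<omega> = blinfun_apply (G j) (second_difference (W \<omega>) (P j))" for j \<omega>
  show ?thesis
  proof (rule that[of X])
    show "gaussian_sequence M' X"
    proof
      fix n and t :: "nat \<Rightarrow> real"
      have "centered_normal M' (\<lambda>\<omega>. \<Sum>j<n. blinfun_apply (t j *\<^sub>R G j) (second_difference (W \<omega>) (P j)))"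
        by (rule second_differences_normal[OF gauss P])
      then show "centered_normal M' (\<lambda>\<omega>. \<Sum>j<n. t j * X j \<omega>)" by (simp add: X_def blinfun.scaleR_left)
    qed
    fix j
    have "\<bar>X j \<omega> - X j \<omega>'\<bar> \<le> norm (second_difference (W \<omega>) (P j) - second_difference (W \<omega>') (P j)) / rho w (snd (P j))" for \<omega> \<omega>'
    proof -
      have "X j \<omega> - X j \<omega>' = blinfun_apply (F (fst (prod_decode j))) (second_difference (W \<omega>) (P j) - second_difference (W \<omega>') (P j)) / rho w (snd (P j))"
        by (simp add: X_def G_def blinfun.scaleR_left blinfun.diff_right diff_divide_distrib)
      then show ?thesis using F(1) rho[of j] by (simp add: divide_right_mono)
    qed
    then show "\<exists>p\<in>scan_triangle. \<forall>\<omega> \<omega>'. \<bar>X j \<omega> - X j \<omega>'\<bar> \<le>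
      norm (second_difference (W \<omega>) p - second_difference (W \<omega>') p) / rho w (snd p)" using P by blast
    show "\<exists>p\<in>scan_triangle. \<forall>\<omega>. second_difference (W \<omega>) p = 0 \<longrightarrow> X j \<omega> = 0"
      using P by (intro bexI[of _ "P j"]) (auto simp: X_def)
  next
    fix \<omega> and t :: real assume t: "0 \<le> t"
    have q_le: "ennreal (norm (second_difference (W \<omega>) p) / rho w (snd p)) \<le> ennreal t \<longleftrightarrow>
      norm (second_difference (W \<omega>) p) / rho w (snd p) \<le> t" for p
      using t by simp
    have "osc w D (W \<omega>) \<le> ennreal t \<longleftrightarrow> (\<forall>p\<in>D. norm (second_difference (W \<omega>) p) / rho w (snd p) \<le> t)"
      unfolding osc_def SUP_le_iff q_le ..
    also have "\<dots> \<longleftrightarrow> (\<forall>j. X j \<omega> \<le> t)"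
    proof safe
      fix j assume le: "\<forall>p\<in>D. norm (second_difference (W \<omega>) p) / rho w (snd p) \<le> t"
      have "X j \<omega> \<le> norm (second_difference (W \<omega>) (P j)) / rho w (snd (P j))"
        using F(1)[of "fst (prod_decode j)" "second_difference (W \<omega>) (P j)"] rho[of j]
        by (simp add: X_def G_def blinfun.scaleR_left divide_right_mono)
      also have "\<dots> \<le> t" using le range_d by (auto simp: P_def)
      finally show "X j \<omega> \<le> t" .
    next
      fix a b assume le: "\<forall>j. X j \<omega> \<le> t" and "(a, b) \<in> D"
      then obtain k where k: "d k = (a, b)" using range_d by (metis rangeE)
      let ?v = "second_difference (W \<omega>) (a, b)"
      have r: "0 < rho w b" using rho[of "prod_encode (0, k)"] by (simp add: P_def k)
      have Fle: "blinfun_apply (F i) ?v \<le> t * rho w b" for i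
        using le[rule_format, of "prod_encode (i, k)"] r by (simp add: X_def G_def P_def k blinfun.scaleR_left field_simps)
      have "norm ?v \<le> t * rho w b" unfolding F(2) using Fle by blast
      then show "norm ?v / rho w (snd (a, b)) \<le> t" using r by (simp add: field_simps)
    qed
    finally show "(\<forall>j. X j \<omega> \<le> t) \<longleftrightarrow> osc w D (W \<omega>) \<le> ennreal t" by simp
  qed
qed

text \<open>The locale provides scalar projections of the path as random variables; norming
  functionals express a bound on the norm through countably many of them.\<close>

lemma measurable_osc_path [measurable]:
  assumes "D' \<subseteq> D" shows "(\<lambda>\<omega>. osc w D' (W \<omega>)) \<in> borel_measurable M'"
  unfolding osc_def
proof (rule borel_measurable_SUP)
  show "countable D'" using assms D(1) by (rule countable_subset)
  obtain F :: "nat \<Rightarrow> 'b \<Rightarrow>\<^sub>L real" where "\<And>i x. \<bar>blinfun_apply (F i) x\<bar> \<le> norm x"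
    and F: "\<And>x t. norm x \<le> t \<longleftrightarrow> (\<forall>i. blinfun_apply (F i) x \<le> t)"
    by (rule countable_norming_set) blast
  fix p assume "p \<in> D'"
  then have p: "p \<in> scan_triangle" using assms D(2) by blast
  have [measurable]: "(\<lambda>\<omega>. blinfun_apply (F i) (second_difference (W \<omega>) p)) \<in> borel_measurable M'" for i
    using second_differences_normal[OF gauss, of "Suc 0" "\<lambda>_. p" "\<lambda>_. F i"] p by (simp add: centered_normal_def)
  have "(\<lambda>\<omega>. norm (second_difference (W \<omega>) p)) \<in> borel_measurable M'"
    unfolding borel_measurable_iff_le F by measurable
  then show "(\<lambda>\<omega>. ennreal (norm (second_difference (W \<omega>) p) / rho w (snd p))) \<in> borel_measurable M'"
    by measurable
qed

lemma prob_osc_eq_zero: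
  assumes q: "0 < q" shows "prob {\<omega> \<in> space M'. osc w D (W \<omega>) = ennreal q} = 0"
proof -
  obtain X where X: "gaussian_sequence M' X"
    and X_le: "\<And>\<omega> t. 0 \<le> t \<Longrightarrow> (\<forall>j. X j \<omega> \<le> t) \<longleftrightarrow> osc w D (W \<omega>) \<le> ennreal t"
    and X_diff: "\<And>j. \<exists>p\<in>scan_triangle. \<forall>\<omega> \<omega>'. \<bar>X j \<omega> - X j \<omega>'\<bar> \<le>
      norm (second_difference (W \<omega>) p - second_difference (W \<omega>') p) / rho w (snd p)"
    using gaussian_coordinates by metis
  interpret X: gaussian_sequence M' X by (rule X)
  have "prob {\<omega> \<in> space M'. (\<forall>j. X j \<omega> \<le> q) \<and> (\<forall>e>0. \<exists>j. q - e < X j \<omega>)} = 0"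
  proof (rule X.prob_sup_eq_zero[OF _ q])
    fix e :: real assume "0 < e"
    then obtain D' where D': "D' \<subseteq> space M'" "countable D'"
      "\<And>\<omega>. \<omega> \<in> space M' \<Longrightarrow> \<exists>\<omega>'\<in>D'. \<forall>p\<in>scan_triangle.
        norm (second_difference (W \<omega>) p - second_difference (W \<omega>') p) / rho w (snd p) \<le> 4 * (e / 4)"
      \<comment> \<open>The division by 4 compensates the tolerance \<open>4 * e\<close> of the
        net.\<close>
      using countable_net_paths[where f = W and \<Omega> = "space M'" and e = "e / 4", OF weight paths] by auto
    have "\<exists>\<omega>'\<in>D'. \<forall>j. \<bar>X j \<omega> - X j \<omega>'\<bar> \<le> e" if "\<omega> \<in> space M'" for \<omega>
      using D'(3)[OF that] X_diff by simp (meson order_trans)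
    then show "\<exists>D\<subseteq>space M'. countable D \<and> (\<forall>\<omega>\<in>space M'. \<exists>\<omega>'\<in>D. \<forall>j. \<bar>X j \<omega> - X j \<omega>'\<bar> \<le> e)"
      using D' by blast
  qed
  moreover have "{\<omega> \<in> space M'. osc w D (W \<omega>) = ennreal q} \<subseteq> {\<omega> \<in> space M'. (\<forall>j. X j \<omega> \<le> q) \<and> (\<forall>e>0. \<exists>j. q - e < X j \<omega>)}"
  proof safe
    fix \<omega> j assume "osc w D (W \<omega>) = ennreal q"
    then show "X j \<omega> \<le> q" using X_le[of q \<omega>] q by auto
  next
    fix \<omega> and e :: real assume o: "osc w D (W \<omega>) = ennreal q" and e: "0 < e"
    show "\<exists>j. q - e < X j \<omega>"
    proof (rule ccontr)
      assume "\<not> (\<exists>j. q - e < X j \<omega>)"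
      \<comment> \<open>The maximum with 0 covers \<open>e > q\<close>, where \<open>X_le\<close>
        does not apply to the negative level \<open>q - e\<close>.\<close>
      then have "\<forall>j. X j \<omega> \<le> max 0 (q - e)" by (meson max.coboundedI2 not_less)
      then have "ennreal q \<le> ennreal (max 0 (q - e))" using X_le[of "max 0 (q - e)" \<omega>] o by simp
      then show False using q e by (subst (asm) ennreal_le_iff) auto
    qed
  qed
  moreover have "{\<omega> \<in> space M'. (\<forall>j. X j \<omega> \<le> q) \<and> (\<forall>e>0. \<exists>j. q - e < X j \<omega>)} \<in> events"
    using X.approach_iff[where P = "\<lambda>_. True"] by simp
  ultimately show ?thesis
    using finite_measure_mono[of "{\<omega> \<in> space M'. osc w D (W \<omega>) = ennreal q}"] by (metis (no_types, lifting) measure_le_0_iff)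
qed

text \<open>If all coordinates had variance 0, almost every path would have vanishing second
  differences, against nondegeneracy. So some coordinate has a normal density, and the event forces
  that coordinate to be exactly 0.\<close>

lemma prob_osc_zero: "prob {\<omega> \<in> space M'. osc w D (W \<omega>) \<le> ennreal 0} = 0"
proof -
  obtain X where X: "gaussian_sequence M' X"
    and X_le: "\<And>\<omega> t. 0 \<le> t \<Longrightarrow> (\<forall>j. X j \<omega> \<le> t) \<longleftrightarrow> osc w D (W \<omega>) \<le> ennreal t"
    and X_zero: "\<And>j. \<exists>p\<in>scan_triangle. \<forall>\<omega>. second_difference (W \<omega>) p = 0 \<longrightarrow> X j \<omega> = 0"
    using gaussian_coordinates by metis
  interpret X: gaussian_sequence M' X by (rule X)
  have zero_iff: "osc w D (W \<omega>) \<le> ennreal 0 \<longleftrightarrow> (\<forall>p\<in>scan_triangle. second_difference (W \<omega>) p = 0)"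
    if \<omega>: "\<omega> \<in> space M'" for \<omega>
  proof -
    \<comment> \<open>\<open>limit_statistic\<close> mediates between the countable set
      \<open>D\<close> and the full triangle, for which nondegeneracy is stated.\<close>
    have "osc w D (W \<omega>) \<le> ennreal 0 \<longleftrightarrow> limit_statistic w (W \<omega>) \<le> 0"
      by (rule limit_statistic_le_iff[OF weight paths[OF \<omega>] D(2,3) order_refl, symmetric])
    also have "\<dots> \<longleftrightarrow> osc w scan_triangle (W \<omega>) \<le> ennreal 0"
      by (rule limit_statistic_le_iff[OF weight paths[OF \<omega>] order_refl closure_subset order_refl])
    also have "\<dots> \<longleftrightarrow> (\<forall>p\<in>scan_triangle. norm (second_difference (W \<omega>) p) / rho w (snd p) \<le> 0)"
      unfolding osc_def SUP_le_iff by (simp add: ennreal_eq_0_iff)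
    also have "\<dots> \<longleftrightarrow> (\<forall>p\<in>scan_triangle. second_difference (W \<omega>) p = 0)"
      using rho_pos_triangle[OF weight] by (intro ball_cong refl) (force simp: divide_le_0_iff)
    finally show ?thesis .
  qed
  have "\<exists>j. X.sd j \<noteq> 0"
  proof (rule ccontr)
    assume "\<not> (\<exists>j. X.sd j \<noteq> 0)"
    then have "AE \<omega> in M'. X j \<omega> = 0" for j
      using integral_nonneg_eq_0_iff_AE[OF X.square_integrable[of j]] X.sd_square[of j] by simp
    then have "AE \<omega> in M'. \<forall>j. X j \<omega> = 0" by (simp add: AE_all_countable)
    then have "AE \<omega> in M'. \<forall>p\<in>scan_triangle. second_difference (W \<omega>) p = 0"
    proof (rule AE_mp, intro AE_I2 impI)
      fix \<omega> assume "\<omega> \<in> space M'" "\<forall>j. X j \<omega> = 0"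
      then show "\<forall>p\<in>scan_triangle. second_difference (W \<omega>) p = 0"
        using X_le[of 0 \<omega>] zero_iff[of \<omega>] by simp
    qed
    then show False using nondegenerate by simp
  qed
  then obtain j where j: "0 < X.sd j" using X.sd_nonneg by (metis less_le)
  have "prob {\<omega> \<in> space M'. osc w D (W \<omega>) \<le> ennreal 0} \<le> prob (X j -` {0} \<inter> space M')"
  proof (rule finite_measure_mono)
    show "{\<omega> \<in> space M'. osc w D (W \<omega>) \<le> ennreal 0} \<subseteq> X j -` {0} \<inter> space M'"
      using X_zero[of j] zero_iff by auto
  qed auto
  also have "\<dots> = measure (distr M' borel (X j)) {0}" by (subst measure_distr) auto
  also have "\<dots> = 0"
    unfolding X.distr_X[OF j] by (simp add: measure_def emeasure_density nn_integral_0_iff_AE AE_lborel_singleton eventually_mono[OF AE_lborel_singleton[of 0]])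
  finally show ?thesis by (simp add: measure_le_0_iff)
qed

text \<open>Each single path has vanishing oscillation at small scales, so the events
  \<open>A n\<close> increase to the whole space; continuity from below makes the scale uniform up
  to probability \<open>\<eta>\<close>.\<close>

lemma prob_osc_small_scale:
  assumes e: "0 < e" and \<eta>: "0 < \<eta>"
  obtains \<delta> where "0 < \<delta>" "1 - \<eta> \<le> prob {\<omega> \<in> space M'. osc w {p \<in> D. snd p \<le> \<delta>} (W \<omega>) \<le> ennreal e}"
proof -
  define A where "A n = {\<omega> \<in> space M'. osc w {p \<in> D. snd p \<le> 1 / real (Suc n)} (W \<omega>) \<le> ennreal e}" for n
  have sub: "{p \<in> D. snd p \<le> d} \<subseteq> D" for d by auto
  note [measurable] = measurable_osc_path[OF sub]
  have [measurable]: "A n \<in> events" for n unfolding A_def by measurable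
  have "incseq A"
  proof (rule incseq_SucI, unfold A_def, rule subsetI)
    fix n \<omega> assume "\<omega> \<in> {\<omega> \<in> space M'. osc w {p \<in> D. snd p \<le> 1 / real (Suc n)} (W \<omega>) \<le> ennreal e}"
    moreover have "{p \<in> D. snd p \<le> 1 / real (Suc (Suc n))} \<subseteq> {p \<in> D. snd p \<le> 1 / real (Suc n)}"
      by (auto elim!: order_trans intro!: divide_left_mono)
    then have "osc w {p \<in> D. snd p \<le> 1 / real (Suc (Suc n))} (W \<omega>) \<le> osc w {p \<in> D. snd p \<le> 1 / real (Suc n)} (W \<omega>)"
      unfolding osc_def by (rule SUP_subset_mono) simp
    ultimately show "\<omega> \<in> {\<omega> \<in> space M'. osc w {p \<in> D. snd p \<le> 1 / real (Suc (Suc n))} (W \<omega>) \<le> ennreal e}"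
      by (auto intro: order_trans)
  qed
  then have "(\<lambda>n. prob (A n)) \<longlonglongrightarrow> prob (\<Union>n. A n)"
    by (intro finite_Lim_measure_incseq) auto
  also have "(\<Union>n. A n) = space M'"
  proof safe
    fix \<omega> assume \<omega>: "\<omega> \<in> space M'"
    obtain \<delta> where \<delta>: "0 < \<delta>" "\<And>p. p \<in> scan_triangle \<Longrightarrow> snd p < \<delta> \<Longrightarrow> norm (second_difference (W \<omega>) p) / rho w (snd p) \<le> e"
      using holder_space_little_o[OF weight paths[OF \<omega>] e] by blast
    obtain n where n: "1 / real (Suc n) < \<delta>" using nat_approx_posE[OF \<delta>(1)] by blast
    have "osc w {p \<in> D. snd p \<le> 1 / real (Suc n)} (W \<omega>) \<le> ennreal e"
      unfolding osc_def
    proof (rule SUP_least, rule ennreal_leI, rule \<delta>(2))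
      fix p assume "p \<in> {p \<in> D. snd p \<le> 1 / real (Suc n)}"
      then show "p \<in> scan_triangle" "snd p < \<delta>" using D(2) n by auto
    qed
    then show "\<omega> \<in> (\<Union>n. A n)" using \<omega> by (auto simp: A_def)
  qed (auto simp: A_def)
  finally have "(\<lambda>n. prob (A n)) \<longlonglongrightarrow> 1" by (simp add: prob_space)
  then have "\<forall>\<^sub>F n in sequentially. 1 - \<eta> < prob (A n)" using \<eta> by (intro order_tendstoD) auto
  then obtain n where "1 - \<eta> < prob (A n)" using eventually_happens by fastforce
  then show ?thesis using that[of "1 / real (Suc n)"] by (simp add: A_def)
qed

text \<open>The strict inequality \<open>a < q\<close> supplies the gap that
  \<open>weak_convergence_osc\<close> requires, and it is here that the absence of an atom at
  \<open>q\<close> is used. Positivity of \<open>q\<close> comes from the absence of an atom at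
  0.\<close>

lemma quantile_properties:
  assumes \<alpha>: "0 < \<alpha>" "\<alpha> < 1"
  defines "q \<equiv> quantile M' (\<lambda>\<omega>. limit_statistic w (W \<omega>)) (1 - \<alpha>)"
  shows "0 < q" "\<And>\<eta>. 0 < \<eta> \<Longrightarrow> \<exists>a. 0 \<le> a \<and> a < q \<and> 1 - \<alpha> - \<eta> \<le> prob {\<omega> \<in> space M'. osc w D (W \<omega>) \<le> ennreal a}"
proof -
  define Y where "Y \<omega> = enn2real (osc w D (W \<omega>))" for \<omega>
  have [measurable]: "(\<lambda>\<omega>. osc w D (W \<omega>)) \<in> borel_measurable M'" by (rule measurable_osc_path) simp
  have Y [measurable]: "Y \<in> borel_measurable M'" unfolding Y_def by measurable
  have osc_eq: "osc w D (W \<omega>) = ennreal (Y \<omega>)" if "\<omega> \<in> space M'" for \<omega>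
    using osc_finite[OF weight D(2) paths[OF that]] by (simp add: Y_def)
  have Y_nonneg: "0 \<le> Y \<omega>" for \<omega> by (simp add: Y_def)
  interpret R: real_distribution "distr M' borel Y" by (rule real_distribution_distr) simp
  define F where "F = cdf (distr M' borel Y)"
  have osc_set: "{\<omega> \<in> space M'. osc w D (W \<omega>) \<le> ennreal t} = {\<omega> \<in> space M'. Y \<omega> \<le> t}" if "0 \<le> t" for t
    using that osc_eq Y_nonneg by auto
  have F_Y: "F t = prob {\<omega> \<in> space M'. Y \<omega> \<le> t}" for t
    unfolding F_def cdf_def by (subst measure_distr) (auto intro!: arg_cong[where f = prob])
  have F_osc: "F t = prob {\<omega> \<in> space M'. osc w D (W \<omega>) \<le> ennreal t}" if "0 \<le> t" for t
    unfolding osc_set[OF that] by (rule F_Y)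
  have lim_set: "{\<omega> \<in> space M'. limit_statistic w (W \<omega>) \<le> t} = {\<omega> \<in> space M'. osc w D (W \<omega>) \<le> ennreal t}" if "0 \<le> t" for t
    using limit_statistic_le_iff[OF weight paths D(2,3) that] by auto
  have F0: "F 0 = 0" using prob_osc_zero by (simp add: F_osc)
  have mono: "F s \<le> F t" if "s \<le> t" for s t unfolding F_def using that by (rule R.cdf_nondecreasing)
  define S where "S = {t. 1 - \<alpha> \<le> prob {\<omega> \<in> space M'. limit_statistic w (W \<omega>) \<le> t}}"
  \<comment> \<open>Nonpositive levels drop out because the statistic is nonpositive with
    probability 0; at positive levels its distribution function is \<open>F\<close>.\<close>
  have S: "S = {t. 0 < t \<and> 1 - \<alpha> \<le> F t}"
  proof -
    have "\<not> 1 - \<alpha> \<le> prob {\<omega> \<in> space M'. limit_statistic w (W \<omega>) \<le> t}" if "t \<le> 0" for t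
    proof -
      have "prob {\<omega> \<in> space M'. limit_statistic w (W \<omega>) \<le> t} \<le> prob {\<omega> \<in> space M'. limit_statistic w (W \<omega>) \<le> 0}"
      proof (rule finite_measure_mono)
        show "{\<omega> \<in> space M'. limit_statistic w (W \<omega>) \<le> 0} \<in> events"
          unfolding lim_set[OF order_refl] by measurable
      qed (use that in auto)
      also have "\<dots> = 0" using F0 lim_set[OF order_refl] F_osc by simp
      finally show ?thesis using \<alpha> by simp
    qed
    moreover have "prob {\<omega> \<in> space M'. limit_statistic w (W \<omega>) \<le> t} = F t" if "0 < t" for t
      using that by (simp add: F_osc lim_set)
    ultimately have "1 - \<alpha> \<le> prob {\<omega> \<in> space M'. limit_statistic w (W \<omega>) \<le> t} \<longleftrightarrow> 0 < t \<and> 1 - \<alpha> \<le> F t" for t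
      by (cases "t \<le> 0") simp_all
    then show ?thesis unfolding S_def by simp
  qed
  have q: "q = Inf S" by (simp add: q_def quantile_def S_def)
  have "\<forall>\<^sub>F t in at_top. 1 - \<alpha> < F t"
    unfolding F_def using \<alpha> by (intro order_tendstoD(1)[OF R.cdf_lim_at_top_prob]) auto
  then have "\<forall>\<^sub>F t in at_top. 0 < t \<and> 1 - \<alpha> \<le> F t"
    using eventually_gt_at_top[of 0] by eventually_elim auto
  then obtain t where "0 < t \<and> 1 - \<alpha> \<le> F t" using eventually_happens'[OF trivial_limit_at_top_linorder] by blast
  then have S_ne: "S \<noteq> {}" unfolding S by blast
  have S_bdd: "bdd_below S" by (rule bdd_belowI[of _ 0]) (auto simp: S)
  have q0: "0 \<le> q" unfolding q using S_ne by (intro cInf_greatest) (auto simp: S)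
  have "(F \<longlongrightarrow> F q) (at_right q)"
    using R.cdf_is_right_cont[of q] by (simp add: F_def continuous_within)
  moreover have "\<forall>\<^sub>F t in at_right q. 1 - \<alpha> \<le> F t"
  proof (rule eventually_at_right_less[THEN eventually_mono])
    fix t assume "q < t"
    then obtain s where "s \<in> S" "s < t" using cInf_less_iff[OF S_ne S_bdd] q by auto
    then show "1 - \<alpha> \<le> F t" using mono[of s t] by (auto simp: S)
  qed
  ultimately have Fq: "1 - \<alpha> \<le> F q" by (rule tendsto_lowerbound) simp
  show q_pos: "0 < q" using Fq F0 q0 \<alpha> by (cases "q = 0") auto
  have "measure (distr M' borel Y) {q} = prob {\<omega> \<in> space M'. osc w D (W \<omega>) = ennreal q}"
    using osc_eq q_pos Y_nonneg by (subst measure_distr) (auto intro!: arg_cong[where f = prob])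
  then have "measure (distr M' borel Y) {q} = 0" using prob_osc_eq_zero[OF q_pos] by simp
  moreover have "F q = measure (distr M' borel Y) {..<q} + measure (distr M' borel Y) {q}"
    unfolding F_def cdf_def ivl_disj_un(2)[symmetric] by (intro R.finite_measure_Union) auto
  \<comment> \<open>Without an atom at \<open>q\<close> the left limit of \<open>F\<close> at
    \<open>q\<close> is still at least \<open>1 - \<alpha>\<close>, so levels slightly below
    \<open>q\<close> carry almost that mass.\<close>
  ultimately have left: "1 - \<alpha> \<le> measure (distr M' borel Y) {..<q}" using Fq by simp
  show "\<exists>a. 0 \<le> a \<and> a < q \<and> 1 - \<alpha> - \<eta> \<le> prob {\<omega> \<in> space M'. osc w D (W \<omega>) \<le> ennreal a}" if "0 < \<eta>" for \<eta>
  proof -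
    have "\<forall>\<^sub>F t in at_left q. 1 - \<alpha> - \<eta> < F t"
      unfolding F_def using left that by (intro order_tendstoD(1)[OF R.cdf_at_left]) auto
    moreover have "\<forall>\<^sub>F t in at_left q. t \<in> {0<..<q}" using q_pos by (rule eventually_at_left_real)
    ultimately have "\<forall>\<^sub>F t in at_left q. 0 \<le> t \<and> t < q \<and> 1 - \<alpha> - \<eta> \<le> F t" by eventually_elim auto
    then obtain t where "0 \<le> t" "t < q" "1 - \<alpha> - \<eta> \<le> F t"
      using eventually_happens[of _ "at_left q"] by (auto simp: trivial_limit_at_left_real)
    then show ?thesis using F_osc by auto
  qed
qed

end

section \<open>Localization\<close>

text \<open>One exponent \<open>x\<close> treats both weights together: the signal is the spacing to
  the power \<open>x\<close> times the jump, and the rate is the quotient of detection level and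
  jump to the power \<open>1 / x\<close>. For logarithmic weights \<open>1 / x = 2\<close> produces
  the squares in the rate.\<close>

fun signal_exponent :: "weight \<Rightarrow> real" where
  "signal_exponent (Poly_weight \<beta>) = 1 - \<beta>"
| "signal_exponent (Log_weight \<beta>) = 1 / 2"

lemma signal_exponent_pos: "valid_weight w \<Longrightarrow> 0 < signal_exponent w"
  by (cases w) auto

lemma signal_strength_eq: "signal_strength w \<delta> \<Delta> = real_of_int \<delta> powr signal_exponent w * \<Delta>"
  by (cases w) auto

lemma detection_level_pos: "2 \<le> N \<Longrightarrow> 0 < detection_level w N"
  by (cases w) auto

lemma powr_real_at_top:
  assumes "0 < s" shows "filterlim (\<lambda>x. x powr s) at_top (at_top :: real filter)"
proof -
  have "filterlim (\<lambda>x :: real. exp (s * ln x)) at_top at_top"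
    by (rule filterlim_compose[OF exp_at_top filterlim_tendsto_pos_mult_at_top[OF tendsto_const assms ln_at_top]])
  moreover have "\<forall>\<^sub>F x :: real in at_top. exp (s * ln x) = x powr s"
    using eventually_gt_at_top[of 0] by eventually_elim (simp add: powr_def)
  ultimately show ?thesis by (simp cong: filterlim_cong)
qed

lemma detection_level_at_top:
  assumes "valid_weight w" shows "filterlim (detection_level w) at_top sequentially"
proof (cases w)
  case (Poly_weight \<beta>)
  then have pos: "0 < 1 / 2 - \<beta>" using assms by simp
  have eq: "detection_level w = (\<lambda>N. real N powr (1 / 2 - \<beta>))" by (auto simp: Poly_weight)
  from filterlim_compose[OF powr_real_at_top[OF pos] filterlim_real_sequentially] show ?thesis
    unfolding eq .
next
  case (Log_weight \<beta>)
  then have pos: "0 < \<beta>" using assms by simp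
  have eq: "detection_level w = (\<lambda>N. ln (real N) powr \<beta>)" by (auto simp: Log_weight)
  from filterlim_compose[OF powr_real_at_top[OF pos] filterlim_compose[OF ln_at_top filterlim_real_sequentially]] show ?thesis
    unfolding eq .
qed

lemma localization_rate_eq:
  assumes "valid_weight w" "0 < \<Delta>" "2 \<le> N"
  shows "localization_rate w N \<Delta> = (detection_level w N / \<Delta>) powr (1 / signal_exponent w)"
proof (cases w)
  case (Log_weight \<beta>)
  have "(ln (real N) powr \<beta> / \<Delta>) powr 2 = ln (real N) powr (2 * \<beta>) / \<Delta>\<^sup>2"
    using assms by (simp add: powr_divide powr_powr powr_numeral mult.commute)
  then show ?thesis by (simp add: Log_weight)
qed simp

text \<open>For logarithmic weights the inequality is \<open>ln (N / h) \<le> ln N\<close>; for polynomial weights it is an equality.\<close>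

lemma scan_signal_lower_bound:
  fixes h \<Delta> :: real
  assumes w: "valid_weight w" and h: "1 \<le> h" "2 * h \<le> real N" and \<Delta>: "0 \<le> \<Delta>"
  shows "h powr signal_exponent w * \<Delta> / detection_level w N \<le> h * \<Delta> / (sqrt (real N) * rho w (h / real N))"
proof -
  have N: "0 < real N" "2 \<le> N" using h by auto
  have pos: "0 < sqrt (real N) * rho w (h / real N)"
    using rho_pos[OF w, of "h / real N"] h N by (simp add: field_simps)
  have "h powr signal_exponent w * (sqrt (real N) * rho w (h / real N)) \<le> h * detection_level w N"
  proof (cases w)
    case (Poly_weight \<beta>)
    have "sqrt (real N) * (h / real N) powr \<beta> = real N powr (1 / 2 - \<beta>) * h powr \<beta>"
      using h N by (simp add: powr_half_sqrt[symmetric] powr_divide powr_diff)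
    moreover have "h powr (1 - \<beta>) * h powr \<beta> = h" using h by (simp add: powr_add[symmetric])
    ultimately have "h powr (1 - \<beta>) * (sqrt (real N) * (h / real N) powr \<beta>) = h * real N powr (1 / 2 - \<beta>)"
      by (metis mult.assoc mult.commute)
    then show ?thesis by (simp add: Poly_weight)
  next
    case (Log_weight \<beta>)
    have "sqrt (real N) * (h / real N) powr (1 / 2) = h powr (1 / 2)"
      using h N by (simp add: powr_half_sqrt real_sqrt_divide)
    moreover have "h powr (1 / 2) * h powr (1 / 2) = h" using h by (simp add: powr_add[symmetric])
    ultimately have "h powr (1 / 2) * (sqrt (real N) * ((h / real N) powr (1 / 2) * ln (1 / (h / real N)) powr \<beta>)) =
        h * ln (real N / h) powr \<beta>"
      by (simp add: mult.assoc[symmetric])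
    also have "\<dots> \<le> h * ln (real N) powr \<beta>"
    proof -
      have "1 \<le> real N / h" "real N / h \<le> real N" using h N by (auto simp: field_simps)
      then have "0 \<le> ln (real N / h)" "ln (real N / h) \<le> ln (real N)" using N by auto
      then show ?thesis using h w Log_weight by (intro mult_left_mono powr_mono2) auto
    qed
    finally show ?thesis by (simp add: Log_weight)
  qed
  then have "h powr signal_exponent w * (sqrt (real N) * rho w (h / real N)) * \<Delta> \<le> h * detection_level w N * \<Delta>"
    using \<Delta> by (rule mult_right_mono)
  then show ?thesis using pos detection_level_pos[OF N(2), of w]
    by (simp add: divide_le_eq pos_le_divide_eq mult.commute mult.left_commute)
qed

text \<open>Minimality of the exponent limits the overshoot to a factor \<open>\<theta>\<close>;
  \<open>x > 1\<close> excludes the exponent 0.\<close>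

lemma geometric_scale:
  fixes \<theta> x :: real
  assumes "1 < \<theta>" "1 < x"
  obtains m where "1 \<le> m" "x \<le> \<theta> ^ m" "\<theta> ^ m \<le> \<theta> * x"
proof -
  define m where "m = (LEAST m. x \<le> \<theta> ^ m)"
  have "\<exists>m. x \<le> \<theta> ^ m" using real_arch_pow[OF assms(1), of x] by (auto intro: less_imp_le)
  then have m: "x \<le> \<theta> ^ m" unfolding m_def by (rule LeastI_ex)
  have m0: "m \<noteq> 0" using m assms by (intro notI) simp
  have "\<not> x \<le> \<theta> ^ (m - 1)" using not_less_Least[of "m - 1" "\<lambda>m. x \<le> \<theta> ^ m"] m0 by (simp add: m_def)
  then have "\<theta> * \<theta> ^ (m - 1) \<le> \<theta> * x" using assms by (intro mult_left_mono) auto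
  then have "\<theta> ^ m \<le> \<theta> * x" using m0 by (simp add: power_eq_if)
  then show ?thesis using that[of m] m m0 by simp
qed

text \<open>At scale \<open>h\<close> the signal \<open>2 * q\<close> minus the noise
  \<open>q / 2\<close> still exceeds \<open>q\<close>. Output pairs of length at most
  \<open>h\<close> also exceed \<open>q\<close>, which noise alone cannot achieve. Disjointness of
  the output makes the detected pair the only one covering \<open>c k\<close>, so its length bound
  holds for every such pair.\<close>

lemma multiscan_localizes:
  assumes cp: "change_points N K c \<mu>" and P: "P \<subseteq> all_pairs N"
    and scan: "multiscan (scan_statistic w N (\<lambda>n. observation K c \<mu> \<epsilon> n \<omega>)) q {} P R"
    and k: "k \<in> {1..K}"
    and h: "(c k, h) \<in> P" "3 * h < min_spacing c k"
    and q: "0 < q"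
    and signal: "2 * q \<le> h * jump_size \<mu> k / (sqrt N * rho w (h / N))"
    and noise: "\<And>n h'. (n, h') \<in> all_pairs N \<Longrightarrow> h' \<le> h \<Longrightarrow> scan_statistic w N (\<lambda>n. \<epsilon> n \<omega>) (n, h') \<le> q / 2"
  shows "\<exists>!p. p \<in> R \<and> c k \<in> pair_interval p"
    "\<And>n h'. (n, h') \<in> R \<Longrightarrow> c k \<in> pair_interval (n, h') \<Longrightarrow> h' \<le> h"
proof -
  have all_pos: "1 \<le> h'" if "(n, h') \<in> P" for n h' using that P by (auto simp: all_pairs_def)
  have h1: "1 \<le> h" using all_pos[OF h(1)] .
  let ?\<gamma> = "scan_statistic w N (\<lambda>n. observation K c \<mu> \<epsilon> n \<omega>)"
  have "2 * q - q / 2 \<le> ?\<gamma> (c k, h)"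
    using scan_statistic_change_point[OF cp k h1, of w \<epsilon> \<omega>] h h1 signal noise[of "c k" h] P by (auto simp: subset_iff)
  then have "q < ?\<gamma> (c k, h)" using q by simp
  then obtain m h' where m: "(m, h') \<in> R" "h' \<le> h" "pair_interval (m, h') \<inter> pair_interval (c k, h) \<noteq> {}"
    using multiscan_detects[OF scan _ h(1)] all_pos by blast
  have mP: "(m, h') \<in> P" "q < ?\<gamma> (m, h')" using multiscan_output[OF scan _ m(1)] all_pos by auto
  have "\<exists>l\<in>{1..K}. c l \<in> pair_interval (m, h')"
  proof (rule ccontr)
    assume "\<not> (\<exists>l\<in>{1..K}. c l \<in> pair_interval (m, h'))"
    then have "?\<gamma> (m, h') = scan_statistic w N (\<lambda>n. \<epsilon> n \<omega>) (m, h')"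
      using mP P by (intro scan_statistic_no_change_point[OF cp]) auto
    also have "\<dots> \<le> q / 2" using mP P m by (intro noise) auto
    finally show False using mP q by simp
  qed
  then obtain l where l: "l \<in> {1..K}" "c l \<in> pair_interval (m, h')" by blast
  have "l = k"
  proof (rule ccontr)
    assume "l \<noteq> k"
    then have far: "min_spacing c k \<le> \<bar>c l - c k\<bar>" using change_points_separated[OF cp k l(1)] by simp
    obtain z where "z \<in> pair_interval (m, h')" "z \<in> pair_interval (c k, h)" using m(3) by blast
    \<comment> \<open>At most \<open>2 * h\<close> within the output interval and \<open>h\<close>
      within the window around \<open>c k\<close>.\<close>
    then have "\<bar>c l - c k\<bar> \<le> 3 * h" using l(2) m(2) by auto
    then show False using far h(2) by simp
  qed
  then have ck: "c k \<in> pair_interval (m, h')" using l by simp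
  have "disjoint_family_on pair_interval R"
    by (rule multiscan_disjoint[OF scan]) (use all_pos in \<open>auto simp: disjoint_family_on_def\<close>)
  then have uniq: "p = (m, h')" if "p \<in> R" "c k \<in> pair_interval p" for p
    using that m(1) ck unfolding disjoint_family_on_def by blast
  show "\<exists>!p. p \<in> R \<and> c k \<in> pair_interval p" using m(1) ck uniq by blast
  show "h'' \<le> h" if "(n, h'') \<in> R" "c k \<in> pair_interval (n, h'')" for n h''
    using uniq[OF that] m(2) by simp
qed

lemma multiscan_no_false_positives:
  assumes cp: "change_points N K c \<mu>" and P: "P \<subseteq> all_pairs N"
    and scan: "multiscan (scan_statistic w N (\<lambda>n. observation K c \<mu> \<epsilon> n \<omega>)) q {} P R"
    and noise: "\<And>p. p \<in> all_pairs N \<Longrightarrow> scan_statistic w N (\<lambda>n. \<epsilon> n \<omega>) p \<le> q"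
    and p: "p \<in> R"
  shows "\<exists>k\<in>{1..K}. c k \<in> pair_interval p"
proof (rule ccontr)
  assume no: "\<not> (\<exists>k\<in>{1..K}. c k \<in> pair_interval p)"
  obtain n h where nh: "p = (n, h)" by force
  have out: "(n, h) \<in> P \<and> q < scan_statistic w N (\<lambda>n. observation K c \<mu> \<epsilon> n \<omega>) (n, h)"
    using P p unfolding nh by (intro multiscan_output[OF scan]) (auto simp: all_pairs_def)
  moreover have "scan_statistic w N (\<lambda>n. observation K c \<mu> \<epsilon> n \<omega>) (n, h) = scan_statistic w N (\<lambda>n. \<epsilon> n \<omega>) (n, h)"
    using out P no nh by (intro scan_statistic_no_change_point[OF cp]) auto
  ultimately show False using noise[of "(n, h)"] P by force
qed

lemma jump_size_pos: "change_points N K c \<mu> \<Longrightarrow> k \<in> {1..K} \<Longrightarrow> 0 < jump_size \<mu> k"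
  unfolding change_points_def jump_size_def by (metis zero_less_norm_iff right_minus_eq)

lemma min_spacing_bounds:
  assumes cp: "change_points N K c \<mu>" and k: "k \<in> {1..K}"
  shows "0 < min_spacing c k" "min_spacing c k \<le> c k" "c k + min_spacing c k \<le> int N"
proof -
  have "k - 1 \<le> K" "k \<le> K" using k by auto
  then have "c (k - 1) < c (k - 1 + 1)" "c k < c (k + 1)" using cp unfolding change_points_def by blast+
  then have lt: "c (k - 1) < c k" "c k < c (k + 1)" using k by auto
  have "c 0 \<le> c (k - 1)" "c (k + 1) \<le> c (K + 1)" using k by (auto intro!: change_points_mono[OF cp])
  moreover have "c 0 = 0" "c (K + 1) = int N" using cp unfolding change_points_def by blast+
  ultimately show "0 < min_spacing c k" "min_spacing c k \<le> c k" "c k + min_spacing c k \<le> int N"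
    using lt unfolding min_spacing_def by linarith+
qed

text \<open>Raising the signal condition to the power \<open>1 / x\<close> bounds the rate by the
  spacing, hence the comparison with \<open>\<kappa> powr x\<close>. For small
  \<open>\<kappa>\<close> a multiple of the rate then fits between neighbouring change points and
  below any fixed fraction of \<open>N\<close>.\<close>

lemma localization_rate_small:
  fixes \<kappa> :: real
  assumes w: "valid_weight w" and cp: "\<And>N. N \<ge> 1 \<Longrightarrow> change_points N (K N) (c N) (\<mu> N)"
    and signal: "signal_dominates w K c \<mu>" and \<kappa>: "0 < \<kappa>"
  shows "\<forall>\<^sub>F N in sequentially. \<forall>k\<in>{1..K N}.
    localization_rate w N (jump_size (\<mu> N) k) \<le> \<kappa> * min_spacing (c N) k"
proof -
  define x where "x = signal_exponent w"
  have x: "0 < x" using signal_exponent_pos[OF w] by (simp add: x_def)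
  define s where "s N k = signal_strength w (min_spacing (c N) k) (jump_size (\<mu> N) k)" for N k
  have "\<forall>\<^sub>F N in sequentially. (if K N = 0 then 0 else detection_level w N / (MIN k\<in>{1..K N}. s N k)) < \<kappa> powr x"
    using signal \<kappa> unfolding signal_dominates_def s_def[symmetric] by (intro order_tendstoD(2)) auto
  with eventually_ge_at_top[of 2] show ?thesis
  proof eventually_elim
    case (elim N)
    show ?case
    proof
      fix k assume k: "k \<in> {1..K N}"
      then have ratio: "detection_level w N / (MIN k\<in>{1..K N}. s N k) < \<kappa> powr x" using elim by auto
      have cpN: "change_points N (K N) (c N) (\<mu> N)" using elim by (intro cp) simp
      have s_pos: "0 < s N l" if "l \<in> {1..K N}" for l
        using min_spacing_bounds(1)[OF cpN that] jump_size_pos[OF cpN that]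
        by (simp add: s_def signal_strength_eq)
      have Min_pos: "0 < (MIN k\<in>{1..K N}. s N k)" using k s_pos by (subst Min_gr_iff) auto
      have "detection_level w N < \<kappa> powr x * (MIN k\<in>{1..K N}. s N k)"
        using ratio Min_pos by (simp add: divide_less_eq)
      also have "\<dots> \<le> \<kappa> powr x * s N k" using k by (intro mult_left_mono Min_le) auto
      also have "\<dots> = (\<kappa> * min_spacing (c N) k) powr x * jump_size (\<mu> N) k"
        using \<kappa> min_spacing_bounds(1)[OF cpN k] by (simp add: s_def signal_strength_eq x_def powr_mult)
      finally have "detection_level w N / jump_size (\<mu> N) k \<le> (\<kappa> * min_spacing (c N) k) powr x"
        using jump_size_pos[OF cpN k] by (simp add: divide_le_eq)
      then have "(detection_level w N / jump_size (\<mu> N) k) powr (1 / x) \<le> ((\<kappa> * min_spacing (c N) k) powr x) powr (1 / x)"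
        using x jump_size_pos[OF cpN k] detection_level_pos[OF elim(1), of w] by (intro powr_mono2) auto
      also have "\<dots> = \<kappa> * min_spacing (c N) k"
        using x \<kappa> min_spacing_bounds(1)[OF cpN k] by (simp add: powr_powr)
      finally show "localization_rate w N (jump_size (\<mu> N) k) \<le> \<kappa> * min_spacing (c N) k"
        using localization_rate_eq[OF w jump_size_pos[OF cpN k] elim(1)] by (simp add: x_def)
    qed
  qed
qed

text \<open>Bounded means bound the jumps, while the detection level diverges. The lower bound 1
  lets the rate absorb the additive rounding error in the choice of an integer scale.\<close>

lemma localization_rate_ge_1:
  assumes w: "valid_weight w" and cp: "\<And>N. N \<ge> 1 \<Longrightarrow> change_points N (K N) (c N) (\<mu> N)"
    and bounded: "\<exists>B. \<forall>N\<ge>1. \<forall>k\<in>{1..K N + 1}. norm (\<mu> N k) \<le> B"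
  shows "\<forall>\<^sub>F N in sequentially. \<forall>k\<in>{1..K N}. 1 \<le> localization_rate w N (jump_size (\<mu> N) k)"
proof -
  obtain B where B: "\<And>N k. N \<ge> 1 \<Longrightarrow> k \<in> {1..K N + 1} \<Longrightarrow> norm (\<mu> N k) \<le> B" using bounded by blast
  have "\<forall>\<^sub>F N in sequentially. 2 * B \<le> detection_level w N"
    using detection_level_at_top[OF w] by (simp add: filterlim_at_top)
  with eventually_ge_at_top[of 2] show ?thesis
  proof eventually_elim
    case (elim N)
    show ?case
    proof
      fix k assume k: "k \<in> {1..K N}"
      have pos: "0 < jump_size (\<mu> N) k" using elim by (intro jump_size_pos[OF cp k]) simp
      have "jump_size (\<mu> N) k \<le> norm (\<mu> N (k + 1)) + norm (\<mu> N k)"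
        unfolding jump_size_def by (rule norm_triangle_ineq4)
      also have "\<dots> \<le> B + B" using elim k by (intro add_mono B) auto
      finally have "1 \<le> detection_level w N / jump_size (\<mu> N) k" using elim pos by (simp add: le_divide_eq)
      then show "1 \<le> localization_rate w N (jump_size (\<mu> N) k)"
        unfolding localization_rate_eq[OF w pos elim(1)] using signal_exponent_pos[OF w] by (intro ge_one_powr_ge_zero) auto
    qed
  qed
qed

text \<open>The hypothesis on \<open>h\<close> is the inequality
  \<open>h powr x * \<Delta> / detection_level w N \<ge> 2 * q\<close> solved for \<open>h\<close>;
  \<open>scan_signal_lower_bound\<close> passes from there to the actual normalisation.\<close>

lemma signal_at_localization_rate:
  fixes h \<Delta> q :: real
  assumes w: "valid_weight w" and \<Delta>: "0 < \<Delta>" and q: "0 < q" and h: "1 \<le> h" "2 * h \<le> real N"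
    and rate: "(2 * q) powr (1 / signal_exponent w) * localization_rate w N \<Delta> \<le> h"
  shows "2 * q \<le> h * \<Delta> / (sqrt (real N) * rho w (h / real N))"
proof -
  define x where "x = signal_exponent w"
  have x: "0 < x" using signal_exponent_pos[OF w] by (simp add: x_def)
  have N: "2 \<le> N" using h by linarith
  have D: "0 < detection_level w N" by (rule detection_level_pos[OF N])
  have "(2 * q) * (detection_level w N / \<Delta>) = ((2 * q) powr (1 / x) * (detection_level w N / \<Delta>) powr (1 / x)) powr x"
    using q D \<Delta> x by (simp add: powr_mult powr_powr)
  also have "\<dots> \<le> h powr x"
    using rate q D \<Delta> x unfolding localization_rate_eq[OF w \<Delta> N] x_def[symmetric] by (intro powr_mono2) auto
  finally have "2 * q \<le> h powr x * \<Delta> / detection_level w N" using D \<Delta> by (simp add: field_simps)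
  also have "\<dots> \<le> h * \<Delta> / (sqrt (real N) * rho w (h / real N))"
    using scan_signal_lower_bound[OF w h] \<Delta> by (simp add: x_def)
  finally show ?thesis .
qed

lemma scan_noise_le:
  assumes p: "(n, h) \<in> all_pairs N" and D: "(real_of_int n / real N, real_of_int h / real N) \<in> D"
    and osc: "osc w D (partial_sum_process \<epsilon> N \<omega>) \<le> ennreal b" and b: "0 \<le> b"
  shows "scan_statistic w N (\<lambda>n. \<epsilon> N n \<omega>) (n, h) \<le> b"
proof -
  have "ennreal (scan_statistic w N (\<lambda>n. \<epsilon> N n \<omega>) (n, h)) \<le> osc w D (partial_sum_process \<epsilon> N \<omega>)"
    unfolding scan_statistic_eq_second_difference[OF p] osc_def
    by (rule SUP_upper2[OF D]) simp
  then have "ennreal (scan_statistic w N (\<lambda>n. \<epsilon> N n \<omega>) (n, h)) \<le> ennreal b" using osc by (rule order_trans)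
  then show ?thesis using b by (simp add: ennreal_le_iff)
qed

theorem theorem2p5:
  fixes w :: weight
    and M :: "nat \<Rightarrow> 'a measure"
    and \<epsilon> :: "nat \<Rightarrow> int \<Rightarrow> 'a \<Rightarrow> 'b :: {banach, second_countable_topology}"
    and K :: "nat \<Rightarrow> nat"
    and c :: "nat \<Rightarrow> nat \<Rightarrow> int"
    and \<mu> :: "nat \<Rightarrow> nat \<Rightarrow> 'b"
    and M' :: "'c measure"
    and W :: "'c \<Rightarrow> real \<Rightarrow> 'b"
    and pairs :: "nat \<Rightarrow> (int \<times> int) set"
    and C :: "nat \<Rightarrow> 'a \<Rightarrow> (int \<times> int) set"
    and \<alpha> :: real
  assumes weight: "valid_weight w"
    and prob: "\<And>N. N \<ge> 1 \<Longrightarrow> prob_space (M N)"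
    and centered: "\<And>N n. N \<ge> 1 \<Longrightarrow> n \<in> {1..int N} \<Longrightarrow>
          integrable (M N) (\<epsilon> N n) \<and> (\<integral>\<omega>. \<epsilon> N n \<omega> \<partial>M N) = 0"
    and model: "\<And>N. N \<ge> 1 \<Longrightarrow> change_points N (K N) (c N) (\<mu> N)"
    and prob_limit: "prob_space M'"
    and convergence: "holder_convergence w M \<epsilon> M' W"
    and means_bounded: "\<exists>B. \<forall>N\<ge>1. \<forall>k\<in>{1..K N + 1}. norm (\<mu> N k) \<le> B"
    and signal: "signal_dominates w K c \<mu>"
    and index_sets: "(\<forall>N. pairs N = all_pairs N) \<or>
          (\<exists>\<theta>>1. \<exists>m\<^sub>0\<in>{0, 1}. \<forall>N. pairs N = geometric_pairs m\<^sub>0 \<theta> N)"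
    and \<alpha>: "\<alpha> \<in> {0<..<1}"
    and C_measurable: "\<And>N. N \<ge> 1 \<Longrightarrow> C N \<in> measurable (M N) (count_space UNIV)"
    and C_output: "\<And>N \<omega>. N \<ge> 1 \<Longrightarrow> \<omega> \<in> space (M N) \<Longrightarrow>
          multiscan (scan_statistic w N (\<lambda>n. observation (K N) (c N) (\<mu> N) (\<epsilon> N) n \<omega>))
            (quantile M' (\<lambda>\<omega>'. limit_statistic w (W \<omega>')) (1 - \<alpha>))
            {} (pairs N) (C N \<omega>)"
  shows "liminf (\<lambda>N. ereal (measure (M N) {\<omega> \<in> space (M N).
             \<forall>p\<in>C N \<omega>. \<exists>k\<in>{1..K N}. c N k \<in> pair_interval p})) \<ge> ereal (1 - \<alpha>) \<and>
         (\<exists>C\<^sub>0>0. (\<lambda>N. measure (M N) {\<omega> \<in> space (M N).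
             \<forall>k\<in>{1..K N}.
               (\<exists>!p. p \<in> C N \<omega> \<and> c N k \<in> pair_interval p) \<and>
               (\<forall>n h. (n, h) \<in> C N \<omega> \<and> c N k \<in> pair_interval (n, h) \<longrightarrow>
                  real_of_int h \<le> C\<^sub>0 * localization_rate w N (jump_size (\<mu> N) k))})
           \<longlonglongrightarrow> 1)"
proof -
  obtain D where D: "countable D" "D \<subseteq> scan_triangle" "scan_triangle \<subseteq> closure D"
    and grid: "\<And>N n h. (n, h) \<in> all_pairs N \<Longrightarrow> (real_of_int n / real N, real_of_int h / real N) \<in> D"
    using countable_scan_net by blast
  have weak: "weakly_converges_to (holder_topology w) M (partial_sum_process \<epsilon>) M' W"
    and gauss: "centered_gaussian_process M' W"
    and W: "W \<in> measurable M' (holder_borel w)"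
    and nondeg: "\<not> (AE \<omega> in M'. \<forall>p\<in>scan_triangle. second_difference (W \<omega>) p = 0)"
    using convergence unfolding holder_convergence_def by auto
  have paths: "W \<omega> \<in> holder_space w" if "\<omega> \<in> space M'" for \<omega>
    using measurable_space[OF W that] by (simp add: holder_borel_def space_measure_of_conv)
  interpret L: gaussian_limit M' w W D
    using prob_limit weight gauss paths nondeg D by (simp add: gaussian_limit_def gaussian_limit_axioms_def)
  define q where "q = quantile M' (\<lambda>\<omega>'. limit_statistic w (W \<omega>')) (1 - \<alpha>)"
  have q: "0 < q" "\<And>\<eta>. 0 < \<eta> \<Longrightarrow> \<exists>a. 0 \<le> a \<and> a < q \<and> 1 - \<alpha> - \<eta> \<le> measure M' {\<omega> \<in> space M'. osc w D (W \<omega>) \<le> ennreal a}"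
    using L.quantile_properties[of \<alpha>] \<alpha> by (auto simp: q_def)
  have osc_measurable: "(\<lambda>\<omega>. osc w D' (partial_sum_process \<epsilon> N \<omega>)) \<in> borel_measurable (M N)"
    if "N \<ge> 1" "D' \<subseteq> D" for N D'
  proof (rule measurable_osc)
    show "countable D'" "D' \<subseteq> scan_triangle" using that D by (auto intro: countable_subset)
    fix x :: real assume "x \<in> {0..1}"
    then show "(\<lambda>\<omega>. partial_sum_process \<epsilon> N \<omega> x) \<in> borel_measurable (M N)"
      using that centered[OF that(1)] by (intro measurable_partial_sum_process borel_measurable_integrable) auto
  qed
  \<comment> \<open>The output is measurable into a discrete space, so every predicate of it defines
    an event.\<close>
  have output_event: "{\<omega> \<in> space (M N). Q (C N \<omega>)} \<in> sets (M N)" if "N \<ge> 1" for N Q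
  proof -
    have "{\<omega> \<in> space (M N). Q (C N \<omega>)} = C N -` {R. Q R} \<inter> space (M N)" by auto
    then show ?thesis using measurable_sets[OF C_measurable[OF that], of "{R. Q R}"] by simp
  qed
  have pairs_all: "pairs N \<subseteq> all_pairs N" for N
    using index_sets by (auto simp: geometric_pairs_def)
  have scan: "multiscan (scan_statistic w N (\<lambda>n. observation (K N) (c N) (\<mu> N) (\<epsilon> N) n \<omega>)) q {} (pairs N) (C N \<omega>)"
    if "N \<ge> 1" "\<omega> \<in> space (M N)" for N \<omega>
    using C_output[OF that] by (simp add: q_def)

  have a: "ereal (1 - \<alpha>) \<le> liminf (\<lambda>N. ereal (measure (M N) {\<omega> \<in> space (M N).
             \<forall>p\<in>C N \<omega>. \<exists>k\<in>{1..K N}. c N k \<in> pair_interval p}))" (is "_ \<le> liminf ?m")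
  proof (rule ereal_le_epsilon2)
    fix \<eta> :: real assume \<eta>: "0 < \<eta>"
    \<comment> \<open>The limit event is taken at \<open>b < q\<close>, so that the finite-sample
      event can be stated at the threshold \<open>q\<close> itself.\<close>
    obtain b where b: "0 \<le> b" "b < q" "1 - \<alpha> - \<eta> / 2 \<le> measure M' {\<omega> \<in> space M'. osc w D (W \<omega>) \<le> ennreal b}"
      using q(2)[of "\<eta> / 2"] \<eta> by auto
    have "\<forall>\<^sub>F N in sequentially. measure M' {\<omega> \<in> space M'. osc w D (W \<omega>) \<le> ennreal b} - \<eta> / 2 \<le>
      measure (M N) {\<omega> \<in> space (M N). osc w D (partial_sum_process \<epsilon> N \<omega>) \<le> ennreal q}"
      using \<eta> by (intro weak_convergence_osc[OF weight D(2) weak prob prob_limit _ _ b(1,2)] osc_measurable L.measurable_osc_path) auto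
    with eventually_ge_at_top[of 1] have "\<forall>\<^sub>F N in sequentially. ereal (1 - \<alpha> - \<eta>) \<le> ?m N"
    proof eventually_elim
      case (elim N)
      interpret MN: prob_space "M N" using elim by (intro prob)
      have "measure (M N) {\<omega> \<in> space (M N). osc w D (partial_sum_process \<epsilon> N \<omega>) \<le> ennreal q} \<le>
        measure (M N) {\<omega> \<in> space (M N). \<forall>p\<in>C N \<omega>. \<exists>k\<in>{1..K N}. c N k \<in> pair_interval p}"
      proof (rule MN.finite_measure_mono[OF _ output_event[OF elim(1)]], safe)
        fix \<omega> n h assume \<omega>: "\<omega> \<in> space (M N)" and le: "osc w D (partial_sum_process \<epsilon> N \<omega>) \<le> ennreal q" and nh: "(n, h) \<in> C N \<omega>"
        have "scan_statistic w N (\<lambda>n. \<epsilon> N n \<omega>) p \<le> q" if "p \<in> all_pairs N" for p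
          using scan_noise_le[OF _ grid le] that q(1) by (cases p) auto
        then show "\<exists>k\<in>{1..K N}. c N k \<in> pair_interval (n, h)"
          by (rule multiscan_no_false_positives[OF model[OF elim(1)] pairs_all scan[OF elim(1) \<omega>] _ nh])
      qed
      then show ?case using elim(2) b(3) by simp
    qed
    then have "ereal (1 - \<alpha> - \<eta>) \<le> liminf ?m" by (rule Liminf_bounded)
    then have "ereal (1 - \<alpha> - \<eta>) + ereal \<eta> \<le> liminf ?m + ereal \<eta>" by (rule add_right_mono)
    then show "ereal (1 - \<alpha>) \<le> liminf ?m + ereal \<eta>" by simp
  qed

  define r where "r N k = localization_rate w N (jump_size (\<mu> N) k)" for N k
  \<comment> \<open>Both kinds of index sets contain the scales given by \<open>m \<ge> 1\<close>,
    under either convention for the least exponent. If all pairs are scanned, the ratio 2 is an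
    arbitrary choice.\<close>
  obtain \<theta> :: real where \<theta>: "1 < \<theta>" "\<And>N n m. 1 \<le> m \<Longrightarrow> (n, \<lfloor>\<theta> ^ m\<rfloor>) \<in> all_pairs N \<Longrightarrow> (n, \<lfloor>\<theta> ^ m\<rfloor>) \<in> pairs N"
  proof (cases "\<forall>N. pairs N = all_pairs N")
    case True
    then show ?thesis using that[of 2] by simp
  next
    case False
    then obtain \<theta> m\<^sub>0 where "1 < \<theta>" "m\<^sub>0 \<in> {0, 1}" "\<forall>N. pairs N = geometric_pairs m\<^sub>0 \<theta> N" using index_sets by blast
    then show ?thesis using that[of \<theta>] by (auto simp: geometric_pairs_def)
  qed
  define C\<^sub>q where "C\<^sub>q = (2 * q) powr (1 / signal_exponent w)"
  have Cq: "0 < C\<^sub>q" using q(1) by (simp add: C\<^sub>q_def)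
  \<comment> \<open>The \<open>+ 1\<close> pays for the floor, as the rate is at least 1; the factor
    \<open>\<theta>\<close> is the overshoot of the next power.\<close>
  define C\<^sub>0 where "C\<^sub>0 = \<theta> * (C\<^sub>q + 1)"
  have C0: "0 < C\<^sub>0" using \<theta>(1) Cq by (simp add: C\<^sub>0_def)

  let ?E = "\<lambda>N. {\<omega> \<in> space (M N). \<forall>k\<in>{1..K N}.
               (\<exists>!p. p \<in> C N \<omega> \<and> c N k \<in> pair_interval p) \<and>
               (\<forall>n h. (n, h) \<in> C N \<omega> \<and> c N k \<in> pair_interval (n, h) \<longrightarrow>
                  real_of_int h \<le> C\<^sub>0 * localization_rate w N (jump_size (\<mu> N) k))}"
  \<comment> \<open>The factor \<open>1 / 4\<close> yields
    \<open>4 * h \<le> min_spacing (c N) k\<close>, hence room for the separation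
    \<open>3 * h\<close> and for \<open>2 * h \<le> N\<close>. The factor \<open>\<delta>\<close>
    places all scales up to \<open>h\<close> in the range where the oscillation is
    controlled.\<close>
  have localized: "\<omega> \<in> ?E N"
    if N: "N \<ge> 1" and \<omega>: "\<omega> \<in> space (M N)" and \<delta>: "0 < \<delta>"
      and rate_ge: "\<forall>k\<in>{1..K N}. 1 \<le> r N k"
      and rate_le: "\<forall>k\<in>{1..K N}. r N k \<le> min (1 / 4) \<delta> / C\<^sub>0 * min_spacing (c N) k"
      and osc_le: "osc w {p \<in> D. snd p \<le> \<delta>} (partial_sum_process \<epsilon> N \<omega>) \<le> ennreal (q / 2)" for N \<omega> \<delta>
  proof -
    note cp = model[OF N]
    have "(\<exists>!p. p \<in> C N \<omega> \<and> c N k \<in> pair_interval p) \<and>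
      (\<forall>n h. (n, h) \<in> C N \<omega> \<and> c N k \<in> pair_interval (n, h) \<longrightarrow> real_of_int h \<le> C\<^sub>0 * r N k)"
      if k: "k \<in> {1..K N}" for k
    proof -
      have rk: "1 \<le> r N k" using rate_ge k by blast
      have "C\<^sub>0 * r N k \<le> min (1 / 4) \<delta> * min_spacing (c N) k"
        using rate_le k C0 by (auto simp: field_simps)
      moreover have spacing: "0 < min_spacing (c N) k" "min_spacing (c N) k \<le> c N k" "c N k + min_spacing (c N) k \<le> int N"
        by (rule min_spacing_bounds[OF cp k])+
      moreover have "min (1 / 4) \<delta> * min_spacing (c N) k \<le> 1 / 4 * min_spacing (c N) k"
        "min (1 / 4) \<delta> * min_spacing (c N) k \<le> \<delta> * min_spacing (c N) k"
        using spacing by (auto intro!: mult_right_mono)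
      ultimately have small: "C\<^sub>0 * r N k \<le> min_spacing (c N) k / 4" "C\<^sub>0 * r N k \<le> \<delta> * min_spacing (c N) k" by linarith+
      have "0 < C\<^sub>q * r N k" using Cq rk by simp
      \<comment> \<open>The added 1 ensures that the floor of the power is still at least
        \<open>C\<^sub>q * r N k\<close>.\<close>
      then obtain m where m: "1 \<le> m" "C\<^sub>q * r N k + 1 \<le> \<theta> ^ m" "\<theta> ^ m \<le> \<theta> * (C\<^sub>q * r N k + 1)"
        using geometric_scale[OF \<theta>(1), of "C\<^sub>q * r N k + 1"] by auto
      define h where "h = \<lfloor>\<theta> ^ m\<rfloor>"
      have h: "C\<^sub>q * r N k \<le> h" "h \<le> \<theta> ^ m" using m(2) unfolding h_def by linarith+
      have "\<theta> * (C\<^sub>q * r N k + 1) \<le> \<theta> * (C\<^sub>q * r N k + r N k)" using rk \<theta>(1) by simp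
      then have h_le: "real_of_int h \<le> C\<^sub>0 * r N k" using h m(3) by (simp add: C\<^sub>0_def algebra_simps)
      have h_ge: "1 \<le> h" using m(2) \<open>0 < C\<^sub>q * r N k\<close> unfolding h_def by linarith
      have h_spacing: "4 * h \<le> min_spacing (c N) k" using h_le small by linarith
      have all: "(c N k, h) \<in> all_pairs N" using h_ge h_spacing spacing by (auto simp: all_pairs_def)
      have "real N > 0" using N by simp
      have "real_of_int h \<le> \<delta> * min_spacing (c N) k" using h_le small by linarith
      also have "\<dots> \<le> \<delta> * real N" using spacing \<delta> by (intro mult_left_mono) linarith+
      finally have h_\<delta>: "real_of_int h \<le> \<delta> * real N" .
      have noise: "scan_statistic w N (\<lambda>n. \<epsilon> N n \<omega>) (n, h') \<le> q / 2" if "(n, h') \<in> all_pairs N" "h' \<le> h" for n h'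
      proof (rule scan_noise_le[OF that(1) _ osc_le])
        have "real_of_int h' \<le> \<delta> * real N" using that h_\<delta> by linarith
        then have "real_of_int h' / real N \<le> \<delta>" using \<open>real N > 0\<close> by (simp add: divide_le_eq)
        then show "(real_of_int n / real N, real_of_int h' / real N) \<in> {p \<in> D. snd p \<le> \<delta>}"
          using grid[OF that(1)] by simp
      qed (use q(1) in simp)
      have strong: "2 * q \<le> h * jump_size (\<mu> N) k / (sqrt N * rho w (h / N))"
        using h h_ge h_spacing spacing
        by (intro signal_at_localization_rate[OF weight jump_size_pos[OF cp k] q(1)]) (auto simp: C\<^sub>q_def r_def)
      have pk: "(c N k, h) \<in> pairs N" using \<theta>(2)[OF m(1)] all by (simp add: h_def)
      have h3: "3 * h < min_spacing (c N) k" using h_spacing h_ge by linarith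
      note localizes = multiscan_localizes[OF cp pairs_all scan[OF N \<omega>] k pk h3 q(1) strong noise]
      have "real_of_int h' \<le> C\<^sub>0 * r N k" if "(n, h') \<in> C N \<omega>" "c N k \<in> pair_interval (n, h')" for n h'
        using localizes(2)[OF _ _ that] h_le by linarith
      moreover have "\<exists>!p. p \<in> C N \<omega> \<and> c N k \<in> pair_interval p" by (rule localizes(1))
      ultimately show ?thesis by blast
    qed
    then show ?thesis using \<omega> by (simp add: r_def)
  qed
  have b: "(\<lambda>N. measure (M N) (?E N)) \<longlonglongrightarrow> 1"
  proof (rule tendstoI)
    fix \<eta> :: real assume \<eta>: "0 < \<eta>"
    \<comment> \<open>The level \<open>q / 4\<close> leaves the gap to \<open>q / 2\<close> for the
      ramp, and two losses of \<open>\<eta> / 3\<close> stay below \<open>\<eta>\<close>.\<close>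
    obtain \<delta> where \<delta>: "0 < \<delta>" "1 - \<eta> / 3 \<le> measure M' {\<omega> \<in> space M'. osc w {p \<in> D. snd p \<le> \<delta>} (W \<omega>) \<le> ennreal (q / 4)}"
      using L.prob_osc_small_scale[of "q / 4" "\<eta> / 3"] q(1) \<eta> by auto
    have sub: "{p \<in> D. snd p \<le> \<delta>} \<subseteq> D" by auto
    have "\<forall>\<^sub>F N in sequentially. measure M' {\<omega> \<in> space M'. osc w {p \<in> D. snd p \<le> \<delta>} (W \<omega>) \<le> ennreal (q / 4)} - \<eta> / 3 \<le>
      measure (M N) {\<omega> \<in> space (M N). osc w {p \<in> D. snd p \<le> \<delta>} (partial_sum_process \<epsilon> N \<omega>) \<le> ennreal (q / 2)}"
      using \<eta> q(1) sub D(2)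
      by (intro weak_convergence_osc[OF weight _ weak prob prob_limit] osc_measurable L.measurable_osc_path) auto
    moreover have "\<forall>\<^sub>F N in sequentially. \<forall>k\<in>{1..K N}. r N k \<le> min (1 / 4) \<delta> / C\<^sub>0 * min_spacing (c N) k"
    proof -
      have pos: "0 < min (1 / 4) \<delta> / C\<^sub>0" using \<delta>(1) C0 by simp
      show ?thesis
        unfolding r_def by (rule localization_rate_small[OF weight _ signal pos]) (rule model)
    qed
    moreover have "\<forall>\<^sub>F N in sequentially. \<forall>k\<in>{1..K N}. 1 \<le> r N k"
      unfolding r_def by (rule localization_rate_ge_1[OF weight model means_bounded])
    ultimately show "\<forall>\<^sub>F N in sequentially. dist (measure (M N) (?E N)) 1 < \<eta>"
      using eventually_ge_at_top[of 1]
    proof eventually_elim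
      case (elim N)
      interpret MN: prob_space "M N" using elim by (intro prob)
      have "measure (M N) {\<omega> \<in> space (M N). osc w {p \<in> D. snd p \<le> \<delta>} (partial_sum_process \<epsilon> N \<omega>) \<le> ennreal (q / 2)} \<le> measure (M N) (?E N)"
      proof (rule MN.finite_measure_mono[OF subsetI output_event[OF elim(4)]])
        fix \<omega> assume "\<omega> \<in> {\<omega> \<in> space (M N). osc w {p \<in> D. snd p \<le> \<delta>} (partial_sum_process \<epsilon> N \<omega>) \<le> ennreal (q / 2)}"
        then show "\<omega> \<in> ?E N" using elim(2,3) by (intro localized[OF elim(4) _ \<delta>(1)]) auto
      qed
      moreover have "measure (M N) (?E N) \<le> 1" by (rule MN.prob_le_1)
      ultimately show ?case using elim(1) \<delta>(2) \<eta> by (simp add: dist_real_def)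
    qed
  qed
  show ?thesis using a b C0 by blast
qed

end
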